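(* Let $\omega$ be a non-principal ultrafilter over $\mathbb N$. There exist a sequence $(n_k)_{k\in\mathbb N}$ of positive integers and a sofic representation $\theta\colon\mathbb F_2\hookrightarrow\Pi_{k\to\omega}S_{n_k}$ of the free group $\mathbb F_2$ of rank $2$ such that $[\theta]$ is an extreme point of the convex structure $Sof(\mathbb F_2,P^\omega)$ and such that the commutant $\theta(\mathbb F_2)'=\{p\in\Pi_{k\to\omega}S_{n_k}:p\theta(w)=\theta(w)p\ \forall w\in\mathbb F_2\}$ is trivial, i.e. contains only the identity element.
   Context: $S_n$ is the symmetric group on $\{1,\ldots,n\}$ with identity $1_n$ (identified with the group $P_n$ of $n\times n$ permutation matrices), and $d_H(p,q)=\frac1n\mathrm{Card}\{i:p(i)\neq q(i)\}$. The universal sofic group is $\Pi_{k\to\omega}S_{n_k}=\Pi_{k\in\mathbb N}S_{n_k}/\{(p_k)_k:\lim_{k\to\omega}d_H(p_k,1_{n_k})=0\}$, with identity $1_\omega$ and metric $d_\omega((p_k)_k,(q_k)_k)=\lim_{k\to\omega}d_H(p_k,q_k)$. A sofic representation of a countable group $G$ is a homomorphism $\theta\colon G\to\Pi_{k\to\omega}S_{n_k}$ with $d_\omega(\theta(g),1_\omega)=1$ for every $1_G\neq g\in G$. Amplifications and direct sums: for $\theta=\Pi_{k\to\omega}\theta_k$ (with $\theta_k\colon G\to S_{n_k}$ any maps representing $\theta$) and a sequence $(r_k)$ of positive integers, $\theta\otimes 1_{r_k}\colon G\to\Pi_{k\to\omega}S_{n_kr_k}$ is $g\mapsto\Pi_{k\to\omega}(\theta_k(g)\otimes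 1_{r_k})$, where $p\otimes 1_r\in S_{nr}$ is the permutation acting as $p$ on each of $r$ disjoint copies of $\{1,\ldots,n\}$; for $\theta=\Pi_{k\to\omega}\theta_k$ into $\Pi_{k\to\omega}S_{n_k}$ and $\psi=\Pi_{k\to\omega}\psi_k$ into $\Pi_{k\to\omega}S_{m_k}$, $\theta\oplus\psi=\Pi_{k\to\omega}(\theta_k\oplus\psi_k)\colon G\to\Pi_{k\to\omega}S_{n_k+m_k}$, acting on disjoint unions. $Sof(G,P^\omega)$ is the set of classes $[\theta]$ of sofic representations of $G$ (all sequences of dimensions allowed, $\omega$ fixed), where $\theta\colon G\to\Pi_{k\to\omega}S_{n_k}$ and $\psi\colon G\to\Pi_{k\to\omega}S_{m_k}$ are equivalent if there are sequences $(r_k),(t_k)$ of positive integers with $n_kr_k=m_kt_k$ such that $\theta\otimes1_{r_k}$ and $\psi\otimes1_{t_k}$ are conjugate by an element of $\Pi_{k\to\omega}S_{n_kr_k}$. Its convex structure: for $\lambda\in(0,1)$, $\lambda[\theta]+(1-\lambda)[\psi]=[(\theta\otimes1_{r_k})\oplus(\psi\otimes1_{t_k})]$, where $(r_k),(t_k)$ are any sequences of positive integers with $\lim_{k\to\omega}\frac{n_kr_k}{n_kr_k+m_kt_k}=\lambda$ (the result does not depend on the choices). A class $[\theta]$ is an extreme point if $[\theta]=\lambda[\psi_1]+(1-\lambda)[\psi_2]$ with $\lambda\in(0,1)$ and $[\psi_1],[\psi_2]\in Sof(G,P^\omega)$ implies $[\psi_1]=[\psi_2]=[\theta]$. *)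

theory Defs
  imports "HOL-Analysis.Elementary_Topology" "HOL-Algebra.Product_Groups" "HOL-Algebra.Sym_Groups"
begin

section \<open>Ultrafilters on the natural numbers\<close>

definition ultrafilter :: "nat filter \<Rightarrow> bool" where
  "ultrafilter \<omega> \<longleftrightarrow> \<omega> \<noteq> bot \<and>
     (\<forall>P. eventually P \<omega> \<or> eventually (\<lambda>k. \<not> P k) \<omega>)"

definition nonprincipal_ultrafilter :: "nat filter \<Rightarrow> bool" where
  "nonprincipal_ultrafilter \<omega> \<longleftrightarrow> ultrafilter \<omega> \<and> (\<forall>j. eventually (\<lambda>k. k \<noteq> j) \<omega>)"

lemma ultrafilter_not: "ultrafilter \<omega> \<Longrightarrow> \<not> eventually P \<omega> \<Longrightarrow> eventually (\<lambda>k. \<not> P k) \<omega>"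
  unfolding ultrafilter_def by (drule conjunct2, drule spec[of _ P]) simp

lemma ultrafilter_tendsto_compact:
  fixes f :: "nat \<Rightarrow> 'a::topological_space"
  assumes "ultrafilter \<omega>" "compact K" "\<And>k. f k \<in> K"
  shows "\<exists>l\<in>K. (f \<longlongrightarrow> l) \<omega>"
proof -
  have "filtermap f \<omega> \<noteq> bot" using assms(1) by (simp add: ultrafilter_def filtermap_bot_iff)
  moreover have "eventually (\<lambda>x. x \<in> K) (filtermap f \<omega>)"
    using assms(3) by (simp add: eventually_filtermap)
  ultimately obtain l where l: "l \<in> K" "inf (nhds l) (filtermap f \<omega>) \<noteq> bot"
    using assms(2)[unfolded compact_filter, rule_format, of "filtermap f \<omega>"] by blast
  have "(f \<longlongrightarrow> l) \<omega>"
  proof (rule topological_tendstoI, rule ccontr)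
    fix S assume S: "open S" "l \<in> S" and "\<not> (\<forall>\<^sub>F x in \<omega>. f x \<in> S)"
    then have "eventually (\<lambda>x. f x \<notin> S) \<omega>" using ultrafilter_not[OF assms(1)] by simp
    then have "eventually (\<lambda>x. x \<notin> S) (filtermap f \<omega>)" by (simp add: eventually_filtermap)
    then have "eventually (\<lambda>x. x \<notin> S) (inf (nhds l) (filtermap f \<omega>))"
      by (rule filter_leD[OF inf_le2])
    moreover have "eventually (\<lambda>x. x \<in> S) (inf (nhds l) (filtermap f \<omega>))"
      by (rule filter_leD[OF inf_le1]) (rule eventually_nhds_in_open[OF S])
    ultimately have "eventually (\<lambda>_. False) (inf (nhds l) (filtermap f \<omega>))"
      by eventually_elim simp
    then show False using l(2) by (simp add: eventually_False)
  qed
  then show ?thesis using l(1) by blast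
qed


section \<open>Free groups\<close>

text \<open>The letter \<open>(x, True)\<close> stands for the generator \<open>x\<close> and \<open>(x, False)\<close> for its formal
  inverse.  Elements of the free group are the reduced words, and the product of two reduced
  words is the reduced form of their concatenation.\<close>

definition cancels :: "'a \<times> bool \<Rightarrow> 'a \<times> bool \<Rightarrow> bool" where
  "cancels a b \<longleftrightarrow> fst a = fst b \<and> snd a \<noteq> snd b"

definition reduced :: "('a \<times> bool) list \<Rightarrow> bool" where
  "reduced w \<longleftrightarrow> successively (\<lambda>a b. \<not> cancels a b) w"

fun cons_reduce :: "'a \<times> bool \<Rightarrow> ('a \<times> bool) list \<Rightarrow> ('a \<times> bool) list" where
  "cons_reduce a [] = [a]"
| "cons_reduce a (b # w) = (if cancels a b then w else a # b # w)"

definition free_group :: "'a set \<Rightarrow> ('a \<times> bool) list monoid" where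
  "free_group S = \<lparr> carrier = {w. reduced w \<and> fst ` set w \<subseteq> S},
     monoid.mult = (\<lambda>u v. foldr cons_reduce u v), one = [] \<rparr>"

definition F2 :: "(bool \<times> bool) list monoid" where
  "F2 = free_group (UNIV :: bool set)"

lemma reduced_Cons: "reduced (a # w) \<longleftrightarrow> (w = [] \<or> \<not> cancels a (hd w)) \<and> reduced w"
  by (cases w) (auto simp: reduced_def)

lemma reduced_cons_reduce: "reduced w \<Longrightarrow> reduced (cons_reduce a w)"
  by (cases w) (auto simp: reduced_Cons)

lemma reduced_foldr: "reduced v \<Longrightarrow> reduced (foldr cons_reduce u v)"
  by (induction u) (auto intro: reduced_cons_reduce)

lemma set_cons_reduce: "set (cons_reduce a w) \<subseteq> insert a (set w)"
  by (cases w) auto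

lemma set_foldr_cons_reduce: "set (foldr cons_reduce u v) \<subseteq> set u \<union> set v"
proof (induction u)
  case (Cons a u)
  then show ?case using set_cons_reduce[of a "foldr cons_reduce u v"] by auto
qed auto

lemma cons_reduce_cancel:
  assumes "cancels a b" "reduced w"
  shows "cons_reduce a (cons_reduce b w) = w"
proof (cases w)
  case (Cons c v)
  show ?thesis
  proof (cases "cancels b c")
    case True
    then have "c = a" using assms(1) by (auto simp: cancels_def prod_eq_iff)
    then show ?thesis using Cons True assms by (cases v) (auto simp: reduced_Cons)
  qed (use assms Cons in auto)
qed (use assms in auto)

lemma foldr_cons_reduce_Nil: "reduced u \<Longrightarrow> foldr cons_reduce u [] = u"
proof (induction u)
  case (Cons a u)
  then show ?case by (cases u) (auto simp: reduced_Cons)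
qed auto

lemma foldr_cons_reduce_assoc:
  assumes "reduced v" "reduced w"
  shows "foldr cons_reduce (foldr cons_reduce u v) w = foldr cons_reduce u (foldr cons_reduce v w)"
proof (induction u)
  case (Cons a u)
  define x where "x = foldr cons_reduce u v"
  have "reduced x" unfolding x_def by (rule reduced_foldr[OF assms(1)])
  have "foldr cons_reduce (cons_reduce a x) w = cons_reduce a (foldr cons_reduce x w)"
  proof (cases x)
    case (Cons b y)
    then show ?thesis
      using cons_reduce_cancel[of a b "foldr cons_reduce y w"] reduced_foldr[OF assms(2), of y]
      by simp
  qed simp
  then show ?case using Cons by (simp add: x_def)
qed simp

lemma foldr_cons_reduce_inverse:
  "foldr cons_reduce (rev (map (\<lambda>(x, s). (x, \<not> s)) w)) w = []"
  by (induction w) (auto simp: cancels_def)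

lemma reduced_inverse: "reduced w \<Longrightarrow> reduced (rev (map (\<lambda>(x, s). (x, \<not> s)) w))"
  unfolding reduced_def successively_rev successively_map
  by (erule successively_mono) (auto simp: cancels_def)

lemma group_free_group: "group (free_group S)"
proof (rule groupI)
  fix w assume w: "w \<in> carrier (free_group S)"
  show "\<exists>v\<in>carrier (free_group S). v \<otimes>\<^bsub>free_group S\<^esub> w = \<one>\<^bsub>free_group S\<^esub>"
    using w reduced_inverse[of w] foldr_cons_reduce_inverse[of w]
    by (intro bexI[of _ "rev (map (\<lambda>(x, s). (x, \<not> s)) w)"]) (auto simp: free_group_def)
next
  fix u v assume "u \<in> carrier (free_group S)" "v \<in> carrier (free_group S)"
  then show "u \<otimes>\<^bsub>free_group S\<^esub> v \<in> carrier (free_group S)"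
    using set_foldr_cons_reduce[of u v] by (fastforce simp: free_group_def reduced_foldr)
qed (auto simp: free_group_def foldr_cons_reduce_assoc reduced_def)

lemma group_F2: "group F2"
  unfolding F2_def by (rule group_free_group)


section \<open>Universal sofic groups\<close>

definition hamming_dist :: "nat \<Rightarrow> (nat \<Rightarrow> nat) \<Rightarrow> (nat \<Rightarrow> nat) \<Rightarrow> real" where
  "hamming_dist n p q = real (card {i \<in> {1..n}. p i \<noteq> q i}) / real n"

abbreviation perm_seqs :: "(nat \<Rightarrow> nat) \<Rightarrow> (nat \<Rightarrow> nat \<Rightarrow> nat) monoid" where
  "perm_seqs n \<equiv> product_group UNIV (\<lambda>k. sym_group (n k))"

definition null_seqs :: "nat filter \<Rightarrow> (nat \<Rightarrow> nat) \<Rightarrow> (nat \<Rightarrow> nat \<Rightarrow> nat) set" where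
  "null_seqs \<omega> n = {p \<in> carrier (perm_seqs n).
     ((\<lambda>k. hamming_dist (n k) (p k) \<one>\<^bsub>sym_group (n k)\<^esub>) \<longlongrightarrow> 0) \<omega>}"

definition sofic_group :: "nat filter \<Rightarrow> (nat \<Rightarrow> nat) \<Rightarrow> (nat \<Rightarrow> nat \<Rightarrow> nat) set monoid" where
  "sofic_group \<omega> n = perm_seqs n Mod null_seqs \<omega> n"

definition sofic_class ::
    "nat filter \<Rightarrow> (nat \<Rightarrow> nat) \<Rightarrow> (nat \<Rightarrow> nat \<Rightarrow> nat) \<Rightarrow> (nat \<Rightarrow> nat \<Rightarrow> nat) set" where
  "sofic_class \<omega> n p = null_seqs \<omega> n #>\<^bsub>perm_seqs n\<^esub> p"

definition sofic_dist ::
    "nat filter \<Rightarrow> (nat \<Rightarrow> nat) \<Rightarrow> (nat \<Rightarrow> nat \<Rightarrow> nat) set \<Rightarrow> (nat \<Rightarrow> nat \<Rightarrow> nat) set \<Rightarrow> real" where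
  "sofic_dist \<omega> n A B =
     (THE d. \<exists>p\<in>A. \<exists>q\<in>B. ((\<lambda>k. hamming_dist (n k) (p k) (q k)) \<longlongrightarrow> d) \<omega>)"

lemma group_perm_seqs: "group (perm_seqs n)"
  by (simp add: sym_group_is_group)

lemma carrier_perm_seqs: "p \<in> carrier (perm_seqs n) \<longleftrightarrow> (\<forall>k. p k permutes {1..n k})"
  by (simp add: sym_group_carrier PiE_UNIV_domain Pi_iff)

lemma mult_perm_seqs: "p \<otimes>\<^bsub>perm_seqs n\<^esub> q = (\<lambda>k. p k \<circ> q k)"
  by (simp add: sym_group_mult restrict_def)

lemma inv_perm_seqs:
  assumes "p \<in> carrier (perm_seqs n)"
  shows "inv\<^bsub>perm_seqs n\<^esub> p = (\<lambda>k. inv' (p k))"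
  using assms by (simp add: sym_group_is_group PiE_UNIV_domain restrict_def Pi_iff)

lemma hamming_dist_nonneg: "0 \<le> hamming_dist n p q"
  by (simp add: hamming_dist_def)

lemma hamming_dist_le_1: "hamming_dist n p q \<le> 1"
proof -
  have "card {i \<in> {1..n}. p i \<noteq> q i} \<le> card {1..n}" by (rule card_mono) auto
  then show ?thesis by (auto simp: hamming_dist_def divide_simps)
qed

lemma hamming_dist_commute: "hamming_dist n p q = hamming_dist n q p"
proof -
  have "{i \<in> {1..n}. p i \<noteq> q i} = {i \<in> {1..n}. q i \<noteq> p i}" by auto
  then show ?thesis by (simp only: hamming_dist_def)
qed

lemma hamming_dist_triangle:
  "hamming_dist n p r \<le> hamming_dist n p q + hamming_dist n q r"
proof -
  have "card {i \<in> {1..n}. p i \<noteq> r i}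
      \<le> card ({i \<in> {1..n}. p i \<noteq> q i} \<union> {i \<in> {1..n}. q i \<noteq> r i})"
    by (rule card_mono) auto
  also have "\<dots> \<le> card {i \<in> {1..n}. p i \<noteq> q i} + card {i \<in> {1..n}. q i \<noteq> r i}"
    by (rule card_Un_le)
  finally show ?thesis
    by (simp add: hamming_dist_def add_divide_distrib[symmetric] divide_right_mono)
qed

lemma hamming_dist_left:
  assumes "inj r"
  shows "hamming_dist n (r \<circ> p) (r \<circ> q) = hamming_dist n p q"
  using assms by (simp add: hamming_dist_def inj_eq)

lemma hamming_dist_right:
  assumes "r permutes {1..n}"
  shows "hamming_dist n (p \<circ> r) (q \<circ> r) = hamming_dist n p q"
proof -
  have "bij_betw r {i \<in> {1..n}. (p \<circ> r) i \<noteq> (q \<circ> r) i} {i \<in> {1..n}. p i \<noteq> q i}"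
    unfolding bij_betw_def
  proof
    show "inj_on r {i \<in> {1..n}. (p \<circ> r) i \<noteq> (q \<circ> r) i}"
      using permutes_inj[OF assms] by (rule inj_on_subset) simp
    show "r ` {i \<in> {1..n}. (p \<circ> r) i \<noteq> (q \<circ> r) i} = {i \<in> {1..n}. p i \<noteq> q i}"
    proof
      show "{i \<in> {1..n}. p i \<noteq> q i} \<subseteq> r ` {i \<in> {1..n}. (p \<circ> r) i \<noteq> (q \<circ> r) i}"
      proof
        fix i assume i: "i \<in> {i \<in> {1..n}. p i \<noteq> q i}"
        then obtain j where "j \<in> {1..n}" "i = r j" using permutes_image[OF assms] by blast
        with i show "i \<in> r ` {i \<in> {1..n}. (p \<circ> r) i \<noteq> (q \<circ> r) i}" by simp
      qed
      show "r ` {i \<in> {1..n}. (p \<circ> r) i \<noteq> (q \<circ> r) i} \<subseteq> {i \<in> {1..n}. p i \<noteq> q i}"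
        using permutes_in_image[OF assms] by fastforce
    qed
  qed
  from bij_betw_same_card[OF this] show ?thesis by (simp add: hamming_dist_def)
qed

lemma null_seqs_normal: "null_seqs \<omega> n \<lhd> perm_seqs n"
proof -
  interpret group "perm_seqs n" by (rule group_perm_seqs)
  let ?N = "null_seqs \<omega> n"
  have mem: "p \<in> ?N \<longleftrightarrow> (\<forall>k. p k permutes {1..n k})
      \<and> ((\<lambda>k. hamming_dist (n k) (p k) id) \<longlongrightarrow> 0) \<omega>" for p
    unfolding null_seqs_def mem_Collect_eq carrier_perm_seqs sym_group_one ..
  have "subgroup ?N (perm_seqs n)"
  proof (rule subgroupI)
    show "?N \<subseteq> carrier (perm_seqs n)" by (auto simp: null_seqs_def)
    have "(\<lambda>k. id) \<in> ?N" unfolding mem by (simp add: hamming_dist_def permutes_id)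
    then show "?N \<noteq> {}" by blast
  next
    fix p assume p: "p \<in> ?N"
    then have pp: "p k permutes {1..n k}" for k unfolding mem by blast
    have "hamming_dist (n k) (inv' (p k)) id = hamming_dist (n k) (p k) id" for k
      using hamming_dist_left[OF permutes_inj[OF pp[of k]], of "n k" "inv' (p k)" id]
      by (simp add: permutes_inv_o[OF pp] hamming_dist_commute)
    then have "(\<lambda>k. inv' (p k)) \<in> ?N" using p pp unfolding mem by (simp add: permutes_inv)
    then show "inv\<^bsub>perm_seqs n\<^esub> p \<in> ?N"
      using inv_perm_seqs[of p n] pp by (simp only: carrier_perm_seqs) simp
  next
    fix p q assume p: "p \<in> ?N" and q: "q \<in> ?N"
    then have pp: "p k permutes {1..n k}" and qq: "q k permutes {1..n k}" for k
      unfolding mem by blast+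
    have le: "hamming_dist (n k) (p k \<circ> q k) id
        \<le> hamming_dist (n k) (p k) id + hamming_dist (n k) (q k) id" for k
      using hamming_dist_triangle[of "n k" "p k \<circ> q k" id "q k"]
        hamming_dist_right[OF qq[of k], of "p k" id] by simp
    have lim: "((\<lambda>k. hamming_dist (n k) (p k) id + hamming_dist (n k) (q k) id) \<longlongrightarrow> 0) \<omega>"
      using p q unfolding mem by (intro tendsto_add_zero) simp_all
    have "((\<lambda>k. hamming_dist (n k) (p k \<circ> q k) id) \<longlongrightarrow> 0) \<omega>"
      by (rule tendsto_sandwich[OF _ _ tendsto_const lim]) (simp_all add: hamming_dist_nonneg le)
    then show "p \<otimes>\<^bsub>perm_seqs n\<^esub> q \<in> ?N"
      unfolding mult_perm_seqs mem using pp qq permutes_compose by blast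
  qed
  moreover have "x \<otimes>\<^bsub>perm_seqs n\<^esub> h \<otimes>\<^bsub>perm_seqs n\<^esub> inv\<^bsub>perm_seqs n\<^esub> x \<in> ?N"
    if x: "x \<in> carrier (perm_seqs n)" and h: "h \<in> ?N" for x h
  proof -
    have xx: "x k permutes {1..n k}" for k using x unfolding carrier_perm_seqs by blast
    have hh: "h k permutes {1..n k}" for k using h unfolding mem by blast
    have "hamming_dist (n k) (x k \<circ> h k \<circ> inv' (x k)) id = hamming_dist (n k) (h k) id" for k
      using hamming_dist_right[OF permutes_inv[OF xx[of k]], of "x k \<circ> h k" "x k"]
        hamming_dist_left[OF permutes_inj[OF xx[of k]], of "n k" "h k" id]
      by (simp add: permutes_inv_o[OF xx])
    moreover have "x k \<circ> h k \<circ> inv' (x k) permutes {1..n k}" for k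
      by (intro permutes_compose permutes_inv xx hh)
    ultimately have "(\<lambda>k. x k \<circ> h k \<circ> inv' (x k)) \<in> ?N"
      using h unfolding mem by simp
    then show ?thesis unfolding mult_perm_seqs inv_perm_seqs[OF x] .
  qed
  ultimately show ?thesis unfolding normal_inv_iff by blast
qed

lemma group_sofic_group: "group (sofic_group \<omega> n)"
  unfolding sofic_group_def by (rule normal.factorgroup_is_group[OF null_seqs_normal])

lemma carrier_sofic_group:
  "carrier (sofic_group \<omega> n) = sofic_class \<omega> n ` carrier (perm_seqs n)"
  by (auto simp: sofic_group_def FactGroup_def RCOSETS_def sofic_class_def)

lemma mult_sofic_class:
  assumes "p \<in> carrier (perm_seqs n)" "q \<in> carrier (perm_seqs n)"
  shows "sofic_class \<omega> n p \<otimes>\<^bsub>sofic_group \<omega> n\<^esub> sofic_class \<omega> n q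
           = sofic_class \<omega> n (\<lambda>k. p k \<circ> q k)"
  using normal.rcos_sum[OF null_seqs_normal assms, of \<omega>]
  by (simp only: sofic_group_def mult_FactGroup sofic_class_def mult_perm_seqs)

lemma mem_sofic_class:
  assumes p: "p \<in> carrier (perm_seqs n)"
  shows "q \<in> sofic_class \<omega> n p \<longleftrightarrow> q \<in> carrier (perm_seqs n)
           \<and> ((\<lambda>k. hamming_dist (n k) (q k) (p k)) \<longlongrightarrow> 0) \<omega>"
proof -
  have pp: "p k permutes {1..n k}" for k using p unfolding carrier_perm_seqs by blast
  have mem: "h \<in> null_seqs \<omega> n \<longleftrightarrow> (\<forall>k. h k permutes {1..n k})
      \<and> ((\<lambda>k. hamming_dist (n k) (h k) id) \<longlongrightarrow> 0) \<omega>" for h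
    unfolding null_seqs_def mem_Collect_eq carrier_perm_seqs sym_group_one ..
  have *: "hamming_dist (n k) (h \<circ> p k) (p k) = hamming_dist (n k) h id" for h k
    using hamming_dist_right[OF pp[of k], of h id] by simp
  show ?thesis
  proof
    assume "q \<in> sofic_class \<omega> n p"
    then obtain h where h: "h \<in> null_seqs \<omega> n" "q = (\<lambda>k. h k \<circ> p k)"
      unfolding sofic_class_def r_coset_def mult_perm_seqs by blast
    then show "q \<in> carrier (perm_seqs n)
           \<and> ((\<lambda>k. hamming_dist (n k) (q k) (p k)) \<longlongrightarrow> 0) \<omega>"
      unfolding carrier_perm_seqs mem h(2) * using pp permutes_compose by blast
  next
    assume q: "q \<in> carrier (perm_seqs n)
           \<and> ((\<lambda>k. hamming_dist (n k) (q k) (p k)) \<longlongrightarrow> 0) \<omega>"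
    define h where "h = (\<lambda>k. q k \<circ> inv' (p k))"
    have qh: "q = (\<lambda>k. h k \<circ> p k)"
      by (rule ext) (simp add: h_def comp_assoc permutes_inv_o[OF pp])
    have "h k permutes {1..n k}" for k
      using q unfolding h_def carrier_perm_seqs
      by (intro permutes_compose permutes_inv pp) blast
    moreover have "((\<lambda>k. hamming_dist (n k) (h k) id) \<longlongrightarrow> 0) \<omega>"
      using q by (simp add: qh *)
    ultimately have "h \<in> null_seqs \<omega> n" unfolding mem by blast
    then show "q \<in> sofic_class \<omega> n p"
      unfolding sofic_class_def r_coset_def mult_perm_seqs using qh by blast
  qed
qed

lemma sofic_class_eqI:
  assumes p: "p \<in> carrier (perm_seqs n)" and q: "q \<in> carrier (perm_seqs n)"
    and lim: "((\<lambda>k. hamming_dist (n k) (p k) (q k)) \<longlongrightarrow> 0) \<omega>"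
  shows "sofic_class \<omega> n p = sofic_class \<omega> n q"
proof -
  interpret N: normal "null_seqs \<omega> n" "perm_seqs n" by (rule null_seqs_normal)
  have "p \<in> sofic_class \<omega> n q" using mem_sofic_class[OF q] p lim by blast
  then show ?thesis
    using N.repr_independence[of p "null_seqs \<omega> n" q] q N.subgroup_axioms
    unfolding sofic_class_def by metis
qed

lemma sofic_dist_sofic_class:
  assumes "\<omega> \<noteq> bot" and p: "p \<in> carrier (perm_seqs n)" and q: "q \<in> carrier (perm_seqs n)"
    and lim: "((\<lambda>k. hamming_dist (n k) (p k) (q k)) \<longlongrightarrow> d) \<omega>"
  shows "sofic_dist \<omega> n (sofic_class \<omega> n p) (sofic_class \<omega> n q) = d"
  unfolding sofic_dist_def
proof (rule the_equality)
  have "p \<in> sofic_class \<omega> n p" "q \<in> sofic_class \<omega> n q"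
    using mem_sofic_class[OF p] mem_sofic_class[OF q] p q by (simp_all add: hamming_dist_def)
  then show "\<exists>p\<in>sofic_class \<omega> n p. \<exists>q\<in>sofic_class \<omega> n q.
      ((\<lambda>k. hamming_dist (n k) (p k) (q k)) \<longlongrightarrow> d) \<omega>" using lim by blast
next
  fix e assume "\<exists>p\<in>sofic_class \<omega> n p. \<exists>q\<in>sofic_class \<omega> n q.
      ((\<lambda>k. hamming_dist (n k) (p k) (q k)) \<longlongrightarrow> e) \<omega>"
  then obtain p' q' where
      p': "((\<lambda>k. hamming_dist (n k) (p' k) (p k)) \<longlongrightarrow> 0) \<omega>"
    and q': "((\<lambda>k. hamming_dist (n k) (q' k) (q k)) \<longlongrightarrow> 0) \<omega>"
    and e: "((\<lambda>k. hamming_dist (n k) (p' k) (q' k)) \<longlongrightarrow> e) \<omega>"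
    using mem_sofic_class[OF p] mem_sofic_class[OF q] by blast
  have le: "\<bar>hamming_dist (n k) (p' k) (q' k) - hamming_dist (n k) (p k) (q k)\<bar>
      \<le> hamming_dist (n k) (p' k) (p k) + hamming_dist (n k) (q' k) (q k)" for k
    using hamming_dist_triangle[of "n k" "p' k" "q' k" "p k"]
      hamming_dist_triangle[of "n k" "p k" "q' k" "q k"]
      hamming_dist_triangle[of "n k" "p k" "q k" "p' k"]
      hamming_dist_triangle[of "n k" "p' k" "q k" "q' k"]
      hamming_dist_commute[of "n k" "p' k" "p k"] hamming_dist_commute[of "n k" "q' k" "q k"]
    by linarith
  have "((\<lambda>k. hamming_dist (n k) (p' k) (q' k) - hamming_dist (n k) (p k) (q k)) \<longlongrightarrow> 0) \<omega>"
    using tendsto_add_zero[OF p' q'] by (rule tendsto_0_le[where K = 1]) (simp add: le hamming_dist_nonneg always_eventually)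
  moreover have "((\<lambda>k. hamming_dist (n k) (p' k) (q' k) - hamming_dist (n k) (p k) (q k))
      \<longlongrightarrow> e - d) \<omega>" using e lim by (rule tendsto_diff)
  ultimately show "e = d" using tendsto_unique[OF assms(1)] by fastforce
qed

lemma hamming_dist_convergent:
  assumes "ultrafilter \<omega>"
  shows "\<exists>d. ((\<lambda>k. hamming_dist (n k) (p k) (q k)) \<longlongrightarrow> d) \<omega>"
proof -
  have "\<exists>d\<in>{0..1}. ((\<lambda>k. hamming_dist (n k) (p k) (q k)) \<longlongrightarrow> d) \<omega>"
    using assms compact_Icc
    by (rule ultrafilter_tendsto_compact) (simp add: hamming_dist_nonneg hamming_dist_le_1)
  then show ?thesis by blast
qed


section \<open>Sofic representations, amplifications and direct sums\<close>

definition sofic_representation ::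
    "('g, 'x) monoid_scheme \<Rightarrow> nat filter \<Rightarrow> (nat \<Rightarrow> nat) \<Rightarrow> ('g \<Rightarrow> (nat \<Rightarrow> nat \<Rightarrow> nat) set) \<Rightarrow> bool"
  where "sofic_representation G \<omega> n \<theta> \<longleftrightarrow>
     \<theta> \<in> hom G (sofic_group \<omega> n) \<and>
     (\<forall>g\<in>carrier G. g \<noteq> \<one>\<^bsub>G\<^esub> \<longrightarrow> sofic_dist \<omega> n (\<theta> g) \<one>\<^bsub>sofic_group \<omega> n\<^esub> = 1)"

text \<open>\<open>p \<otimes> 1\<^sub>r\<close> acts as \<open>p\<close> on each of the \<open>r\<close> consecutive blocks of length \<open>n\<close> of \<open>{1..n * r}\<close>,
  and \<open>p \<oplus> q\<close> acts as \<open>p\<close> on \<open>{1..n}\<close> and as \<open>q\<close> on \<open>{n + 1..n + m}\<close>.\<close>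

definition amplify :: "nat \<Rightarrow> nat \<Rightarrow> (nat \<Rightarrow> nat) \<Rightarrow> nat \<Rightarrow> nat" where
  "amplify n r p i =
     (if i \<in> {1..n * r} then n * ((i - 1) div n) + p ((i - 1) mod n + 1) else i)"

definition direct_sum :: "nat \<Rightarrow> (nat \<Rightarrow> nat) \<Rightarrow> (nat \<Rightarrow> nat) \<Rightarrow> nat \<Rightarrow> nat" where
  "direct_sum n p q i = (if i \<le> n then p i else n + q (i - n))"

text \<open>The induced operations on the universal sofic groups.  All representatives of the
  arguments give the same class, so each union is over a family of equal sets; see
  \<open>amplify_class_eq\<close> and \<open>sum_class_eq\<close> below.\<close>

definition amplify_class ::
    "nat filter \<Rightarrow> (nat \<Rightarrow> nat) \<Rightarrow> (nat \<Rightarrow> nat) \<Rightarrow> (nat \<Rightarrow> nat \<Rightarrow> nat) set \<Rightarrow> (nat \<Rightarrow> nat \<Rightarrow> nat) set"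
  where "amplify_class \<omega> n r A =
     (\<Union>p\<in>A. sofic_class \<omega> (\<lambda>k. n k * r k) (\<lambda>k. amplify (n k) (r k) (p k)))"

definition sum_class ::
    "nat filter \<Rightarrow> (nat \<Rightarrow> nat) \<Rightarrow> (nat \<Rightarrow> nat) \<Rightarrow>
     (nat \<Rightarrow> nat \<Rightarrow> nat) set \<Rightarrow> (nat \<Rightarrow> nat \<Rightarrow> nat) set \<Rightarrow> (nat \<Rightarrow> nat \<Rightarrow> nat) set"
  where "sum_class \<omega> n m A B =
     (\<Union>p\<in>A. \<Union>q\<in>B. sofic_class \<omega> (\<lambda>k. n k + m k) (\<lambda>k. direct_sum (n k) (p k) (q k)))"


lemma block_cases:
  fixes n r i :: nat
  assumes "i \<in> {1..n * r}"
  obtains b j where "b < r" "j \<in> {1..n}" "i = n * b + j"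
proof
  have n: "0 < n" using assms by (cases n) auto
  show "(i - 1) div n < r" using assms by (intro less_mult_imp_div_less) (auto simp: mult.commute)
  have "(i - 1) mod n < n" using n by simp
  then show "(i - 1) mod n + 1 \<in> {1..n}" by simp
  have "n * ((i - 1) div n) + (i - 1) mod n = i - 1" by simp
  then show "i = n * ((i - 1) div n) + ((i - 1) mod n + 1)" using assms by simp
qed

lemma amplify_block:
  assumes "b < r" "j \<in> {1..n}"
  shows "n * b + j \<in> {1..n * r}" "amplify n r p (n * b + j) = n * b + p j"
proof -
  have "n * b + j \<le> n * (b + 1)" using assms(2) by simp
  also have "\<dots> \<le> n * r" using assms(1) by (intro mult_le_mono2) simp
  finally show *: "n * b + j \<in> {1..n * r}" using assms(2) by simp
  have "n * b + j - 1 = n * b + (j - 1)" "j - 1 < n" using assms(2) by auto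
  then have **: "(n * b + j - 1) div n = b" "(n * b + j - 1) mod n = j - 1" by simp_all
  show "amplify n r p (n * b + j) = n * b + p j"
    using * assms(2) unfolding amplify_def ** by simp
qed

lemma amplify_outside: "i \<notin> {1..n * r} \<Longrightarrow> amplify n r p i = i"
  by (simp only: amplify_def if_False)

lemma amplify_comp:
  assumes "q permutes {1..n}"
  shows "amplify n r (p \<circ> q) = amplify n r p \<circ> amplify n r q"
proof
  fix i show "amplify n r (p \<circ> q) i = (amplify n r p \<circ> amplify n r q) i"
  proof (cases "i \<in> {1..n * r}")
    case True
    then obtain b j where "b < r" and j: "j \<in> {1..n}" and "i = n * b + j" by (rule block_cases)
    moreover have "q j \<in> {1..n}" using permutes_in_image[OF assms] j by blast
    ultimately show ?thesis by (simp only: o_apply amplify_block)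
  qed (simp add: amplify_outside del: atLeastAtMost_iff)
qed

lemma amplify_id: "amplify n r id = id"
proof
  fix i show "amplify n r id i = id i"
  proof (cases "i \<in> {1..n * r}")
    case True
    then obtain b j where "b < r" "j \<in> {1..n}" "i = n * b + j" by (rule block_cases)
    then show ?thesis by (simp only: id_apply amplify_block)
  qed (simp add: amplify_outside del: atLeastAtMost_iff)
qed

lemma permutes_bijI: "bij p \<Longrightarrow> (\<And>x. x \<notin> S \<Longrightarrow> p x = x) \<Longrightarrow> p permutes S"
  unfolding permutes_def bij_iff by blast

lemma amplify_permutes:
  assumes "p permutes {1..n}"
  shows "amplify n r p permutes {1..n * r}"
proof (rule permutes_bijI)
  show "bij (amplify n r p)"
  proof (rule o_bij)
    show "amplify n r (inv' p) \<circ> amplify n r p = id"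
      by (simp only: amplify_comp[OF assms, symmetric] permutes_inv_o[OF assms] amplify_id)
    show "amplify n r p \<circ> amplify n r (inv' p) = id"
      by (simp only: amplify_comp[OF permutes_inv[OF assms], symmetric]
          permutes_inv_o[OF assms] amplify_id)
  qed
qed (rule amplify_outside)

lemma amplify_amplify:
  assumes "p permutes {1..n}"
  shows "amplify (n * r) s (amplify n r p) = amplify n (r * s) p"
proof
  fix i show "amplify (n * r) s (amplify n r p) i = amplify n (r * s) p i"
  proof (cases "i \<in> {1..n * r * s}")
    case True
    then obtain b j where b: "b < s" and j: "j \<in> {1..n * r}" and i: "i = n * r * b + j"
      by (rule block_cases)
    from j obtain c l where c: "c < r" and l: "l \<in> {1..n}" and jl: "j = n * c + l"
      by (rule block_cases)
    have "r * b + c < r * (b + 1)" using c by simp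
    also have "\<dots> \<le> r * s" using b by (intro mult_le_mono2) simp
    finally have *: "r * b + c < r * s" .
    have i': "i = n * (r * b + c) + l" by (simp add: i jl algebra_simps)
    have "amplify (n * r) s (amplify n r p) i = n * r * b + (n * c + p l)"
      unfolding i amplify_block(2)[OF b j] unfolding jl amplify_block(2)[OF c l] ..
    also have "\<dots> = amplify n (r * s) p i"
      unfolding i' amplify_block(2)[OF * l] by (simp add: algebra_simps)
    finally show ?thesis .
  next
    case False
    then have "i \<notin> {1..n * (r * s)}" by (simp only: mult.assoc not_False_eq_True)
    with False show ?thesis by (simp only: amplify_outside not_False_eq_True)
  qed
qed

lemma hamming_dist_amplify:
  assumes "0 < r"
  shows "hamming_dist (n * r) (amplify n r p) (amplify n r q) = hamming_dist n p q"
proof -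
  let ?D = "{j \<in> {1..n}. p j \<noteq> q j}"
  have inj: "inj_on (\<lambda>(b, j). n * b + j) ({..<r} \<times> ?D)"
  proof (rule inj_onI, clarify)
    fix b j b' j' assume j: "j \<in> {1..n}" "j' \<in> {1..n}" and eq: "n * b + j = n * b' + j'"
    have j': "j - 1 < n" "j' - 1 < n" using j by auto
    have eq': "n * b + (j - 1) = n * b' + (j' - 1)" using j eq by simp
    have "b = (n * b + (j - 1)) div n" using j' by simp
    also have "\<dots> = b'" unfolding eq' using j' by simp
    finally show "b = b' \<and> j = j'" using eq by simp
  qed
  have img: "(\<lambda>(b, j). n * b + j) ` ({..<r} \<times> ?D)
      = {i \<in> {1..n * r}. amplify n r p i \<noteq> amplify n r q i}" (is "?L = ?R")
  proof
    show "?L \<subseteq> ?R"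
    proof
      fix i assume "i \<in> ?L"
      then obtain b j where bj: "b < r" "j \<in> {1..n}" "p j \<noteq> q j" "i = n * b + j" by auto
      then show "i \<in> ?R"
        using amplify_block(1)[OF bj(1,2)] amplify_block(2)[OF bj(1,2), of p]
          amplify_block(2)[OF bj(1,2), of q] by simp
    qed
    show "?R \<subseteq> ?L"
    proof
      fix i assume i: "i \<in> ?R"
      then have "i \<in> {1..n * r}" by blast
      then obtain b j where bj: "b < r" "j \<in> {1..n}" "i = n * b + j" by (rule block_cases)
      then have "p j \<noteq> q j"
        using i amplify_block(2)[OF bj(1,2), of p] amplify_block(2)[OF bj(1,2), of q] by auto
      with bj show "i \<in> ?L" by (intro image_eqI[of _ _ "(b, j)"]) auto
    qed
  qed
  have "card {i \<in> {1..n * r}. amplify n r p i \<noteq> amplify n r q i} = card ({..<r} \<times> ?D)"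
    using card_image[OF inj] unfolding img .
  then show ?thesis using assms by (simp add: hamming_dist_def card_cartesian_product)
qed

lemma amplify_carrier:
  "p \<in> carrier (perm_seqs n) \<Longrightarrow>
     (\<lambda>k. amplify (n k) (r k) (p k)) \<in> carrier (perm_seqs (\<lambda>k. n k * r k))"
  unfolding carrier_perm_seqs using amplify_permutes by blast

lemma sofic_class_self:
  "p \<in> carrier (perm_seqs n) \<Longrightarrow> p \<in> sofic_class \<omega> n p"
  using mem_sofic_class[of p n p \<omega>] by (simp add: hamming_dist_def)

lemma amplify_class_eq:
  assumes p: "p \<in> carrier (perm_seqs n)" and r: "\<And>k. 0 < r k"
  shows "amplify_class \<omega> n r (sofic_class \<omega> n p)
           = sofic_class \<omega> (\<lambda>k. n k * r k) (\<lambda>k. amplify (n k) (r k) (p k))"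
proof -
  have "sofic_class \<omega> (\<lambda>k. n k * r k) (\<lambda>k. amplify (n k) (r k) (q k))
      = sofic_class \<omega> (\<lambda>k. n k * r k) (\<lambda>k. amplify (n k) (r k) (p k))"
    if "q \<in> sofic_class \<omega> n p" for q
    using that[unfolded mem_sofic_class[OF p]] p r
    by (intro sofic_class_eqI) (simp_all only: amplify_carrier hamming_dist_amplify)
  moreover have "sofic_class \<omega> n p \<noteq> {}" using sofic_class_self[OF p] by blast
  ultimately show ?thesis by (simp add: amplify_class_def cong: SUP_cong_simp)
qed

lemma direct_sum_permutes:
  assumes p: "p permutes {1..n}" and q: "q permutes {1..m}"
  shows "direct_sum n p q permutes {1..n + m}"
proof (rule permutes_bijI)
  have pn: "p i \<le> n" if "p permutes {1..n}" "i \<le> n" for i p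
  proof (cases "i \<in> {1..n}")
    case True
    then have "p i \<in> {1..n}" using permutes_in_image[OF that(1)] by blast
    then show ?thesis by simp
  qed (use that(2) permutes_not_in[OF that(1), of i] in simp)
  have qm: "0 < q i" if "q permutes {1..m}" "0 < i" for i q
  proof (cases "i \<in> {1..m}")
    case True
    then have "q i \<in> {1..m}" using permutes_in_image[OF that(1)] by blast
    then show ?thesis by simp
  qed (use that(2) permutes_not_in[OF that(1), of i] in simp)
  show "bij (direct_sum n p q)"
  proof (rule o_bij)
    show "direct_sum n (inv' p) (inv' q) \<circ> direct_sum n p q = id"
    proof
      fix i show "(direct_sum n (inv' p) (inv' q) \<circ> direct_sum n p q) i = id i"
        using pn[OF p, of i] qm[OF q, of "i - n"]
        by (cases "i \<le> n") (simp_all add: direct_sum_def permutes_inverses[OF p] permutes_inverses[OF q])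
    qed
    show "direct_sum n p q \<circ> direct_sum n (inv' p) (inv' q) = id"
    proof
      fix i show "(direct_sum n p q \<circ> direct_sum n (inv' p) (inv' q)) i = id i"
        using pn[OF permutes_inv[OF p], of i] qm[OF permutes_inv[OF q], of "i - n"]
        by (cases "i \<le> n") (simp_all add: direct_sum_def permutes_inverses[OF p] permutes_inverses[OF q])
    qed
  qed
  show "direct_sum n p q i = i" if "i \<notin> {1..n + m}" for i
  proof -
    from that have "i \<notin> {1..n}" "i - n \<notin> {1..m}" by auto
    then have "p i = i" "q (i - n) = i - n" using permutes_not_in[OF p] permutes_not_in[OF q] by (simp_all only: not_False_eq_True)
    then show ?thesis by (simp add: direct_sum_def)
  qed
qed

lemma hamming_dist_direct_sum:
  "hamming_dist (n + m) (direct_sum n p q) (direct_sum n p' q')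
     \<le> hamming_dist n p p' + hamming_dist m q q'"
proof -
  let ?A = "{i \<in> {1..n}. p i \<noteq> p' i}" and ?B = "{i \<in> {1..m}. q i \<noteq> q' i}"
  have "{i \<in> {1..n + m}. direct_sum n p q i \<noteq> direct_sum n p' q' i} \<subseteq> ?A \<union> (+) n ` ?B"
  proof
    fix i assume i: "i \<in> {i \<in> {1..n + m}. direct_sum n p q i \<noteq> direct_sum n p' q' i}"
    show "i \<in> ?A \<union> (+) n ` ?B"
    proof (cases "i \<le> n")
      case False
      with i have "i - n \<in> ?B" "i = n + (i - n)" by (auto simp: direct_sum_def)
      then show ?thesis by blast
    qed (use i in \<open>auto simp: direct_sum_def\<close>)
  qed
  then have "card {i \<in> {1..n + m}. direct_sum n p q i \<noteq> direct_sum n p' q' i}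
      \<le> card (?A \<union> (+) n ` ?B)" by (rule card_mono[rotated]) simp
  also have "\<dots> \<le> card ?A + card ((+) n ` ?B)" by (rule card_Un_le)
  also have "\<dots> = card ?A + card ?B" by (simp add: card_image)
  finally have "hamming_dist (n + m) (direct_sum n p q) (direct_sum n p' q')
      \<le> real (card ?A + card ?B) / real (n + m)"
    unfolding hamming_dist_def by (intro divide_right_mono) simp_all
  also have "\<dots> = real (card ?A) / real (n + m) + real (card ?B) / real (n + m)"
    by (simp add: add_divide_distrib)
  also have "\<dots> \<le> real (card ?A) / real n + real (card ?B) / real m"
  proof (rule add_mono)
    show "real (card ?A) / real (n + m) \<le> real (card ?A) / real n"
      by (cases "n = 0") (simp_all add: frac_le)
    show "real (card ?B) / real (n + m) \<le> real (card ?B) / real m"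
      by (cases "m = 0") (simp_all add: frac_le)
  qed
  finally show ?thesis by (simp add: hamming_dist_def)
qed

lemma sum_class_eq:
  assumes p: "p \<in> carrier (perm_seqs n)" and q: "q \<in> carrier (perm_seqs m)"
  shows "sum_class \<omega> n m (sofic_class \<omega> n p) (sofic_class \<omega> m q)
           = sofic_class \<omega> (\<lambda>k. n k + m k) (\<lambda>k. direct_sum (n k) (p k) (q k))"
proof -
  have carr: "(\<lambda>k. direct_sum (n k) (p k) (q k)) \<in> carrier (perm_seqs (\<lambda>k. n k + m k))"
    if "p \<in> carrier (perm_seqs n)" "q \<in> carrier (perm_seqs m)" for p q
    using that unfolding carrier_perm_seqs using direct_sum_permutes by blast
  have eq: "sofic_class \<omega> (\<lambda>k. n k + m k) (\<lambda>k. direct_sum (n k) (p' k) (q' k))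
      = sofic_class \<omega> (\<lambda>k. n k + m k) (\<lambda>k. direct_sum (n k) (p k) (q k))"
    if p': "p' \<in> sofic_class \<omega> n p" and q': "q' \<in> sofic_class \<omega> m q" for p' q'
  proof (rule sofic_class_eqI)
    have lim: "((\<lambda>k. hamming_dist (n k) (p' k) (p k) + hamming_dist (m k) (q' k) (q k)) \<longlongrightarrow> 0) \<omega>"
      using p' q' unfolding mem_sofic_class[OF p] mem_sofic_class[OF q]
      by (intro tendsto_add_zero) blast+
    show "((\<lambda>k. hamming_dist (n k + m k) (direct_sum (n k) (p' k) (q' k))
        (direct_sum (n k) (p k) (q k))) \<longlongrightarrow> 0) \<omega>"
      by (rule tendsto_sandwich[OF _ _ tendsto_const lim])
         (simp_all add: hamming_dist_nonneg hamming_dist_direct_sum)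
  qed (use p' q' p q carr in \<open>simp_all only: mem_sofic_class[OF p] mem_sofic_class[OF q]\<close>)
  have "sofic_class \<omega> n p \<noteq> {}" "sofic_class \<omega> m q \<noteq> {}"
    using sofic_class_self[OF p] sofic_class_self[OF q] by blast+
  then show ?thesis by (simp add: sum_class_def eq cong: SUP_cong_simp)
qed


section \<open>The convex structure on classes of sofic representations\<close>

definition sofic_reps ::
    "('g, 'x) monoid_scheme \<Rightarrow> nat filter \<Rightarrow> ((nat \<Rightarrow> nat) \<times> ('g \<Rightarrow> (nat \<Rightarrow> nat \<Rightarrow> nat) set)) set"
  where "sofic_reps G \<omega> = {(n, \<theta>). (\<forall>k. 0 < n k) \<and> sofic_representation G \<omega> n \<theta>}"

text \<open>Conjugacy is only required on \<open>carrier G\<close>, so the values of \<open>\<theta>\<close> and \<open>\<psi>\<close> elsewhere do not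
  affect their classes.\<close>

definition sof_equiv ::
    "('g, 'x) monoid_scheme \<Rightarrow> nat filter \<Rightarrow> (nat \<Rightarrow> nat) \<Rightarrow> ('g \<Rightarrow> (nat \<Rightarrow> nat \<Rightarrow> nat) set) \<Rightarrow>
     (nat \<Rightarrow> nat) \<Rightarrow> ('g \<Rightarrow> (nat \<Rightarrow> nat \<Rightarrow> nat) set) \<Rightarrow> bool"
  where "sof_equiv G \<omega> n \<theta> m \<psi> \<longleftrightarrow>
     (\<exists>r t. (\<forall>k. 0 < r k \<and> 0 < t k \<and> n k * r k = m k * t k) \<and>
       (\<exists>u\<in>carrier (sofic_group \<omega> (\<lambda>k. n k * r k)). \<forall>g\<in>carrier G.
          u \<otimes>\<^bsub>sofic_group \<omega> (\<lambda>k. n k * r k)\<^esub> amplify_class \<omega> n r (\<theta> g)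
            \<otimes>\<^bsub>sofic_group \<omega> (\<lambda>k. n k * r k)\<^esub> inv\<^bsub>sofic_group \<omega> (\<lambda>k. n k * r k)\<^esub> u
          = amplify_class \<omega> m t (\<psi> g)))"

definition sof_rel ::
    "('g, 'x) monoid_scheme \<Rightarrow> nat filter \<Rightarrow> ((nat \<Rightarrow> nat) \<times> ('g \<Rightarrow> (nat \<Rightarrow> nat \<Rightarrow> nat) set)) rel"
  where "sof_rel G \<omega> = {((n, \<theta>), (m, \<psi>)).
     (n, \<theta>) \<in> sofic_reps G \<omega> \<and> (m, \<psi>) \<in> sofic_reps G \<omega> \<and> sof_equiv G \<omega> n \<theta> m \<psi>}"

definition Sof ::
    "('g, 'x) monoid_scheme \<Rightarrow> nat filter \<Rightarrow> ((nat \<Rightarrow> nat) \<times> ('g \<Rightarrow> (nat \<Rightarrow> nat \<Rightarrow> nat) set)) set set"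
  where "Sof G \<omega> = sofic_reps G \<omega> // sof_rel G \<omega>"

definition sof_class ::
    "('g, 'x) monoid_scheme \<Rightarrow> nat filter \<Rightarrow> (nat \<Rightarrow> nat) \<Rightarrow> ('g \<Rightarrow> (nat \<Rightarrow> nat \<Rightarrow> nat) set)
      \<Rightarrow> ((nat \<Rightarrow> nat) \<times> ('g \<Rightarrow> (nat \<Rightarrow> nat \<Rightarrow> nat) set)) set"
  where "sof_class G \<omega> n \<theta> = sof_rel G \<omega> `` {(n, \<theta>)}"

text \<open>\<open>is_convex_combination G \<omega> c X Y Z\<close> states \<open>Z = c X + (1 - c) Y\<close>.  The class \<open>Z\<close> is determined
  by \<open>c\<close>, \<open>X\<close> and \<open>Y\<close>, and the graph of this operation is defined here by allowing every choice of
  representatives and of amplification sequences.\<close>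

definition is_convex_combination ::
    "('g, 'x) monoid_scheme \<Rightarrow> nat filter \<Rightarrow> real
      \<Rightarrow> ((nat \<Rightarrow> nat) \<times> ('g \<Rightarrow> (nat \<Rightarrow> nat \<Rightarrow> nat) set)) set
      \<Rightarrow> ((nat \<Rightarrow> nat) \<times> ('g \<Rightarrow> (nat \<Rightarrow> nat \<Rightarrow> nat) set)) set
      \<Rightarrow> ((nat \<Rightarrow> nat) \<times> ('g \<Rightarrow> (nat \<Rightarrow> nat \<Rightarrow> nat) set)) set \<Rightarrow> bool"
  where "is_convex_combination G \<omega> c X Y Z \<longleftrightarrow>
     (\<exists>n \<theta> m \<psi> r t. (n, \<theta>) \<in> X \<and> (m, \<psi>) \<in> Y \<and> (\<forall>k. 0 < r k \<and> 0 < t k) \<and>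
       ((\<lambda>k. real (n k * r k) / real (n k * r k + m k * t k)) \<longlongrightarrow> c) \<omega> \<and>
       Z = sof_class G \<omega> (\<lambda>k. n k * r k + m k * t k)
             (\<lambda>g. sum_class \<omega> (\<lambda>k. n k * r k) (\<lambda>k. m k * t k)
                    (amplify_class \<omega> n r (\<theta> g)) (amplify_class \<omega> m t (\<psi> g))))"

definition is_extreme_point ::
    "('g, 'x) monoid_scheme \<Rightarrow> nat filter
      \<Rightarrow> ((nat \<Rightarrow> nat) \<times> ('g \<Rightarrow> (nat \<Rightarrow> nat \<Rightarrow> nat) set)) set \<Rightarrow> bool"
  where "is_extreme_point G \<omega> Z \<longleftrightarrow> Z \<in> Sof G \<omega> \<and>
     (\<forall>c X Y. 0 < c \<and> c < 1 \<and> X \<in> Sof G \<omega> \<and> Y \<in> Sof G \<omega> \<and> is_convex_combination G \<omega> c X Y Z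
        \<longrightarrow> X = Z \<and> Y = Z)"

definition commutant ::
    "('g, 'x) monoid_scheme \<Rightarrow> nat filter \<Rightarrow> (nat \<Rightarrow> nat) \<Rightarrow> ('g \<Rightarrow> (nat \<Rightarrow> nat \<Rightarrow> nat) set)
      \<Rightarrow> (nat \<Rightarrow> nat \<Rightarrow> nat) set set"
  where "commutant G \<omega> n \<theta> = {p \<in> carrier (sofic_group \<omega> n).
     \<forall>g\<in>carrier G. p \<otimes>\<^bsub>sofic_group \<omega> n\<^esub> \<theta> g = \<theta> g \<otimes>\<^bsub>sofic_group \<omega> n\<^esub> p}"

lemma amplify_class_hom:
  assumes r: "\<And>k. 0 < r k"
  shows "amplify_class \<omega> n r \<in> hom (sofic_group \<omega> n) (sofic_group \<omega> (\<lambda>k. n k * r k))"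
proof (rule homI)
  fix A assume "A \<in> carrier (sofic_group \<omega> n)"
  then obtain p where p: "p \<in> carrier (perm_seqs n)" and A: "A = sofic_class \<omega> n p"
    unfolding carrier_sofic_group by blast
  show "amplify_class \<omega> n r A \<in> carrier (sofic_group \<omega> (\<lambda>k. n k * r k))"
    unfolding A amplify_class_eq[OF p r] carrier_sofic_group
    by (rule imageI[OF amplify_carrier[OF p]])
next
  fix A B assume "A \<in> carrier (sofic_group \<omega> n)" "B \<in> carrier (sofic_group \<omega> n)"
  then obtain p q where p: "p \<in> carrier (perm_seqs n)" and A: "A = sofic_class \<omega> n p"
    and q: "q \<in> carrier (perm_seqs n)" and B: "B = sofic_class \<omega> n q"
    unfolding carrier_sofic_group by blast
  have pq: "(\<lambda>k. p k \<circ> q k) \<in> carrier (perm_seqs n)"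
    using p q unfolding carrier_perm_seqs by (auto intro: permutes_compose simp del: One_nat_def)
  have "amplify (n k) (r k) (p k \<circ> q k)
      = amplify (n k) (r k) (p k) \<circ> amplify (n k) (r k) (q k)" for k
    using q unfolding carrier_perm_seqs by (intro amplify_comp) blast
  then show "amplify_class \<omega> n r (A \<otimes>\<^bsub>sofic_group \<omega> n\<^esub> B) = amplify_class \<omega> n r A
      \<otimes>\<^bsub>sofic_group \<omega> (\<lambda>k. n k * r k)\<^esub> amplify_class \<omega> n r B"
    unfolding A B mult_sofic_class[OF p q] amplify_class_eq[OF p r] amplify_class_eq[OF q r]
      amplify_class_eq[OF pq r] mult_sofic_class[OF amplify_carrier[OF p] amplify_carrier[OF q]]
    by (simp only:)
qed

lemma amplify_class_amplify_class:
  assumes A: "A \<in> carrier (sofic_group \<omega> n)" and r: "\<And>k. 0 < r k" and s: "\<And>k. 0 < s k"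
  shows "amplify_class \<omega> (\<lambda>k. n k * r k) s (amplify_class \<omega> n r A)
           = amplify_class \<omega> n (\<lambda>k. r k * s k) A"
proof -
  obtain p where p: "p \<in> carrier (perm_seqs n)" and A: "A = sofic_class \<omega> n p"
    using A unfolding carrier_sofic_group by blast
  have rs: "\<And>k. 0 < r k * s k" using r s by simp
  have "amplify (n k * r k) (s k) (amplify (n k) (r k) (p k)) = amplify (n k) (r k * s k) (p k)"
    for k using p unfolding carrier_perm_seqs by (intro amplify_amplify) blast
  then show ?thesis
    unfolding A amplify_class_eq[OF p r] amplify_class_eq[OF amplify_carrier[OF p] s]
      amplify_class_eq[where r = "\<lambda>k. r k * s k", OF p rs] by (simp only: mult.assoc)
qed

lemma amplify_class_conj:
  assumes r: "\<And>k. 0 < r k"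
    and u: "u \<in> carrier (sofic_group \<omega> n)" and A: "A \<in> carrier (sofic_group \<omega> n)"
    and B: "u \<otimes>\<^bsub>sofic_group \<omega> n\<^esub> A \<otimes>\<^bsub>sofic_group \<omega> n\<^esub> inv\<^bsub>sofic_group \<omega> n\<^esub> u = B"
  shows "amplify_class \<omega> n r u \<otimes>\<^bsub>sofic_group \<omega> (\<lambda>k. n k * r k)\<^esub> amplify_class \<omega> n r A
       \<otimes>\<^bsub>sofic_group \<omega> (\<lambda>k. n k * r k)\<^esub>
         inv\<^bsub>sofic_group \<omega> (\<lambda>k. n k * r k)\<^esub> amplify_class \<omega> n r u
     = amplify_class \<omega> n r B"
proof -
  interpret group_hom "sofic_group \<omega> n" "sofic_group \<omega> (\<lambda>k. n k * r k)" "amplify_class \<omega> n r"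
    by (intro group_hom.intro group_sofic_group group_hom_axioms.intro amplify_class_hom r)
  show ?thesis unfolding B[symmetric] using u A by simp
qed

lemma sofic_reps_closed:
  "(n, \<theta>) \<in> sofic_reps G \<omega> \<Longrightarrow> g \<in> carrier G \<Longrightarrow> \<theta> g \<in> carrier (sofic_group \<omega> n)"
  by (auto simp: sofic_reps_def sofic_representation_def hom_def)

lemma sof_equivI:
  assumes "\<And>k. 0 < r k \<and> 0 < t k \<and> n k * r k = m k * t k"
    and S: "S = sofic_group \<omega> (\<lambda>k. n k * r k)" and "u \<in> carrier S"
    and "\<And>g. g \<in> carrier G \<Longrightarrow>
      u \<otimes>\<^bsub>S\<^esub> amplify_class \<omega> n r (\<theta> g) \<otimes>\<^bsub>S\<^esub> inv\<^bsub>S\<^esub> u = amplify_class \<omega> m t (\<psi> g)"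
  shows "sof_equiv G \<omega> n \<theta> m \<psi>"
proof -
  have "(\<forall>k. 0 < r k \<and> 0 < t k \<and> n k * r k = m k * t k) \<and>
      (\<exists>u\<in>carrier S. \<forall>g\<in>carrier G. u \<otimes>\<^bsub>S\<^esub> amplify_class \<omega> n r (\<theta> g) \<otimes>\<^bsub>S\<^esub> inv\<^bsub>S\<^esub> u
        = amplify_class \<omega> m t (\<psi> g))"
    using assms(1,3,4) by blast
  then show ?thesis unfolding sof_equiv_def S by (intro exI)
qed

lemma equiv_sof_rel: "equiv (sofic_reps G \<omega>) (sof_rel G \<omega>)"
proof (rule equivI)
  show "sof_rel G \<omega> \<subseteq> sofic_reps G \<omega> \<times> sofic_reps G \<omega>" by (auto simp: sof_rel_def)
  show "refl_on (sofic_reps G \<omega>) (sof_rel G \<omega>)"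
  proof (rule refl_onI, clarify)
    fix n \<theta> assume n: "(n, \<theta>) \<in> sofic_reps G \<omega>"
    interpret group "sofic_group \<omega> (\<lambda>k. n k * 1)" by (rule group_sofic_group)
    have "amplify_class \<omega> n (\<lambda>_. 1) (\<theta> g) \<in> carrier (sofic_group \<omega> (\<lambda>k. n k * 1))"
      if "g \<in> carrier G" for g
      by (rule hom_in_carrier[OF amplify_class_hom sofic_reps_closed[OF n that]]) simp
    then have "sof_equiv G \<omega> n \<theta> n \<theta>"
      unfolding sof_equiv_def
      by (intro exI[of _ "\<lambda>_. 1"] conjI bexI[of _ "\<one>\<^bsub>sofic_group \<omega> (\<lambda>k. n k * 1)\<^esub>"])
         (simp_all del: mult_1_right One_nat_def)
    then show "((n, \<theta>), (n, \<theta>)) \<in> sof_rel G \<omega>" using n by (simp add: sof_rel_def)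
  qed
  show "sym (sof_rel G \<omega>)"
  proof (rule symI, clarify)
    fix n \<theta> m \<psi> assume "((n, \<theta>), (m, \<psi>)) \<in> sof_rel G \<omega>"
    then have n: "(n, \<theta>) \<in> sofic_reps G \<omega>" and m: "(m, \<psi>) \<in> sofic_reps G \<omega>"
      and equiv: "sof_equiv G \<omega> n \<theta> m \<psi>" by (auto simp: sof_rel_def)
    from equiv obtain r t u where
      r: "\<And>k. 0 < r k" and t: "\<And>k. 0 < t k" and rt: "\<And>k. n k * r k = m k * t k"
      and u: "u \<in> carrier (sofic_group \<omega> (\<lambda>k. n k * r k))"
      and conj: "\<And>g. g \<in> carrier G \<Longrightarrow>
          u \<otimes>\<^bsub>sofic_group \<omega> (\<lambda>k. n k * r k)\<^esub> amplify_class \<omega> n r (\<theta> g)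
            \<otimes>\<^bsub>sofic_group \<omega> (\<lambda>k. n k * r k)\<^esub> inv\<^bsub>sofic_group \<omega> (\<lambda>k. n k * r k)\<^esub> u
          = amplify_class \<omega> m t (\<psi> g)"
      unfolding sof_equiv_def by blast
    define S where "S = sofic_group \<omega> (\<lambda>k. n k * r k)"
    have S: "sofic_group \<omega> (\<lambda>k. m k * t k) = S" by (simp only: S_def rt)
    interpret group S unfolding S_def by (rule group_sofic_group)
    have u': "u \<in> carrier S" using u by (simp only: S_def)
    have conv: "inv\<^bsub>S\<^esub> u \<otimes>\<^bsub>S\<^esub> amplify_class \<omega> m t (\<psi> g) \<otimes>\<^bsub>S\<^esub> inv\<^bsub>S\<^esub> (inv\<^bsub>S\<^esub> u)
        = amplify_class \<omega> n r (\<theta> g)" if g: "g \<in> carrier G" for g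
    proof -
      have a: "amplify_class \<omega> n r (\<theta> g) \<in> carrier S"
        unfolding S_def by (rule hom_in_carrier[OF amplify_class_hom sofic_reps_closed[OF n g]]) (rule r)
      then have "inv\<^bsub>S\<^esub> u \<otimes>\<^bsub>S\<^esub> (u \<otimes>\<^bsub>S\<^esub> amplify_class \<omega> n r (\<theta> g)) = amplify_class \<omega> n r (\<theta> g)"
        using u' by (simp add: m_assoc[symmetric])
      then show ?thesis
        unfolding conj[OF g, folded S_def, symmetric] using u' a by (simp add: m_assoc)
    qed
    have dims: "0 < t k \<and> 0 < r k \<and> m k * t k = n k * r k" for k
      using r t rt by simp
    have "sof_equiv G \<omega> m \<psi> n \<theta>"
      by (rule sof_equivI[OF dims S[symmetric] inv_closed[OF u'] conv])
    then show "((m, \<psi>), (n, \<theta>)) \<in> sof_rel G \<omega>" using n m by (simp add: sof_rel_def)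
  qed
  show "trans (sof_rel G \<omega>)"
  proof (rule transI, clarify)
    fix n \<theta> m \<psi> l \<phi>
    assume "((n, \<theta>), (m, \<psi>)) \<in> sof_rel G \<omega>" "((m, \<psi>), (l, \<phi>)) \<in> sof_rel G \<omega>"
    then have n: "(n, \<theta>) \<in> sofic_reps G \<omega>"
      and m: "(m, \<psi>) \<in> sofic_reps G \<omega>" and l: "(l, \<phi>) \<in> sofic_reps G \<omega>"
      and equiv: "sof_equiv G \<omega> n \<theta> m \<psi>" and equiv': "sof_equiv G \<omega> m \<psi> l \<phi>"
      by (auto simp: sof_rel_def)
    from equiv obtain r t u where r: "\<And>k. 0 < r k" and t: "\<And>k. 0 < t k" and rt: "\<And>k. n k * r k = m k * t k"
      and u: "u \<in> carrier (sofic_group \<omega> (\<lambda>k. n k * r k))"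
      and conj: "\<And>g. g \<in> carrier G \<Longrightarrow>
          u \<otimes>\<^bsub>sofic_group \<omega> (\<lambda>k. n k * r k)\<^esub> amplify_class \<omega> n r (\<theta> g)
            \<otimes>\<^bsub>sofic_group \<omega> (\<lambda>k. n k * r k)\<^esub> inv\<^bsub>sofic_group \<omega> (\<lambda>k. n k * r k)\<^esub> u
          = amplify_class \<omega> m t (\<psi> g)"
      unfolding sof_equiv_def by blast
    from equiv' obtain r' t' v where
      r': "\<And>k. 0 < r' k" and t': "\<And>k. 0 < t' k" and rt': "\<And>k. m k * r' k = l k * t' k"
      and v: "v \<in> carrier (sofic_group \<omega> (\<lambda>k. m k * r' k))"
      and conj': "\<And>g. g \<in> carrier G \<Longrightarrow>
          v \<otimes>\<^bsub>sofic_group \<omega> (\<lambda>k. m k * r' k)\<^esub> amplify_class \<omega> m r' (\<psi> g)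
            \<otimes>\<^bsub>sofic_group \<omega> (\<lambda>k. m k * r' k)\<^esub> inv\<^bsub>sofic_group \<omega> (\<lambda>k. m k * r' k)\<^esub> v
          = amplify_class \<omega> l t' (\<phi> g)"
      unfolding sof_equiv_def by blast
    define S where "S = sofic_group \<omega> (\<lambda>k. n k * (r k * r' k))"
    have S1: "sofic_group \<omega> (\<lambda>k. n k * r k * r' k) = S" by (simp only: S_def mult.assoc)
    have dims: "m k * r' k * t k = n k * (r k * r' k)" for k
      using rt[of k] by (simp add: algebra_simps)
    have S2: "sofic_group \<omega> (\<lambda>k. m k * r' k * t k) = S" by (simp only: S_def dims)
    interpret group S unfolding S_def by (rule group_sofic_group)
    define u' where "u' = amplify_class \<omega> (\<lambda>k. n k * r k) r' u"
    define v' where "v' = amplify_class \<omega> (\<lambda>k. m k * r' k) t v"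
    have u': "u' \<in> carrier S"
      using hom_in_carrier[OF amplify_class_hom[where r = r', OF r'] u] unfolding u'_def S1 .
    have v': "v' \<in> carrier S"
      using hom_in_carrier[OF amplify_class_hom[where r = t, OF t] v] unfolding v'_def S2 .
    have conv: "(v' \<otimes>\<^bsub>S\<^esub> u') \<otimes>\<^bsub>S\<^esub> amplify_class \<omega> n (\<lambda>k. r k * r' k) (\<theta> g)
          \<otimes>\<^bsub>S\<^esub> inv\<^bsub>S\<^esub> (v' \<otimes>\<^bsub>S\<^esub> u')
        = amplify_class \<omega> l (\<lambda>k. t' k * t k) (\<phi> g)" if g: "g \<in> carrier G" for g
    proof -
      note \<theta>g = sofic_reps_closed[OF n g] and \<psi>g = sofic_reps_closed[OF m g]
        and \<phi>g = sofic_reps_closed[OF l g]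
      have a: "amplify_class \<omega> n (\<lambda>k. r k * r' k) (\<theta> g) \<in> carrier S"
        unfolding S_def by (rule hom_in_carrier[OF amplify_class_hom \<theta>g]) (simp add: r r')
      have 1: "u' \<otimes>\<^bsub>S\<^esub> amplify_class \<omega> n (\<lambda>k. r k * r' k) (\<theta> g) \<otimes>\<^bsub>S\<^esub> inv\<^bsub>S\<^esub> u'
          = amplify_class \<omega> m (\<lambda>k. t k * r' k) (\<psi> g)"
        using amplify_class_conj[where r = r', OF r' u hom_in_carrier[OF amplify_class_hom[where r = r, OF r] \<theta>g] conj[OF g]]
        unfolding S1 u'_def[symmetric] amplify_class_amplify_class[where r = r and s = r', OF \<theta>g r r']
        unfolding rt amplify_class_amplify_class[where r = t and s = r', OF \<psi>g t r'] .
      have 2: "v' \<otimes>\<^bsub>S\<^esub> amplify_class \<omega> m (\<lambda>k. r' k * t k) (\<psi> g) \<otimes>\<^bsub>S\<^esub> inv\<^bsub>S\<^esub> v'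
          = amplify_class \<omega> l (\<lambda>k. t' k * t k) (\<phi> g)"
        using amplify_class_conj[where r = t, OF t v hom_in_carrier[OF amplify_class_hom[where r = r', OF r'] \<psi>g] conj'[OF g]]
        unfolding S2 v'_def[symmetric] amplify_class_amplify_class[where r = r' and s = t, OF \<psi>g r' t]
        unfolding rt' amplify_class_amplify_class[where r = t' and s = t, OF \<phi>g t' t] .
      have tr: "(\<lambda>k. t k * r' k) = (\<lambda>k. r' k * t k)" by (simp add: mult.commute)
      show ?thesis
        using 2[folded 1[unfolded tr]] u' v' a by (simp add: inv_mult_group m_assoc)
    qed
    have dims': "0 < r k * r' k \<and> 0 < t' k * t k \<and> n k * (r k * r' k) = l k * (t' k * t k)" for k
      using rt'[of k] dims[of k] r t r' t' by (simp add: mult.assoc[symmetric])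
    have "sof_equiv G \<omega> n \<theta> l \<phi>"
      by (rule sof_equivI[OF dims' S_def m_closed[OF v' u'] conv])
    then show "((n, \<theta>), (l, \<phi>)) \<in> sof_rel G \<omega>" using n l by (simp add: sof_rel_def)
  qed
qed

end

theory Submission
  imports Defs "HOL-Library.Sublist" "HOL-Real_Asymp.Real_Asymp"
begin

text \<open>The representation sends the two generators to the \<open>n\<close>-cycle \<open>cyc n\<close> and to a permutation \<open>b\<close>
  of \<open>{1..n}\<close> that behaves like a random one, with \<open>n\<close> growing along \<open>k\<close>. Three properties of
  such a pair matter, and each of them fails only for a proportion of the permutations \<open>b\<close> that
  tends to 0 as \<open>n\<close> grows.

  \<^item> \<^emph>\<open>Freeness\<close> (\<open>free_fraction\<close>): a fixed nontrivial word in the pair fixes few points, because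
  the walk that it describes from a given point is unlikely ever to come back near itself. This
  makes the limit a sofic representation.

  \<^item> \<^emph>\<open>Expansion\<close> (\<open>expanding_fraction\<close>): a set that is almost invariant under the pair is almost
  empty or almost everything. The number of sets that are almost invariant under the cycle grows
  exponentially, but with a rate close to 0, and the probability that \<open>b\<close> almost preserves a given
  set of intermediate size decays exponentially with a larger rate.

  \<^item> \<^emph>\<open>Rigidity\<close> (\<open>rigid_fraction\<close>): a permutation that almost commutes with the pair is almost the
  identity. A permutation that commutes with the cycle off \<open>\<delta> n\<close> points is determined by these
  points and about \<open>\<delta> n\<close> of its values, so up to an exponential factor there are at most \<open>n\<close> to the
  power \<open>\<delta> n\<close> of them. If such a
  permutation moves a fixed proportion of the points, it almost commutes with \<open>b\<close> with probability
  \<open>n\<close> to the power \<open>- c n\<close>, where \<open>c\<close> is much larger than \<open>\<delta>\<close>. This makes the commutant trivial.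

  Expansion alone gives extremality (\<open>is_extreme_point_if_expanding\<close>). If \<open>[\<theta>]\<close> is a convex
  combination of \<open>[\<phi>]\<close> and \<open>[\<psi>]\<close>, then some amplification of \<open>\<theta>\<close> is conjugate to a direct sum of
  amplifications of \<open>\<phi>\<close> and \<open>\<psi>\<close>. The points that belong to \<open>\<phi>\<close> form an almost invariant set in many
  disjoint copies of \<open>{1..n}\<close>. By expansion this set is, up to a small error, a union of whole
  copies, so an amplification of \<open>\<phi>\<close> is close to an amplification of \<open>\<theta>\<close>. The sizes of the two agree
  only up to a factor that tends to 1, and this is repaired by amplifying each of them by the size
  of the other (\<open>matching_of_embedding\<close>). The same holds for \<open>\<psi>\<close>.\<close>

section \<open>Permutations that almost commute with given ones\<close>

lemma extend_to_bij_betw: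
  assumes "finite X" "finite Y" "card X = card Y" "D \<subseteq> X" "inj_on f D" "f ` D \<subseteq> Y"
  obtains h where "bij_betw h X Y" "\<And>x. x \<in> D \<Longrightarrow> h x = f x"
proof -
  have fin: "finite D" using assms finite_subset by blast
  have "card (X - D) = card (Y - f ` D)"
    using assms fin by (simp add: card_Diff_subset card_image)
  then obtain g where g: "bij_betw g (X - D) (Y - f ` D)"
    using finite_same_card_bij[of "X - D" "Y - f ` D"] assms by auto
  have "bij_betw (\<lambda>x. if x \<in> D then f x else g x) (D \<union> (X - D)) (f ` D \<union> (Y - f ` D))"
    by (rule bij_betw_disjoint_Un) (use assms g in \<open>auto simp: inj_on_imp_bij_betw\<close>)
  moreover have "D \<union> (X - D) = X" "f ` D \<union> (Y - f ` D) = Y" using assms by auto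
  ultimately show ?thesis by (intro that[of "\<lambda>x. if x \<in> D then f x else g x"]) auto
qed

definition cyc :: "nat \<Rightarrow> nat \<Rightarrow> nat" where
  "cyc n i = (if 1 \<le> i \<and> i < n then Suc i else if i = n \<and> 1 \<le> n then 1 else i)"

lemma cyc_permutes: "cyc n permutes {1..n}"
proof (rule bij_imp_permutes)
  have "inj_on (cyc n) {1..n}" by (auto simp: inj_on_def cyc_def split: if_splits)
  moreover have "cyc n ` {1..n} \<subseteq> {1..n}" by (auto simp: cyc_def)
  ultimately show "bij_betw (cyc n) {1..n} {1..n}"
    by (simp add: bij_betw_def endo_inj_surj)
qed (auto simp: cyc_def)

lemma finite_permutes: "finite A \<Longrightarrow> finite {p. p permutes A \<and> Q p}"
  using finite_permutations[of A] by (rule rev_finite_subset) auto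

text \<open>The sets \<open>{p \<circ> k |k. k permutes T}\<close> with \<open>p \<in> X\<close> are
  disjoint, because \<open>p \<circ> k\<close> agrees with \<open>p\<close> outside
  \<open>T\<close> and so determines \<open>p\<close>. Each of them has \<open>fact (card
  T)\<close> elements.\<close>

lemma card_determined_permutations:
  assumes fin: "finite U" and T: "T \<subseteq> U" and X: "X \<subseteq> {p. p permutes U}"
    and det: "\<And>p q. p \<in> X \<Longrightarrow> q \<in> X \<Longrightarrow> (\<And>x. x \<in> U - T \<Longrightarrow> p x = q x) \<Longrightarrow> p = q"
  shows "card X * fact (card T) \<le> fact (card U)"
proof -
  have finT: "finite T" using fin T finite_subset by blast
  have "inj_on (\<lambda>(p, k). p \<circ> k) (X \<times> {k. k permutes T})"
  proof (rule inj_onI, clarify)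
    fix p k q l
    assume p: "p \<in> X" and k: "k permutes T" and q: "q \<in> X" and l: "l permutes T"
      and eq: "p \<circ> k = q \<circ> l"
    have "p x = q x" if "x \<in> U - T" for x
      using fun_cong[OF eq, of x] that permutes_not_in[OF k, of x] permutes_not_in[OF l, of x] by simp
    then have pq: "p = q" by (rule det[OF p q])
    have "inj p" using p X permutes_inj by blast
    then have "k = l" using eq pq by (auto simp: fun_eq_iff inj_eq)
    with pq show "p = q \<and> k = l" by simp
  qed
  moreover have "(\<lambda>(p, k). p \<circ> k) ` (X \<times> {k. k permutes T}) \<subseteq> {p. p permutes U}"
    using X T permutes_subset[of _ T U] by (auto intro!: permutes_compose)
  ultimately have "card (X \<times> {k. k permutes T}) \<le> card {p. p permutes U}"
    by (intro card_inj_on_le finite_permutations fin)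
  then show ?thesis
    using card_permutations[OF refl fin] card_permutations[OF refl finT]
    by (simp add: card_cartesian_product)
qed

text \<open>If \<open>p\<close> commutes with the cycle off a set \<open>E\<close>, then its values can be
  computed one after the other along the cycle, except at the point 1 and at the successors of
  the points of \<open>E\<close>. The factor \<open>2 ^ n\<close> counts the choices of
  \<open>E\<close>.\<close>

lemma card_almost_commuting_cyc:
  assumes "n > 0"
  shows "card {p. p permutes {1..n} \<and> card {i \<in> {1..n}. p (cyc n i) \<noteq> cyc n (p i)} \<le> d}
     \<le> 2 ^ n * n ^ (d + 1)" (is "card ?X \<le> _")
proof -
  define XE where "XE E = {p. p permutes {1..n} \<and> {i \<in> {1..n}. p (cyc n i) \<noteq> cyc n (p i)} = E}" for E
  have bound: "card (XE E) \<le> n ^ (d + 1)" if E: "E \<subseteq> {1..n}" "card E \<le> d" for E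
  proof -
    define S where "S = insert 1 (cyc n ` E)"
    have S: "S \<subseteq> {1..n}" using E assms permutes_image[OF cyc_permutes[of n]] by (auto simp: S_def)
    have finE: "finite E" using E finite_subset by blast
    have cS: "card S \<le> d + 1"
      using card_insert_le_m1[of "d+1" "cyc n ` E" 1] card_image_le[OF finE, of "cyc n"] E(2)
      unfolding S_def by (simp add: card_insert_if finE)
    have "card (XE E) * fact (card ({1..n} - S)) \<le> fact (card {1..n})"
    proof (rule card_determined_permutations)
      fix p q assume p: "p \<in> XE E" and q: "q \<in> XE E"
        and eq: "\<And>x. x \<in> {1..n} - ({1..n} - S) \<Longrightarrow> p x = q x"
      have eqS: "p x = q x" if "x \<in> S" for x using eq[of x] that S by auto
      have "p i = q i" if "i \<ge> 1" "i \<le> n" for i using that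
      proof (induction i rule: dec_induct)
        case base show ?case by (rule eqS) (simp add: S_def)
      next
        case (step i)
        have i: "cyc n i = Suc i" using step by (simp add: cyc_def)
        show ?case
        proof (cases "i \<in> E")
          case True
          then have "Suc i \<in> S" using i by (auto simp: S_def intro!: image_eqI[of _ _ i])
          then show ?thesis by (rule eqS)
        next
          case False
          then have "i \<notin> {i \<in> {1..n}. p (cyc n i) \<noteq> cyc n (p i)}"
            "i \<notin> {i \<in> {1..n}. q (cyc n i) \<noteq> cyc n (q i)}"
            using p q unfolding XE_def by blast+
          then show ?thesis using i step by simp
        qed
      qed
      moreover have "p i = q i" if "\<not> (i \<ge> 1 \<and> i \<le> n)" for i
        using that p q permutes_not_in[of p "{1..n}" i] permutes_not_in[of q "{1..n}" i]
        unfolding XE_def by auto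
      ultimately show "p = q" by blast
    qed (auto simp: XE_def)
    then have le: "card (XE E) * fact (n - card S) \<le> fact n"
      using S by (simp add: card_Diff_subset finite_subset)
    have "card S \<le> n" using card_mono[OF _ S] by simp
    have "card (XE E) \<le> fact n div fact (n - card S)"
      using div_le_mono[OF le, of "fact (n - card S)"] by simp
    also have "\<dots> \<le> n ^ card S" by (rule fact_div_fact_le_pow) fact
    also have "\<dots> \<le> n ^ (d + 1)" using cS assms by (intro power_increasing) auto
    finally show ?thesis .
  qed
  have "?X \<subseteq> (\<Union>E\<in>{E. E \<subseteq> {1..n} \<and> card E \<le> d}. XE E)" by (auto simp: XE_def)
  then have "card ?X \<le> card (\<Union>E\<in>{E. E \<subseteq> {1..n} \<and> card E \<le> d}. XE E)"
    by (intro card_mono) (auto simp: XE_def intro!: finite_permutes)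
  also have "\<dots> \<le> (\<Sum>E\<in>{E. E \<subseteq> {1..n} \<and> card E \<le> d}. card (XE E))"
    by (rule card_UN_le) auto
  also have "\<dots> \<le> (\<Sum>E\<in>{E. E \<subseteq> {1..n} \<and> card E \<le> d}. n ^ (d + 1))"
    by (rule sum_mono) (use bound in auto)
  also have "\<dots> = card {E. E \<subseteq> {1..n} \<and> card E \<le> d} * n ^ (d + 1)" by simp
  also have "card {E. E \<subseteq> {1..n} \<and> card E \<le> d} \<le> card (Pow {1..n})"
    by (rule card_mono) auto
  finally show ?thesis by (simp add: card_Pow)
qed

text \<open>If \<open>b\<close> commutes with \<open>p\<close> off a set \<open>E\<close>, then \<open>b (p
  i) = p (b i)\<close> for \<open>i \<in> M - E\<close>. As \<open>M\<close> and \<open>p `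
  M\<close> are disjoint, the values of \<open>b\<close> on \<open>p ` (M - E)\<close> are
  determined by those elsewhere. For \<open>M\<close> of linear size the gain \<open>fact (card
  M - d)\<close> grows faster than any exponential, so the crude factor \<open>2 ^ n\<close> for
  the choice of \<open>E\<close> is harmless.\<close>

lemma card_almost_commuting:
  assumes p: "p permutes {1..n}" and M: "M \<subseteq> {1..n}" "M \<inter> p ` M = {}"
  shows "card {b. b permutes {1..n} \<and> card {i \<in> {1..n}. b (p i) \<noteq> p (b i)} \<le> d} * fact (card M - d)
     \<le> 2 ^ n * fact n" (is "card ?X * _ \<le> _")
proof -
  define XE where "XE E = {b. b permutes {1..n} \<and> {i \<in> {1..n}. b (p i) \<noteq> p (b i)} = E}" for E
  have bound: "card (XE E) * fact (card M - d) \<le> fact n" if E: "E \<subseteq> {1..n}" "card E \<le> d" for E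
  proof -
    define T where "T = p ` (M - E)"
    have finM: "finite M" using M finite_subset by blast
    have T: "T \<subseteq> {1..n}" using M permutes_image[OF p] by (auto simp: T_def)
    have "card (XE E) * fact (card T) \<le> fact (card {1..n})"
    proof (rule card_determined_permutations[OF _ T])
      fix b c assume b: "b \<in> XE E" and c: "c \<in> XE E"
        and eq: "\<And>x. x \<in> {1..n} - T \<Longrightarrow> b x = c x"
      show "b = c"
      proof
        fix x
        consider "x \<notin> {1..n}" | "x \<in> {1..n} - T" | "x \<in> T" by blast
        then show "b x = c x"
        proof cases
          case 1
          then show ?thesis
            using b c permutes_not_in[of b "{1..n}" x] permutes_not_in[of c "{1..n}" x]
            unfolding XE_def by auto
        next
          case 2 then show ?thesis by (rule eq)
        next
          case 3
          then obtain i where i: "i \<in> M" "i \<notin> E" "x = p i" by (auto simp: T_def)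
          then have "i \<in> {1..n} - T" using M by (auto simp: T_def)
          then have "b i = c i" by (rule eq)
          moreover have "b (p i) = p (b i)" "c (p i) = p (c i)"
            using i M(1) b c unfolding XE_def by blast+
          ultimately show ?thesis using i by simp
        qed
      qed
    qed (auto simp: XE_def)
    then have c: "card (XE E) * fact (card T) \<le> fact n" by simp
    have "card M - d \<le> card T"
    proof -
      have "card T = card (M - E)" unfolding T_def
        by (rule card_image) (use permutes_inj[OF p] in \<open>auto intro: inj_on_subset\<close>)
      also have "card M - card E \<le> card (M - E)" by (rule diff_card_le_card_Diff) (use E finite_subset in blast)
      finally show ?thesis using E(2) by simp
    qed
    then have "fact (card M - d) \<le> (fact (card T) :: nat)" by (rule fact_mono)
    then have "card (XE E) * fact (card M - d) \<le> card (XE E) * fact (card T)" by simp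
    also have "\<dots> \<le> fact n" by (rule c)
    finally show ?thesis .
  qed
  have "?X \<subseteq> (\<Union>E\<in>{E. E \<subseteq> {1..n} \<and> card E \<le> d}. XE E)" by (auto simp: XE_def)
  then have "card ?X \<le> card (\<Union>E\<in>{E. E \<subseteq> {1..n} \<and> card E \<le> d}. XE E)"
    by (intro card_mono) (auto simp: XE_def intro!: finite_permutes)
  also have "\<dots> \<le> (\<Sum>E\<in>{E. E \<subseteq> {1..n} \<and> card E \<le> d}. card (XE E))"
    by (rule card_UN_le) auto
  finally have "card ?X * fact (card M - d) \<le> (\<Sum>E\<in>{E. E \<subseteq> {1..n} \<and> card E \<le> d}. card (XE E)) * fact (card M - d)"
    by simp
  also have "\<dots> = (\<Sum>E\<in>{E. E \<subseteq> {1..n} \<and> card E \<le> d}. card (XE E) * fact (card M - d))"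
    by (rule sum_distrib_right)
  also have "\<dots> \<le> (\<Sum>E\<in>{E. E \<subseteq> {1..n} \<and> card E \<le> d}. fact n)"
    by (rule sum_mono) (use bound in auto)
  also have "\<dots> = card {E. E \<subseteq> {1..n} \<and> card E \<le> d} * fact n" by simp
  also have "card {E. E \<subseteq> {1..n} \<and> card E \<le> d} \<le> card (Pow {1..n})"
    by (rule card_mono) auto
  finally show ?thesis by (simp add: card_Pow)
qed

text \<open>A maximal \<open>M\<close> that is disjoint from its image will do: a moved point outside
  \<open>M \<union> p ` M \<union> inv p ` M\<close> could be added to it.\<close>

lemma moved_independent_set:
  assumes p: "p permutes U" and fin: "finite U"
  obtains M where "M \<subseteq> U" "M \<inter> p ` M = {}" "card {i \<in> U. p i \<noteq> i} \<le> 3 * card M"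
proof -
  define F where "F = {M. M \<subseteq> U \<and> M \<inter> p ` M = {}}"
  have "finite F" unfolding F_def using fin by auto
  moreover have "F \<noteq> {}" unfolding F_def by blast
  ultimately obtain M where M: "M \<in> F" and max: "\<And>N. N \<in> F \<Longrightarrow> M \<subseteq> N \<Longrightarrow> M = N"
    using finite_has_maximal by (metis (no_types, lifting))
  have MU: "M \<subseteq> U" "M \<inter> p ` M = {}" using M by (auto simp: F_def)
  have finM: "finite M" using MU fin finite_subset by blast
  have inj: "inj p" by (rule permutes_inj[OF p])
  have sub: "{i \<in> U. p i \<noteq> i} \<subseteq> M \<union> p ` M \<union> inv' p ` M"
  proof
    fix x assume x: "x \<in> {i \<in> U. p i \<noteq> i}"
    show "x \<in> M \<union> p ` M \<union> inv' p ` M"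
    proof (rule ccontr)
      assume nx: "x \<notin> M \<union> p ` M \<union> inv' p ` M"
      have "p x \<notin> M" using nx inj by (metis UnI2 image_eqI inv_f_f)
      then have "insert x M \<in> F" using x nx MU inj unfolding F_def by (auto dest: injD)
      then show False using max[of "insert x M"] nx by blast
    qed
  qed
  have "card {i \<in> U. p i \<noteq> i} \<le> card (M \<union> p ` M \<union> inv' p ` M)"
    by (rule card_mono[OF _ sub]) (use finM in auto)
  also have "\<dots> \<le> card M + card (p ` M) + card (inv' p ` M)"
    by (meson add_le_mono1 card_Un_le le_trans)
  also have "\<dots> \<le> 3 * card M" using card_image_le[OF finM, of p] card_image_le[OF finM, of "inv' p"] by simp
  finally show ?thesis using that MU by blast
qed

section \<open>Sets with a small boundary\<close>

text \<open>Composition with a permutation that carries \<open>B\<close> to \<open>C\<close> embeds the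
  permutations with \<open>b ` A = B\<close> into those with \<open>b ` A = C\<close>, and for
  different \<open>C\<close> of the size of \<open>A\<close> the latter sets are disjoint.\<close>

lemma card_permutations_image_eq:
  assumes fin: "finite U" and A: "A \<subseteq> U" "B \<subseteq> U" "card B = card A"
  shows "card {b. b permutes U \<and> b ` A = B} * (card U choose card A) \<le> fact (card U)"
proof -
  have ex: "\<exists>c. c permutes U \<and> c ` B = C" if C: "C \<subseteq> U" "card C = card A" for C
  proof -
    have "finite B" "finite C" using fin A C finite_subset by blast+
    then obtain f where f: "bij_betw f B C" using finite_same_card_bij[of B C] A C by auto
    obtain h where h: "bij_betw h U U" "\<And>x. x \<in> B \<Longrightarrow> h x = f x"
      using extend_to_bij_betw[OF fin fin refl A(2), of f] f C by (metis bij_betw_def)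
    define c where "c x = (if x \<in> U then h x else x)" for x
    have "bij_betw c U U" using h(1) by (simp add: c_def cong: bij_betw_cong)
    then have "c permutes U" by (rule bij_imp_permutes) (simp add: c_def)
    moreover have "c ` B = f ` B" using A(2) h(2) by (intro image_cong) (auto simp: c_def)
    ultimately show ?thesis using f by (auto simp: bij_betw_def)
  qed
  define \<C> where "\<C> = {C. C \<subseteq> U \<and> card C = card A}"
  obtain c where c: "\<And>C. C \<in> \<C> \<Longrightarrow> c C permutes U \<and> c C ` B = C"
    using ex unfolding \<C>_def by (metis (mono_tags, lifting) mem_Collect_eq)
  have "inj_on (\<lambda>(b, C). c C \<circ> b) ({b. b permutes U \<and> b ` A = B} \<times> \<C>)"
  proof (rule inj_onI, clarify)
    fix b C b' C'
    assume b: "b permutes U" "B = b ` A" and C: "C \<in> \<C>"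
      and b': "b' permutes U" "b' ` A = b ` A" and C': "C' \<in> \<C>"
      and eq: "c C \<circ> b = c C' \<circ> b'"
    have "C = (c C \<circ> b) ` A" using c[OF C] b by (simp only: image_comp[symmetric])
    also have "\<dots> = C'" unfolding eq using c[OF C'] b b' by (simp only: image_comp[symmetric])
    finally have "C = C'" .
    moreover have "inj (c C)" using c[OF C] permutes_inj by blast
    ultimately show "b = b' \<and> C = C'" using eq by (auto simp: fun_eq_iff inj_eq)
  qed
  moreover have "(\<lambda>(b, C). c C \<circ> b) ` ({b. b permutes U \<and> b ` A = B} \<times> \<C>) \<subseteq> {b. b permutes U}"
    using c by (auto intro: permutes_compose)
  ultimately have "card ({b. b permutes U \<and> b ` A = B} \<times> \<C>) \<le> card {b. b permutes U}"
    by (intro card_inj_on_le finite_permutations fin)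
  then show ?thesis
    using card_permutations[OF refl fin] n_subsets[OF fin, of "card A"]
    by (simp add: card_cartesian_product \<C>_def)
qed

definition small_subsets :: "nat \<Rightarrow> nat \<Rightarrow> nat set set" where
  "small_subsets n d = {D. D \<subseteq> {1..n} \<and> card D \<le> d}"

lemma finite_small_subsets: "finite (small_subsets n d)"
  unfolding small_subsets_def by simp

text \<open>The exponential Markov inequality: the weights \<open>x ^ card D\<close> of all subsets add up
  to \<open>(1 + x) ^ n\<close>, and each set that is counted has weight at least \<open>x ^
  d\<close>.\<close>

lemma card_small_subsets_le:
  fixes x :: real
  assumes "0 < x" "x \<le> 1"
  shows "real (card (small_subsets n d)) * x ^ d \<le> (1 + x) ^ n"
proof -
  have "real (card (small_subsets n d)) * x ^ d = (\<Sum>D\<in>small_subsets n d. x ^ d)" by simp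
  also have "\<dots> \<le> (\<Sum>D\<in>small_subsets n d. x ^ card D)"
    by (rule sum_mono) (use assms in \<open>auto simp: small_subsets_def intro!: power_decreasing\<close>)
  also have "\<dots> \<le> (\<Sum>D\<in>Pow {1..n}. x ^ card D)"
    by (rule sum_mono2) (use assms in \<open>auto simp: small_subsets_def\<close>)
  also have "\<dots> = (\<Prod>i\<in>{1..n}. 1 + x)"
    using prod_add[of "{1..n}" "\<lambda>_. x" "\<lambda>_. 1"] by (simp add: add.commute)
  finally show ?thesis by simp
qed

definition edge_boundary :: "'a set \<Rightarrow> ('a \<Rightarrow> 'a) \<Rightarrow> 'a set \<Rightarrow> 'a set" where
  "edge_boundary U g A = {i \<in> U. (i \<in> A) \<noteq> (g i \<in> A)}"

text \<open>Along the cycle, membership in \<open>A\<close> changes exactly at the boundary points. So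
  \<open>A\<close> can be recovered from its boundary and from whether it contains 1.\<close>

lemma card_small_boundary_cyc:
  assumes "n > 0"
  shows "card {A. A \<subseteq> {1..n} \<and> card (edge_boundary {1..n} (cyc n) A) \<le> d}
    \<le> 2 * card (small_subsets n d)" (is "card ?X \<le> _")
proof -
  have "inj_on (\<lambda>A. (1 \<in> A, edge_boundary {1..n} (cyc n) A)) ?X"
  proof (rule inj_onI)
    fix A B assume A: "A \<in> ?X" and B: "B \<in> ?X"
      and "(1 \<in> A, edge_boundary {1..n} (cyc n) A) = (1 \<in> B, edge_boundary {1..n} (cyc n) B)"
    then have one: "(1 \<in> A) = (1 \<in> B)" and bd: "edge_boundary {1..n} (cyc n) A = edge_boundary {1..n} (cyc n) B"
      by blast+
    have "(i \<in> A) = (i \<in> B)" if "i \<ge> 1" "i \<le> n" for i using that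
    proof (induction i rule: dec_induct)
      case base show ?case by (rule one)
    next
      case (step i)
      then have i: "i \<in> {1..n}" "cyc n i = Suc i" by (auto simp: cyc_def)
      have "(i \<in> edge_boundary {1..n} (cyc n) A) = (i \<in> edge_boundary {1..n} (cyc n) B)"
        using bd by simp
      then show ?case using i step by (auto simp: edge_boundary_def)
    qed
    then have "A \<inter> {1..n} = B \<inter> {1..n}" by auto
    moreover have "A \<subseteq> {1..n}" "B \<subseteq> {1..n}" using A B by (simp_all only: mem_Collect_eq)
    ultimately show "A = B" by (simp only: Int_absorb2)
  qed
  moreover have "(\<lambda>A. (1 \<in> A, edge_boundary {1..n} (cyc n) A)) ` ?X \<subseteq> UNIV \<times> small_subsets n d"
    by (auto simp: small_subsets_def edge_boundary_def)
  ultimately have "card ?X \<le> card ((UNIV :: bool set) \<times> small_subsets n d)"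
    by (intro card_inj_on_le finite_cartesian_product finite_small_subsets finite_UNIV)
  then show ?thesis by (simp add: card_cartesian_product)
qed

text \<open>The symmetric difference of \<open>A\<close> and \<open>b ` A\<close> has at most
  \<open>d\<close> elements, which leaves few candidates for \<open>b ` A\<close>, and every set
  of the size of \<open>A\<close> is equally likely to be this image.\<close>

lemma card_small_boundary_perm:
  assumes A: "A \<subseteq> {1..n}"
  shows "card {b. b permutes {1..n} \<and> card (edge_boundary {1..n} b A) \<le> d} * (n choose card A)
    \<le> card (small_subsets n d) * fact n" (is "card ?X * _ \<le> _")
proof -
  define \<B> where "\<B> = {B. B \<subseteq> {1..n} \<and> card B = card A \<and> sym_diff A B \<in> small_subsets n d}"
  define F where "F B = {b. b permutes {1..n} \<and> b ` A = B}" for B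
  have finB: "finite \<B>" unfolding \<B>_def by simp
  have "inj_on (\<lambda>B. sym_diff A B) \<B>" by (rule inj_onI) blast
  then have cB: "card \<B> \<le> card (small_subsets n d)"
    by (rule card_inj_on_le) (auto simp: \<B>_def finite_small_subsets)
  have "?X \<subseteq> (\<Union>B\<in>\<B>. F B)"
  proof
    fix b assume b: "b \<in> ?X"
    then have bp: "b permutes {1..n}" by blast
    have "sym_diff A (b ` A) \<subseteq> b ` edge_boundary {1..n} b A"
    proof
      fix y assume y: "y \<in> sym_diff A (b ` A)"
      then have "y \<in> {1..n}" using A permutes_image[OF bp] by blast
      then obtain x where x: "x \<in> {1..n}" "y = b x" using permutes_image[OF bp] by blast
      have "b x \<in> b ` A \<longleftrightarrow> x \<in> A" using permutes_inj[OF bp] by (simp add: inj_image_mem_iff)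
      then show "y \<in> b ` edge_boundary {1..n} b A" using x y by (auto simp: edge_boundary_def)
    qed
    then have "card (sym_diff A (b ` A)) \<le> card (b ` edge_boundary {1..n} b A)"
      by (rule card_mono[rotated]) (simp add: edge_boundary_def)
    also have "\<dots> \<le> card (edge_boundary {1..n} b A)"
      by (rule card_image_le) (simp add: edge_boundary_def)
    also have "\<dots> \<le> d" using b by blast
    finally have "b ` A \<in> \<B>"
      using A permutes_image[OF bp] card_image[OF inj_on_subset[OF permutes_inj[OF bp]], of A]
      unfolding \<B>_def small_subsets_def by auto
    then show "b \<in> (\<Union>B\<in>\<B>. F B)" using bp by (auto simp: F_def)
  qed
  then have "card ?X \<le> card (\<Union>B\<in>\<B>. F B)"
    by (intro card_mono finite_UN_I finB) (auto simp: F_def intro!: finite_permutes)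
  also have "\<dots> \<le> (\<Sum>B\<in>\<B>. card (F B))" by (rule card_UN_le[OF finB])
  finally have "card ?X * (n choose card A) \<le> (\<Sum>B\<in>\<B>. card (F B)) * (n choose card A)" by simp
  also have "\<dots> = (\<Sum>B\<in>\<B>. card (F B) * (n choose card A))" by (rule sum_distrib_right)
  also have "\<dots> \<le> (\<Sum>B\<in>\<B>. fact n)"
  proof (rule sum_mono)
    fix B assume "B \<in> \<B>"
    then show "card (F B) * (n choose card A) \<le> fact n"
      using card_permutations_image_eq[of "{1..n}" A B] A unfolding F_def \<B>_def by simp
  qed
  also have "\<dots> \<le> card (small_subsets n d) * fact n" using cB by simp
  finally show ?thesis .
qed

section \<open>Expansion and rigidity of a random pair\<close>

text \<open>A qualitative form of expansion. The constant \<open>\<delta>\<close> will depend on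
  \<open>\<epsilon>\<close> but not on \<open>n\<close>.\<close>

definition expanding :: "nat \<Rightarrow> real \<Rightarrow> real \<Rightarrow> (nat \<Rightarrow> nat) set \<Rightarrow> bool" where
  "expanding n \<epsilon> \<delta> S \<longleftrightarrow> (\<forall>A\<subseteq>{1..n}.
     (\<forall>g\<in>S. real (card (edge_boundary {1..n} g A)) \<le> \<delta> * real n) \<longrightarrow>
     real (card A) \<le> \<epsilon> * real n \<or> (1 - \<epsilon>) * real n \<le> real (card A))"

text \<open>A finitary form of the triviality of the commutant.\<close>

definition rigid :: "nat \<Rightarrow> real \<Rightarrow> real \<Rightarrow> (nat \<Rightarrow> nat) set \<Rightarrow> bool" where
  "rigid n \<epsilon> \<delta> S \<longleftrightarrow> (\<forall>p. p permutes {1..n} \<longrightarrow>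
     (\<forall>g\<in>S. hamming_dist n (p \<circ> g) (g \<circ> p) \<le> \<delta>) \<longrightarrow> hamming_dist n p id \<le> \<epsilon>)"

text \<open>In the bound \<open>(1 + x) ^ n / x ^ d\<close>, first \<open>x\<close> is taken so small that
  the numerator is at most \<open>2 powr (\<epsilon> n / 2)\<close>, and then
  \<open>\<delta>\<close> is chosen such that \<open>x powr (- \<delta> n)\<close> is equal to
  this number.\<close>

lemma small_subsets_subexponential:
  fixes \<epsilon> :: real
  assumes "\<epsilon> > 0"
  shows "\<exists>\<delta>>0. \<forall>n. real (card (small_subsets n (nat \<lfloor>\<delta> * real n\<rfloor>))) \<le> 2 powr (\<epsilon> * real n)"
proof -
  define x where "x = min (1/2) (2 powr (\<epsilon> / 2) - 1 :: real)"
  have "(1::real) < 2 powr (\<epsilon> / 2)" using assms by simp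
  then have x: "0 < x" "x \<le> 1/2" "1 + x \<le> 2 powr (\<epsilon> / 2)" unfolding x_def by linarith+
  define \<delta> where "\<delta> = (\<epsilon> / 2) * ln 2 / (- ln x)"
  have lnx: "ln x < 0" using x by simp
  have \<delta>: "\<delta> > 0" unfolding \<delta>_def using assms lnx by (intro divide_pos_pos mult_pos_pos) auto
  have "real (card (small_subsets n (nat \<lfloor>\<delta> * real n\<rfloor>))) \<le> 2 powr (\<epsilon> * real n)" for n
  proof -
    let ?d = "nat \<lfloor>\<delta> * real n\<rfloor>"
    have d: "real ?d \<le> \<delta> * real n" using \<delta> by simp
    have "2 powr (- (\<epsilon> / 2 * real n)) = x powr (\<delta> * real n)"
      using x lnx by (simp add: powr_def \<delta>_def)
    also have "\<dots> \<le> x powr (real ?d)" using x d by (intro powr_mono') auto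
    also have "\<dots> = x ^ ?d" using x by (simp add: powr_realpow)
    finally have a: "2 powr (- (\<epsilon> / 2 * real n)) \<le> x ^ ?d" .
    have "(1 + x) ^ n \<le> (2 powr (\<epsilon> / 2)) ^ n" using x by (intro power_mono) auto
    also have "\<dots> = 2 powr (\<epsilon> / 2 * real n)" by (simp add: powr_realpow[symmetric] powr_powr)
    finally have b: "(1 + x) ^ n \<le> 2 powr (\<epsilon> / 2 * real n)" .
    have "real (card (small_subsets n ?d)) * 2 powr (- (\<epsilon> / 2 * real n))
        \<le> real (card (small_subsets n ?d)) * x ^ ?d" using a by (intro mult_left_mono) auto
    also have "\<dots> \<le> (1 + x) ^ n" using x by (intro card_small_subsets_le) auto
    also have "\<dots> \<le> 2 powr (\<epsilon> / 2 * real n)" by (rule b)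
    finally have "real (card (small_subsets n ?d)) \<le> 2 powr (\<epsilon> / 2 * real n) * 2 powr (\<epsilon> / 2 * real n)"
      by (simp add: powr_minus field_simps)
    then show ?thesis by (simp add: powr_add[symmetric])
  qed
  with \<delta> show ?thesis by blast
qed

text \<open>For \<open>k \<le> n / 2\<close> this is \<open>2 ^ k \<le> (n / k) ^ k \<le> (n choose
  k)\<close>, and the other half is symmetric.\<close>

lemma binomial_middle_ge:
  fixes \<epsilon> :: real
  assumes "\<epsilon> * real n \<le> real k" "real k \<le> (1 - \<epsilon>) * real n" "k \<le> n"
  shows "2 powr (\<epsilon> * real n) \<le> real (n choose k)"
proof -
  have half: "2 powr (\<epsilon> * real n) \<le> real (n choose j)" if "\<epsilon> * real n \<le> real j" "2 * j \<le> n" for j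
  proof (cases "j = 0")
    case False
    have "2 powr (\<epsilon> * real n) \<le> 2 powr (real j)" using that by simp
    also have "\<dots> = 2 ^ j" by (simp add: powr_realpow)
    also have "\<dots> \<le> (real n / real j) ^ j"
      using that False by (intro power_mono) (auto simp: field_simps)
    also have "\<dots> \<le> real (n choose j)" using that by (intro binomial_ge_n_over_k_pow_k) auto
    finally show ?thesis .
  next
    case True
    then have "2 powr (\<epsilon> * real n) \<le> 2 powr 0" using that by (intro powr_mono) auto
    then show ?thesis using True by simp
  qed
  show ?thesis
  proof (cases "2 * k \<le> n")
    case True then show ?thesis using half assms by blast
  next
    case False
    then have "2 powr (\<epsilon> * real n) \<le> real (n choose (n - k))"
      using assms by (intro half) (auto simp: of_nat_diff algebra_simps)
    then show ?thesis using binomial_symmetric[OF assms(3)] by simp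
  qed
qed

text \<open>A union bound over the sets \<open>A\<close> of intermediate size. With \<open>G\<close> the
  number of sets of size at most \<open>\<delta> n\<close>, there are at most \<open>2 *
  G\<close> sets with a small boundary for the cycle, and each of them has a small boundary for
  \<open>b\<close> with probability at most \<open>G / 2 powr (\<epsilon> n)\<close>. It
  suffices that \<open>G \<le> 2 powr (\<epsilon> n / 4)\<close>.\<close>

lemma expanding_fraction:
  fixes \<epsilon> :: real
  assumes "\<epsilon> > 0"
  shows "\<exists>\<delta>>0. (\<lambda>n. real (card {b. b permutes {1..n} \<and> \<not> expanding n \<epsilon> \<delta> {cyc n, b}}) / fact n) \<longlonglongrightarrow> 0"
proof -
  obtain \<delta> where \<delta>: "\<delta> > 0" and
    G: "\<And>n. real (card (small_subsets n (nat \<lfloor>\<delta> * real n\<rfloor>))) \<le> 2 powr (\<epsilon> / 4 * real n)"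
    using small_subsets_subexponential[of "\<epsilon> / 4"] assms by auto
  have bound: "real (card {b. b permutes {1..n} \<and> \<not> expanding n \<epsilon> \<delta> {cyc n, b}}) / fact n
     \<le> 2 * 2 powr (- (\<epsilon> / 2 * real n))" if n: "n > 0" for n
  proof -
    define d where "d = nat \<lfloor>\<delta> * real n\<rfloor>"
    define G where "G = real (card (small_subsets n d))"
    have Gle: "G \<le> 2 powr (\<epsilon> / 4 * real n)" "0 \<le> G" using G[of n] by (auto simp: G_def d_def)
    have le_d: "real c \<le> \<delta> * real n \<longleftrightarrow> c \<le> d" for c :: nat
      unfolding d_def using \<delta> by (simp add: le_nat_iff le_floor_iff)
    define \<A> where "\<A> = {A. A \<subseteq> {1..n} \<and> card (edge_boundary {1..n} (cyc n) A) \<le> d \<and>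
       \<epsilon> * real n < real (card A) \<and> real (card A) < (1 - \<epsilon>) * real n}"
    define X where "X A = {b. b permutes {1..n} \<and> card (edge_boundary {1..n} b A) \<le> d}" for A
    have fin: "finite \<A>" unfolding \<A>_def by simp
    have "card \<A> \<le> card {A. A \<subseteq> {1..n} \<and> card (edge_boundary {1..n} (cyc n) A) \<le> d}"
      by (rule card_mono) (auto simp: \<A>_def)
    also have "\<dots> \<le> 2 * card (small_subsets n d)" by (rule card_small_boundary_cyc[OF n])
    finally have cA: "real (card \<A>) \<le> 2 * G" by (simp add: G_def)
    have cX: "real (card (X A)) \<le> G * fact n / 2 powr (\<epsilon> * real n)" if A: "A \<in> \<A>" for A
    proof -
      have AU: "A \<subseteq> {1..n}" using A by (auto simp: \<A>_def)
      have "card (X A) * (n choose card A) \<le> card (small_subsets n d) * fact n"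
        unfolding X_def by (rule card_small_boundary_perm[OF AU])
      then have "real (card (X A) * (n choose card A)) \<le> real (card (small_subsets n d) * fact n)"
        by (simp only: of_nat_le_iff)
      then have 1: "real (card (X A)) * real (n choose card A) \<le> G * fact n" by (simp add: G_def)
      have "card A \<le> n" using card_mono[OF _ AU] by simp
      then have "2 powr (\<epsilon> * real n) \<le> real (n choose card A)"
        using A by (intro binomial_middle_ge) (auto simp: \<A>_def)
      then have "real (card (X A)) * 2 powr (\<epsilon> * real n) \<le> G * fact n"
        using 1 by (meson mult_left_mono of_nat_0_le_iff order_trans)
      then show ?thesis by (simp add: field_simps)
    qed
    have "{b. b permutes {1..n} \<and> \<not> expanding n \<epsilon> \<delta> {cyc n, b}} \<subseteq> (\<Union>A\<in>\<A>. X A)"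
      unfolding expanding_def X_def \<A>_def le_d by (auto simp: not_le)
    then have "card {b. b permutes {1..n} \<and> \<not> expanding n \<epsilon> \<delta> {cyc n, b}} \<le> card (\<Union>A\<in>\<A>. X A)"
      by (intro card_mono finite_UN_I fin) (auto simp: X_def intro!: finite_permutes)
    also have "\<dots> \<le> (\<Sum>A\<in>\<A>. card (X A))" by (rule card_UN_le[OF fin])
    finally have "real (card {b. b permutes {1..n} \<and> \<not> expanding n \<epsilon> \<delta> {cyc n, b}})
        \<le> real (\<Sum>A\<in>\<A>. card (X A))" by (simp only: of_nat_le_iff)
    also have "\<dots> = (\<Sum>A\<in>\<A>. real (card (X A)))" by simp
    also have "\<dots> \<le> (\<Sum>A\<in>\<A>. G * fact n / 2 powr (\<epsilon> * real n))" by (rule sum_mono) (rule cX)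
    also have "\<dots> = real (card \<A>) * (G * fact n / 2 powr (\<epsilon> * real n))" by simp
    also have "\<dots> \<le> (2 * G) * (G * fact n / 2 powr (\<epsilon> * real n))"
      using cA Gle by (intro mult_right_mono) auto
    also have "\<dots> = 2 * (G * G) / 2 powr (\<epsilon> * real n) * fact n" by simp
    also have "\<dots> \<le> 2 * (2 powr (\<epsilon> / 4 * real n) * 2 powr (\<epsilon> / 4 * real n)) / 2 powr (\<epsilon> * real n) * fact n"
      using Gle by (intro mult_right_mono divide_right_mono mult_left_mono mult_mono) auto
    also have "\<dots> = 2 * 2 powr (- (\<epsilon> / 2 * real n)) * fact n"
      by (simp add: powr_add[symmetric] powr_diff[symmetric] field_simps)
    finally show ?thesis by (simp add: field_simps)
  qed
  have "(\<lambda>n. real (card {b. b permutes {1..n} \<and> \<not> expanding n \<epsilon> \<delta> {cyc n, b}}) / fact n) \<longlonglongrightarrow> 0"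
  proof (rule tendsto_sandwich[OF _ _ tendsto_const])
    show "(\<lambda>n. 2 * 2 powr (- (\<epsilon> / 2 * real n))) \<longlonglongrightarrow> 0" using assms by real_asymp
    show "\<forall>\<^sub>F n in sequentially. real (card {b. b permutes {1..n} \<and> \<not> expanding n \<epsilon> \<delta> {cyc n, b}}) / fact n
        \<le> 2 * 2 powr (- (\<epsilon> / 2 * real n))"
      using eventually_gt_at_top[of 0] by eventually_elim (rule bound)
  qed simp
  with \<delta> show ?thesis by blast
qed

text \<open>The term with index \<open>s\<close> of the exponential series gives \<open>s ^ s / fact s \<le>
  exp s\<close>.\<close>

lemma fact_ge_powr:
  fixes y :: real
  assumes "exp 1 \<le> y"
  shows "(y / exp 1) powr y \<le> fact (nat \<lceil>y\<rceil>)"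
proof -
  define s where "s = nat \<lceil>y\<rceil>"
  have y: "0 < y" "1 \<le> y / exp 1" "y \<le> real s"
    using assms less_le_trans[OF exp_gt_zero assms] by (auto simp: s_def real_nat_ceiling_ge)
  have "(y / exp 1) powr y \<le> (y / exp 1) powr (real s)" using y by (intro powr_mono) auto
  also have "\<dots> = (y / exp 1) ^ s" using y by (simp add: powr_realpow)
  also have "\<dots> \<le> (real s / exp 1) ^ s" using y by (intro power_mono divide_right_mono) auto
  also have "\<dots> = real s ^ s / exp (real s)" by (simp add: power_divide exp_of_nat_mult[symmetric])
  also have "\<dots> \<le> fact s"
  proof -
    have "real s ^ s /\<^sub>R fact s \<le> (\<Sum>n. real s ^ n /\<^sub>R fact n)"
      using sum_le_suminf[OF summable_exp_generic[of "real s"], of "{s}"] by simp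
    then have "real s ^ s / fact s \<le> exp (real s)" by (simp add: exp_def divide_inverse_commute)
    then show ?thesis by (simp add: field_simps)
  qed
  finally show ?thesis unfolding s_def .
qed

lemma hamming_dist_le_iff:
  "n > 0 \<Longrightarrow> hamming_dist n p q \<le> \<delta> \<longleftrightarrow> real (card {i \<in> {1..n}. p i \<noteq> q i}) \<le> \<delta> * real n"
  by (simp add: hamming_dist_def divide_simps)

text \<open>A union bound over the permutations \<open>p\<close> that almost commute with the cycle and move
  more than \<open>\<epsilon> n\<close> points. For \<open>\<delta> = \<epsilon> / 12\<close>
  there is an \<open>M\<close> as in \<open>card_almost_commuting\<close> with \<open>card M -
  \<delta> n \<ge> \<epsilon> n / 3 - \<epsilon> n / 12 = 3 \<delta> n\<close>. Up to
  exponential factors there are \<open>n powr (\<delta> n)\<close> choices of \<open>p\<close>,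
  and each of them almost commutes with \<open>b\<close> with probability \<open>n powr (- 3
  \<delta> n)\<close>.\<close>

lemma rigid_fraction:
  fixes \<epsilon> :: real
  assumes "\<epsilon> > 0"
  shows "\<exists>\<delta>>0. (\<lambda>n. real (card {b. b permutes {1..n} \<and> \<not> rigid n \<epsilon> \<delta> {cyc n, b}}) / fact n) \<longlonglongrightarrow> 0"
proof -
  define \<delta> where "\<delta> = \<epsilon> / 12"
  have \<delta>: "\<delta> > 0" using assms by (simp add: \<delta>_def)
  have bound: "real (card {b. b permutes {1..n} \<and> \<not> rigid n \<epsilon> \<delta> {cyc n, b}}) / fact n
     \<le> 4 ^ n * real n powr (\<delta> * real n + 1) / (3 * \<delta> * real n / exp 1) powr (3 * \<delta> * real n)"
    if n: "n > 0" and large: "exp 1 \<le> 3 * \<delta> * real n" for n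
  proof -
    define d where "d = nat \<lfloor>\<delta> * real n\<rfloor>"
    define s where "s = nat \<lceil>3 * \<delta> * real n\<rceil>"
    have le_d: "real c \<le> \<delta> * real n \<longleftrightarrow> c \<le> d" for c :: nat
      unfolding d_def using \<delta> by (simp add: le_nat_iff le_floor_iff)
    have d: "real d \<le> \<delta> * real n" using le_d by blast
    define P where "P = {p. p permutes {1..n} \<and> card {i \<in> {1..n}. p (cyc n i) \<noteq> cyc n (p i)} \<le> d \<and>
       \<epsilon> * real n < real (card {i \<in> {1..n}. p i \<noteq> i})}"
    define X where "X p = {b. b permutes {1..n} \<and> card {i \<in> {1..n}. b (p i) \<noteq> p (b i)} \<le> d}" for p
    have fin: "finite P" unfolding P_def by (intro finite_permutes) simp
    have "card P \<le> card {p. p permutes {1..n} \<and> card {i \<in> {1..n}. p (cyc n i) \<noteq> cyc n (p i)} \<le> d}"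
      by (intro card_mono finite_permutes) (auto simp: P_def)
    also have "\<dots> \<le> 2 ^ n * n ^ (d + 1)" by (rule card_almost_commuting_cyc[OF n])
    finally have cP: "card P \<le> 2 ^ n * n ^ (d + 1)" .
    have cX: "card (X p) * fact s \<le> 2 ^ n * fact n" if p: "p \<in> P" for p
    proof -
      have pp: "p permutes {1..n}" using p by (simp add: P_def)
      obtain M where M: "M \<subseteq> {1..n}" "M \<inter> p ` M = {}" "card {i \<in> {1..n}. p i \<noteq> i} \<le> 3 * card M"
        using moved_independent_set[OF pp] by auto
      have "\<epsilon> * real n < 3 * real (card M)" using p M(3) by (simp add: P_def)
      then have "3 * \<delta> * real n \<le> real (card M - d)" using d by (simp add: \<delta>_def field_simps)
      then have "s \<le> card M - d" unfolding s_def by linarith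
      then have "fact s \<le> (fact (card M - d) :: nat)" by (rule fact_mono)
      then have "card (X p) * fact s \<le> card (X p) * fact (card M - d)" by simp
      also have "\<dots> \<le> 2 ^ n * fact n" unfolding X_def by (rule card_almost_commuting[OF pp M(1,2)])
      finally show ?thesis .
    qed
    have "{b. b permutes {1..n} \<and> \<not> rigid n \<epsilon> \<delta> {cyc n, b}} \<subseteq> (\<Union>p\<in>P. X p)"
    proof clarify
      fix b assume b: "b permutes {1..n}" "\<not> rigid n \<epsilon> \<delta> {cyc n, b}"
      then obtain p where p: "p permutes {1..n}"
        and "hamming_dist n (p \<circ> cyc n) (cyc n \<circ> p) \<le> \<delta>"
        and "hamming_dist n (b \<circ> p) (p \<circ> b) \<le> \<delta>"
        and "\<not> hamming_dist n p id \<le> \<epsilon>"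
        unfolding rigid_def by (auto simp: hamming_dist_commute[of n "b \<circ> _"])
      then have "p \<in> P" "b \<in> X p"
        using b(1) unfolding P_def X_def hamming_dist_le_iff[OF n] le_d by (auto simp: not_le)
      then show "b \<in> (\<Union>p\<in>P. X p)" by blast
    qed
    then have "card {b. b permutes {1..n} \<and> \<not> rigid n \<epsilon> \<delta> {cyc n, b}} \<le> card (\<Union>p\<in>P. X p)"
      by (intro card_mono finite_UN_I fin) (auto simp: X_def intro!: finite_permutes)
    also have "\<dots> \<le> (\<Sum>p\<in>P. card (X p))" by (rule card_UN_le[OF fin])
    finally have "card {b. b permutes {1..n} \<and> \<not> rigid n \<epsilon> \<delta> {cyc n, b}} * fact s
        \<le> (\<Sum>p\<in>P. card (X p)) * fact s" by simp
    also have "\<dots> = (\<Sum>p\<in>P. card (X p) * fact s)" by (rule sum_distrib_right)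
    also have "\<dots> \<le> (\<Sum>p\<in>P. 2 ^ n * fact n)" by (rule sum_mono) (rule cX)
    also have "\<dots> \<le> (2 ^ n * n ^ (d + 1)) * (2 ^ n * fact n)" using cP by simp
    also have "\<dots> = 4 ^ n * n ^ (d + 1) * fact n"
      by (simp add: power_mult_distrib[symmetric])
    finally have "real (card {b. b permutes {1..n} \<and> \<not> rigid n \<epsilon> \<delta> {cyc n, b}} * fact s)
        \<le> real (4 ^ n * n ^ (d + 1) * fact n)" by (simp only: of_nat_le_iff)
    then have "real (card {b. b permutes {1..n} \<and> \<not> rigid n \<epsilon> \<delta> {cyc n, b}}) / fact n
        \<le> 4 ^ n * real n ^ (d + 1) / fact s" by (simp add: field_simps)
    also have "real n ^ (d + 1) = real n powr (real d + 1)"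
      using n by (simp add: powr_add powr_realpow)
    also have "4 ^ n * real n powr (real d + 1) / fact s
      \<le> 4 ^ n * real n powr (\<delta> * real n + 1) / (3 * \<delta> * real n / exp 1) powr (3 * \<delta> * real n)"
    proof (rule frac_le)
      show "(3 * \<delta> * real n / exp 1) powr (3 * \<delta> * real n) \<le> fact s"
        unfolding s_def by (rule fact_ge_powr[OF large])
      show "4 ^ n * real n powr (real d + 1) \<le> 4 ^ n * real n powr (\<delta> * real n + 1)"
        using n d by (intro mult_left_mono powr_mono) auto
    qed (use n \<delta> in auto)
    finally show ?thesis .
  qed
  have "(\<lambda>n. real (card {b. b permutes {1..n} \<and> \<not> rigid n \<epsilon> \<delta> {cyc n, b}}) / fact n) \<longlonglongrightarrow> 0"
  proof (rule tendsto_sandwich[OF _ _ tendsto_const])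
    \<comment> \<open>The leading term of the exponent is \<open>\<delta> n ln n - 3 \<delta> n ln n\<close>, and \<open>C\<close> is the coefficient of \<open>n\<close>.\<close>
    define C where "C = ln 4 - 3 * \<delta> * ln (3 * \<delta>) + 3 * \<delta>"
    have eq: "4 ^ n * real n powr (\<delta> * real n + 1) / (3 * \<delta> * real n / exp 1) powr (3 * \<delta> * real n)
        = exp (C * real n + ln (real n) - 2 * \<delta> * real n * ln (real n))" if n: "n > 0" for n
    proof -
      have four: "(4::real) ^ n = exp (real n * ln 4)" by (simp add: exp_of_nat_mult)
      have "ln (3 * \<delta> * real n / exp 1) = ln (3 * \<delta>) + ln (real n) - 1"
        using n \<delta> by (simp add: ln_div ln_mult)
      then have "(3 * \<delta> * real n / exp 1) powr (3 * \<delta> * real n)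
          = exp (3 * \<delta> * real n * (ln (3 * \<delta>) + ln (real n) - 1))"
        unfolding powr_def using n \<delta> by simp
      moreover have "real n powr (\<delta> * real n + 1) = exp ((\<delta> * real n + 1) * ln (real n))"
        unfolding powr_def using n by simp
      ultimately show ?thesis
        by (simp only: four mult_exp_exp exp_diff[symmetric]) (simp add: C_def algebra_simps)
    qed
    have "(\<lambda>n. exp (C * real n + ln (real n) - D * real n * ln (real n))) \<longlonglongrightarrow> 0" if "D > 0" for D :: real
      using that by real_asymp
    from this[of "2 * \<delta>"] have "(\<lambda>n. exp (C * real n + ln (real n) - 2 * \<delta> * real n * ln (real n))) \<longlonglongrightarrow> 0"
      using \<delta> by simp
    then show "(\<lambda>n. 4 ^ n * real n powr (\<delta> * real n + 1) / (3 * \<delta> * real n / exp 1) powr (3 * \<delta> * real n)) \<longlonglongrightarrow> 0"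
      by (rule Lim_transform_eventually) (use eventually_gt_at_top[of 0] in \<open>eventually_elim, simp only: eq\<close>)
    have "filterlim (\<lambda>n. 3 * \<delta> * real n) at_top sequentially" using \<delta> by real_asymp
    then have "\<forall>\<^sub>F n in sequentially. exp 1 \<le> 3 * \<delta> * real n" by (simp add: filterlim_at_top)
    then show "\<forall>\<^sub>F n in sequentially. real (card {b. b permutes {1..n} \<and> \<not> rigid n \<epsilon> \<delta> {cyc n, b}}) / fact n
        \<le> 4 ^ n * real n powr (\<delta> * real n + 1) / (3 * \<delta> * real n / exp 1) powr (3 * \<delta> * real n)"
      using eventually_gt_at_top[of 0] by eventually_elim (rule bound)
  qed simp
  with \<delta> show ?thesis by blast
qed

section \<open>Fixed points of words in a random pair\<close>

definition letter_act :: "('a \<Rightarrow> 'a) \<Rightarrow> ('a \<Rightarrow> 'a) \<Rightarrow> bool \<times> bool \<Rightarrow> 'a \<Rightarrow> 'a" where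
  "letter_act a b l = (let g = if fst l then b else a in if snd l then g else inv' g)"

definition word_act :: "('a \<Rightarrow> 'a) \<Rightarrow> ('a \<Rightarrow> 'a) \<Rightarrow> (bool \<times> bool) list \<Rightarrow> 'a \<Rightarrow> 'a" where
  "word_act a b w = foldr (\<lambda>l f. letter_act a b l \<circ> f) w id"

lemma word_act_simps [simp]:
  "word_act a b [] = id"
  "word_act a b (l # w) = letter_act a b l \<circ> word_act a b w"
  by (simp_all add: word_act_def)

lemma word_act_append: "word_act a b (v @ w) = word_act a b v \<circ> word_act a b w"
  by (induction v) (auto simp: comp_assoc)

lemma letter_act_permutes:
  "a permutes U \<Longrightarrow> b permutes U \<Longrightarrow> letter_act a b l permutes U"
  by (auto simp: letter_act_def permutes_inv)

lemma word_act_permutes: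
  "a permutes U \<Longrightarrow> b permutes U \<Longrightarrow> word_act a b w permutes U"
  by (induction w) (auto intro: permutes_compose letter_act_permutes permutes_id)

text \<open>Words act from their last letter on, so the points visited by the walk of \<open>w\<close> from
  \<open>i\<close> are the images of \<open>i\<close> under the suffixes of \<open>w\<close>.\<close>

fun visited :: "('a \<Rightarrow> 'a) \<Rightarrow> ('a \<Rightarrow> 'a) \<Rightarrow> 'a \<Rightarrow> (bool \<times> bool) list \<Rightarrow> 'a set" where
  "visited a b i [] = {i}"
| "visited a b i (l # w) = insert (word_act a b (l # w) i) (visited a b i w)"

definition near :: "('a \<Rightarrow> 'a) \<Rightarrow> nat \<Rightarrow> 'a \<Rightarrow> 'a \<Rightarrow> bool" where
  "near a L x y \<longleftrightarrow> (\<exists>j\<le>L. y = (a ^^ j) x \<or> x = (a ^^ j) y)"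

text \<open>Every step along \<open>b\<close> leads to a point that is more than \<open>L\<close> steps
  along \<open>a\<close> away from all points visited before. Steps along \<open>a\<close> are
  not restricted, since in a word of length at most \<open>L\<close> a run of such steps stays
  within this distance.\<close>

fun fresh_walk :: "('a \<Rightarrow> 'a) \<Rightarrow> nat \<Rightarrow> ('a \<Rightarrow> 'a) \<Rightarrow> 'a \<Rightarrow> (bool \<times> bool) list \<Rightarrow> bool" where
  "fresh_walk a L b i [] \<longleftrightarrow> True"
| "fresh_walk a L b i (l # w) \<longleftrightarrow> fresh_walk a L b i w \<and>
     (fst l \<longrightarrow> (\<forall>v\<in>visited a b i w. \<not> near a L v (word_act a b (l # w) i)))"

lemma visited_suffix: "suffix v w \<Longrightarrow> word_act a b v i \<in> visited a b i w"
  by (induction w) (auto simp: suffix_Cons)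

lemma fresh_walk_suffix: "suffix v w \<Longrightarrow> fresh_walk a L b i w \<Longrightarrow> fresh_walk a L b i v"
  by (induction w) (auto simp: suffix_Cons)

lemma card_visited: "finite (visited a b i w) \<and> card (visited a b i w) \<le> length w + 1"
  by (induction w) (auto simp: card_insert_if)

text \<open>Equal generators next to each other have equal signs in a reduced word, so a reduced word starts
  with a power of the first generator.\<close>

lemma reduced_leading_run:
  assumes "reduced w"
  obtains j e z where "w = replicate j (False, e) @ z" "z = [] \<or> fst (hd z)"
proof -
  have "\<exists>j e z. w = replicate j (False, e) @ z \<and> (z = [] \<or> fst (hd z))"
    using assms
  proof (induction w)
    case Nil
    show ?case by (rule exI[of _ 0]) simp
  next
    case (Cons l w)
    then obtain j e z where w: "w = replicate j (False, e) @ z" "z = [] \<or> fst (hd z)"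
      by (auto simp: reduced_Cons)
    consider "fst l" | "\<not> fst l" "j = 0" | "\<not> fst l" "j > 0" by auto
    then show ?case
    proof cases
      case 1
      then show ?thesis by (intro exI[of _ 0] exI[of _ e] exI[of _ "l # w"]) simp
    next
      case 2
      then have "l # w = replicate 1 (False, snd l) @ z" using w by (cases l) simp
      then show ?thesis using w by blast
    next
      case 3
      then have "hd w = (False, e)" using w by (cases j) auto
      then have "l = (False, e)" using Cons.prems 3 w by (cases l) (auto simp: reduced_Cons cancels_def)
      then have "l # w = replicate (Suc j) (False, e) @ z" using w by simp
      then show ?thesis using w by blast
    qed
  qed
  then show ?thesis using that by blast
qed

lemma word_act_replicate:
  assumes "bij a"
  shows "word_act a b (replicate j (False, e)) x = y \<longleftrightarrow>
    (if e then (a ^^ j) x = y else (a ^^ j) y = x)"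
proof (cases e)
  case True
  have "word_act a b (replicate j (False, True)) = a ^^ j"
    by (induction j) (auto simp: letter_act_def)
  then show ?thesis using True by simp
next
  case False
  have "word_act a b (replicate j (False, False)) = inv' a ^^ j"
    by (induction j) (auto simp: letter_act_def)
  then show ?thesis using False inv_fn[OF assms, of j] bij_inv_eq_iff[OF bij_fn[OF assms, of j], of y x] by auto
qed

lemma near_replicate:
  assumes "bij a" "j \<le> L"
  shows "near a L x (word_act a b (replicate j (False, e)) x)"
  using word_act_replicate[OF assms(1), of b j e x] assms(2) unfolding near_def by metis

lemma near_sym: "near a L x y \<longleftrightarrow> near a L y x"
  by (auto simp: near_def)

text \<open>The endpoint of a fresh walk is near the endpoint of its last step along \<open>b\<close>, and
  hence different from all points visited before that step. So a further step along
  \<open>b\<close> or its inverse uses an edge \<open>x \<mapsto> b x\<close> that the walk has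
  not used yet, unless it retraces the last step along \<open>b\<close> at once, and then the
  word is not reduced.\<close>

lemma fresh_walk_new_edge:
  assumes a: "a permutes U" and b: "b permutes U" and i: "i \<in> U"
    and ap: "\<And>j x. 0 < j \<Longrightarrow> j \<le> L \<Longrightarrow> x \<in> U \<Longrightarrow> (a ^^ j) x \<noteq> x"
    and fresh: "fresh_walk a L b i w" and red: "reduced ((True, s) # w)" and len: "length w \<le> L"
    and suf: "suffix ((True, s') # u) w"
  shows "word_act a b w i \<noteq> word_act a b (if s = s' then u else (True, s') # u) i"
proof -
  have redw: "reduced w" using red by (simp add: reduced_Cons)
  obtain j e z where w: "w = replicate j (False, e) @ z" and z: "z = [] \<or> fst (hd z)"
    by (rule reduced_leading_run[OF redw])
  let ?pos = "\<lambda>w. word_act a b w i"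
  have jL: "j \<le> L" using w len by simp
  have pw: "?pos w = word_act a b (replicate j (False, e)) (?pos z)"
    unfolding w word_act_append by simp
  have nr: "near a L (?pos z) (?pos w)"
    unfolding pw by (rule near_replicate[OF permutes_bij[OF a] jL])
  have suf_z: "suffix ((True, s') # u) z"
  proof -
    from suf consider "suffix ((True, s') # u) z"
      | y where "(True, s') # u = y @ z" "suffix y (replicate j (False, e))"
      unfolding w suffix_append by blast
    then show ?thesis
    proof cases
      case 2
      then have "y = []" using set_mono_suffix[of y "replicate j (False, e)"] by (cases y) auto
      then show ?thesis using 2 by simp
    qed
  qed
  then obtain s'' v where zv: "z = (True, s'') # v" using z by (cases z) auto
  have "fresh_walk a L b i z" by (rule fresh_walk_suffix[OF _ fresh]) (simp add: w suffix_def)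
  then have far: "\<not> near a L x (?pos z)" if "x \<in> visited a b i v" for x
    using that unfolding zv by simp
  have ne: "?pos w \<noteq> x" if "x \<in> visited a b i v" for x
    using far[OF that] nr near_sym by metis
  from suf_z consider "s' = s''" "u = v" | "suffix ((True, s') # u) v"
    unfolding zv suffix_Cons by auto
  then show ?thesis
  proof cases
    case 2
    then have "suffix u v" by (metis suffix_ConsD)
    then show ?thesis using 2 ne visited_suffix by (metis (full_types))
  next
    case 1
    show ?thesis
    proof (cases "s = s'")
      case True
      then show ?thesis using ne[OF visited_suffix[of v v]] 1 by simp
    next
      case False
      have "j \<noteq> 0"
      proof
        assume "j = 0"
        then have "w = (True, s') # u" using w zv 1 by simp
        then show False using red False by (simp add: reduced_Cons cancels_def)
      qed
      have "?pos z \<in> U" using word_act_permutes[OF a b] i by (simp only: permutes_in_image)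
      then have "(a ^^ j) (?pos z) \<noteq> ?pos z" using \<open>j \<noteq> 0\<close> jL ap by blast
      then have "?pos w \<noteq> ?pos z" unfolding pw word_act_replicate[OF permutes_bij[OF a]]
        by (auto split: if_splits)
      then show ?thesis using False 1 zv by simp
    qed
  qed
qed

text \<open>After a step along \<open>b\<close> the walk stays away from its starting point, and without
  such a step it is a short nontrivial power of \<open>a\<close>.\<close>

lemma fresh_walk_not_closed:
  assumes a: "a permutes U" and i: "i \<in> U"
    and ap: "\<And>j x. 0 < j \<Longrightarrow> j \<le> L \<Longrightarrow> x \<in> U \<Longrightarrow> (a ^^ j) x \<noteq> x"
    and fresh: "fresh_walk a L b i w" and red: "reduced w" and len: "length w \<le> L" and "w \<noteq> []"
  shows "word_act a b w i \<noteq> i"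
proof -
  obtain j e z where w: "w = replicate j (False, e) @ z" and z: "z = [] \<or> fst (hd z)"
    by (rule reduced_leading_run[OF red])
  let ?pos = "\<lambda>w. word_act a b w i"
  have jL: "j \<le> L" using w len by simp
  have pw: "?pos w = word_act a b (replicate j (False, e)) (?pos z)"
    unfolding w word_act_append by simp
  show ?thesis
  proof (cases z)
    case Nil
    then have "0 < j" using w \<open>w \<noteq> []\<close> by simp
    then have "(a ^^ j) i \<noteq> i" using jL ap i by blast
    then show ?thesis unfolding pw word_act_replicate[OF permutes_bij[OF a]] Nil by simp
  next
    case (Cons l v)
    have "near a L (?pos z) (?pos w)"
      unfolding pw by (rule near_replicate[OF permutes_bij[OF a] jL])
    moreover have "fresh_walk a L b i z" by (rule fresh_walk_suffix[OF _ fresh]) (simp add: w suffix_def)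
    then have "\<not> near a L i (?pos z)" using visited_suffix[of "[]" v a b i] z Cons by simp
    ultimately show ?thesis using near_sym by metis
  qed
qed

text \<open>The edge that the next step along \<open>b\<close> would use is new, so redirecting it to an
  unvisited point \<open>z\<close> does not affect the walk up to now. The transposition also
  changes the edge of \<open>b\<close> into \<open>z\<close>, which the walk has not used
  because it never visited \<open>z\<close>.\<close>

lemma word_act_redirect:
  assumes a: "a permutes U" and b: "b permutes U" and i: "i \<in> U"
    and ap: "\<And>j x. 0 < j \<Longrightarrow> j \<le> L \<Longrightarrow> x \<in> U \<Longrightarrow> (a ^^ j) x \<noteq> x"
    and fresh: "fresh_walk a L b i w" and red: "reduced ((True, True) # w)" and len: "length w \<le> L"
    and z: "z \<in> U" "z \<notin> visited a b i w"
    and b': "b' = Transposition.transpose (b (word_act a b w i)) z \<circ> b"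
    and suf: "suffix v w"
  shows "word_act a b' v i = word_act a b v i"
  using suf
proof (induction v)
  case (Cons l v)
  let ?y = "b (word_act a b w i)"
  have sv: "suffix v w" using Cons.prems by (metis suffix_ConsD)
  then have IH: "word_act a b' v i = word_act a b v i" using Cons.IH by simp
  have bijb: "bij b" by (rule permutes_bij[OF b])
  note edge = fresh_walk_new_edge[OF a b i ap fresh red len]
  have vis: "word_act a b v i \<noteq> z" "word_act a b (l # v) i \<noteq> z"
    using z visited_suffix[OF sv] visited_suffix[OF Cons.prems] by metis+
  consider "\<not> fst l" | "l = (True, True)" | "l = (True, False)" by (cases l) auto
  then show ?case
  proof cases
    case 1
    then show ?thesis using IH by (simp add: letter_act_def)
  next
    case 2
    have "word_act a b w i \<noteq> word_act a b v i"
      using edge[of True v] Cons.prems unfolding 2 by simp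
    then have "b (word_act a b v i) \<noteq> ?y" using bijb by (metis bij_pointE)
    moreover have "b (word_act a b v i) \<noteq> z" using vis(2) 2 by (simp add: letter_act_def)
    ultimately have "b' (word_act a b v i) = b (word_act a b v i)"
      unfolding b' by (simp add: Transposition.transpose_def)
    then show ?thesis using IH by (simp add: letter_act_def 2)
  next
    case 3
    have "word_act a b w i \<noteq> word_act a b (l # v) i"
      using edge[of False v] Cons.prems unfolding 3 by simp
    then have "word_act a b v i \<noteq> ?y"
      using 3 bijb by (auto simp: letter_act_def bij_inv_eq_iff)
    then have "Transposition.transpose ?y z (word_act a b v i) = word_act a b v i"
      using vis(1) by (simp add: Transposition.transpose_def)
    moreover have "inv' b' = inv' b \<circ> Transposition.transpose ?y z"
      unfolding b' using bijb by (simp add: o_inv_distrib)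
    ultimately show ?thesis using IH 3 by (simp add: letter_act_def)
  qed
qed simp

lemma visited_cong:
  assumes "\<And>v. suffix v w \<Longrightarrow> word_act a b' v i = word_act a b v i"
  shows "visited a b' i w = visited a b i w"
  using assms
proof (induction w)
  case (Cons l w)
  have "visited a b' i w = visited a b i w" by (rule Cons.IH) (simp add: Cons.prems suffix_Cons)
  then show ?case using Cons.prems[of "l # w"] by simp
qed simp

definition near_visited :: "'a set \<Rightarrow> ('a \<Rightarrow> 'a) \<Rightarrow> nat \<Rightarrow> ('a \<Rightarrow> 'a) \<Rightarrow> 'a \<Rightarrow> (bool \<times> bool) list \<Rightarrow> 'a set" where
  "near_visited U a L b i w = {y \<in> U. \<exists>v\<in>visited a b i w. near a L v y}"

lemma card_near_visited:
  assumes "bij a"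
  shows "finite (near_visited U a L b i w) \<and> card (near_visited U a L b i w) \<le> (length w + 1) * (2 * (L + 1))"
proof -
  define N where "N v = (\<lambda>j. (a ^^ j) v) ` {..L} \<union> (\<lambda>j. inv' (a ^^ j) v) ` {..L}" for v
  have inv: "y = inv' (a ^^ j) v" if "v = (a ^^ j) y" for v y j
    using that bij_fn[OF assms, of j] by (metis bij_inv_eq_iff)
  have sub: "near_visited U a L b i w \<subseteq> (\<Union>v\<in>visited a b i w. N v)"
    unfolding near_visited_def near_def N_def using inv by blast
  have fin: "finite (\<Union>v\<in>visited a b i w. N v)" using card_visited[of a b i w] by (auto simp: N_def)
  have "card (N v) \<le> 2 * (L + 1)" for v
  proof -
    have "card (N v) \<le> card ((\<lambda>j. (a ^^ j) v) ` {..L}) + card ((\<lambda>j. inv' (a ^^ j) v) ` {..L})"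
      unfolding N_def by (rule card_Un_le)
    also have "\<dots> \<le> card {..L} + card {..L}" by (intro add_mono card_image_le) auto
    finally show ?thesis by simp
  qed
  then have "card (\<Union>v\<in>visited a b i w. N v) \<le> (\<Sum>v\<in>visited a b i w. 2 * (L + 1))"
    by (intro order_trans[OF card_UN_le sum_mono]) (simp_all add: card_visited)
  also have "\<dots> \<le> (length w + 1) * (2 * (L + 1))"
    using card_visited[of a b i w] by (simp only: sum_constant of_nat_id mult_le_mono1)
  finally show ?thesis using sub fin card_mono finite_subset by (metis le_trans)
qed

text \<open>A switching argument. For \<open>b\<close> in the set on the left let \<open>y\<close> be the
  point to which the next step leads, and redirect this step to an unvisited point
  \<open>z\<close>. The walk stays the same, so it can be read off from the new permutation, as
  can \<open>z\<close>; together with \<open>y\<close> this gives back \<open>b\<close>. There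
  are at least \<open>card U - L\<close> choices for \<open>z\<close>, but \<open>y\<close> is
  one of the few points near the walk.\<close>

lemma card_first_revisit_forward:
  assumes fin: "finite U" and a: "a permutes U" and i: "i \<in> U"
    and ap: "\<And>j x. 0 < j \<Longrightarrow> j \<le> L \<Longrightarrow> x \<in> U \<Longrightarrow> (a ^^ j) x \<noteq> x"
    and red: "reduced ((True, True) # w)" and len: "length w < L"
  shows "card {b. b permutes U \<and> fresh_walk a L b i w \<and> \<not> fresh_walk a L b i ((True, True) # w)} * (card U - L)
    \<le> 2 * (L + 1)\<^sup>2 * fact (card U)" (is "card ?X * _ \<le> _")
proof -
  define \<Phi> where "\<Phi> = (\<lambda>(b, z). (Transposition.transpose (b (word_act a b w i)) z \<circ> b, b (word_act a b w i)))"
  define A where "A = (SIGMA b:?X. U - visited a b i w)"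
  define B where "B = (SIGMA b:{b. b permutes U}. near_visited U a L b i w)"
  have finX: "finite ?X" using fin by (rule finite_permutes)
  have finB: "finite B" unfolding B_def
    using finite_permutations[OF fin] card_near_visited[OF permutes_bij[OF a]] by (intro finite_SigmaI) auto
  have redirect: "word_act a (fst (\<Phi> (b, z))) v i = word_act a b v i"
    if "b \<in> ?X" "z \<in> U - visited a b i w" "suffix v w" for b z v
    unfolding \<Phi>_def using that len red by (intro word_act_redirect[OF a _ i ap _ red]) auto
  have "\<Phi> ` A \<subseteq> B"
  proof
    fix x assume "x \<in> \<Phi> ` A"
    then obtain b z where b: "b \<in> ?X" and z: "z \<in> U - visited a b i w" and x: "x = \<Phi> (b, z)"
      by (auto simp: A_def)
    have bU: "b permutes U" using b by blast
    have wU: "word_act a b w i \<in> U" using word_act_permutes[OF a bU] i by (simp only: permutes_in_image)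
    then have y: "b (word_act a b w i) \<in> U" using bU by (simp only: permutes_in_image)
    have vis: "visited a (fst x) i w = visited a b i w"
      unfolding x by (rule visited_cong) (rule redirect[OF b z])
    have "fst x permutes U" unfolding x \<Phi>_def using y z bU by (auto intro!: permutes_compose permutes_swap_id)
    moreover have "snd x \<in> near_visited U a L (fst x) i w"
      unfolding near_visited_def vis using y b by (auto simp: x \<Phi>_def letter_act_def)
    ultimately show "x \<in> B" unfolding B_def by (cases x) auto
  qed
  moreover have "inj_on \<Phi> A"
  proof (rule inj_onI)
    fix x x' assume "x \<in> A" "x' \<in> A" and eq: "\<Phi> x = \<Phi> x'"
    from \<open>x \<in> A\<close> obtain b z where b: "b \<in> ?X" and z: "z \<in> U - visited a b i w" and x: "x = (b, z)"
      unfolding A_def by (rule SigmaE)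
    from \<open>x' \<in> A\<close> obtain c z' where c: "c \<in> ?X" and z': "z' \<in> U - visited a c i w" and x': "x' = (c, z')"
      unfolding A_def by (rule SigmaE)
    let ?d = "fst (\<Phi> (b, z))" and ?y = "b (word_act a b w i)"
    have eq': "\<Phi> (b, z) = \<Phi> (c, z')" using eq unfolding x x' .
    have "snd (\<Phi> (b, z)) = snd (\<Phi> (c, z'))" by (simp only: eq')
    then have d2: "?y = c (word_act a c w i)" by (simp add: \<Phi>_def)
    have "?d = fst (\<Phi> (c, z'))" by (simp only: eq')
    note d = this d2
    have w: "word_act a b w i = word_act a c w i"
      using redirect[OF b z, of w] redirect[OF c z', of w] d by simp
    have "?d (word_act a b w i) = z" "fst (\<Phi> (c, z')) (word_act a c w i) = z'" by (simp_all add: \<Phi>_def)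
    then have zz: "z = z'" using d w by simp
    have "Transposition.transpose ?y z \<circ> ?d = b" by (simp add: \<Phi>_def fun_eq_iff)
    moreover have "Transposition.transpose (c (word_act a c w i)) z' \<circ> fst (\<Phi> (c, z')) = c"
      by (simp add: \<Phi>_def fun_eq_iff)
    then have "Transposition.transpose ?y z \<circ> ?d = c"
      unfolding d(1)[symmetric] d(2)[symmetric] zz .
    ultimately show "x = x'" using x x' zz by simp
  qed
  ultimately have "card A \<le> card B" by (intro card_inj_on_le finB)
  also have "card B = (\<Sum>b\<in>{b. b permutes U}. card (near_visited U a L b i w))"
    unfolding B_def using card_near_visited[OF permutes_bij[OF a]] by (intro card_SigmaI finite_permutations fin) auto
  also have "\<dots> \<le> (\<Sum>b\<in>{b. b permutes U}. 2 * (L + 1)\<^sup>2)"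
  proof (rule sum_mono)
    fix b
    have "card (near_visited U a L b i w) \<le> (length w + 1) * (2 * (L + 1))"
      using card_near_visited[OF permutes_bij[OF a]] by blast
    also have "\<dots> \<le> (L + 1) * (2 * (L + 1))" using len by (intro mult_le_mono1) simp
    finally show "card (near_visited U a L b i w) \<le> 2 * (L + 1)\<^sup>2" by (simp add: power2_eq_square algebra_simps)
  qed
  also have "\<dots> = 2 * (L + 1)\<^sup>2 * fact (card U)" by (simp add: card_permutations[OF refl fin])
  finally have "card A \<le> 2 * (L + 1)\<^sup>2 * fact (card U)" .
  moreover have "card ?X * (card U - L) \<le> card A"
  proof -
    have "card ?X * (card U - L) = (\<Sum>b\<in>?X. card U - L)" by simp
    also have "\<dots> \<le> (\<Sum>b\<in>?X. card (U - visited a b i w))"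
    proof (rule sum_mono)
      fix b
      have "card U - card (visited a b i w) \<le> card (U - visited a b i w)"
        by (rule diff_card_le_card_Diff) (simp add: card_visited)
      then show "card U - L \<le> card (U - visited a b i w)" using card_visited[of a b i w] len by linarith
    qed
    also have "\<dots> = card A" unfolding A_def using finX fin by (simp add: card_SigmaI)
    finally show ?thesis .
  qed
  ultimately show ?thesis by simp
qed

text \<open>Exchanges the letters for \<open>b\<close> and its inverse, so that a statement on steps along
  \<open>b\<close> also covers the steps along its inverse.\<close>

definition flip :: "bool \<times> bool \<Rightarrow> bool \<times> bool" where
  "flip l = (fst l, fst l \<noteq> snd l)"

lemma letter_act_flip: "bij b \<Longrightarrow> letter_act a b (flip l) = letter_act a (inv' b) l"
  by (auto simp: letter_act_def flip_def inv_inv_eq)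

lemma word_act_flip: "bij b \<Longrightarrow> word_act a b (map flip w) = word_act a (inv' b) w"
  by (induction w) (auto simp: letter_act_flip)

lemma visited_flip: "bij b \<Longrightarrow> visited a b i (map flip w) = visited a (inv' b) i w"
  by (induction w) (simp_all add: word_act_flip letter_act_flip)

lemma fresh_walk_flip: "bij b \<Longrightarrow> fresh_walk a L b i (map flip w) = fresh_walk a L (inv' b) i w"
proof (induction w)
  case (Cons l w)
  then show ?case using word_act_flip[OF Cons.prems, of a "l # w"]
    by (simp add: visited_flip) (simp add: flip_def)
qed simp

lemma reduced_flip: "reduced w \<Longrightarrow> reduced (map flip w)"
  unfolding reduced_def successively_map
  by (erule successively_mono) (auto simp: cancels_def flip_def)

lemma card_first_revisit:
  assumes fin: "finite U" and a: "a permutes U" and i: "i \<in> U"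
    and ap: "\<And>j x. 0 < j \<Longrightarrow> j \<le> L \<Longrightarrow> x \<in> U \<Longrightarrow> (a ^^ j) x \<noteq> x"
    and red: "reduced (l # w)" and len: "length w < L"
  shows "card {b. b permutes U \<and> fresh_walk a L b i w \<and> \<not> fresh_walk a L b i (l # w)} * (card U - L)
    \<le> 2 * (L + 1)\<^sup>2 * fact (card U)"
proof -
  consider "\<not> fst l" | "l = (True, True)" | "l = (True, False)" by (cases l) auto
  then show ?thesis
  proof cases
    case 1
    then have "{b. b permutes U \<and> fresh_walk a L b i w \<and> \<not> fresh_walk a L b i (l # w)} = {}" by auto
    then show ?thesis by (simp only: card.empty)
  next
    case 2
    then show ?thesis using card_first_revisit_forward[OF fin a i ap _ len] red by simp
  next
    case 3
    let ?P = "\<lambda>w b. b permutes U \<and> fresh_walk a L b i w \<and> \<not> fresh_walk a L b i ((True, True) # w)"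
    have red': "reduced ((True, True) # map flip w)" using reduced_flip[OF red] 3 by (simp add: flip_def)
    have sub: "inv' ` {b. b permutes U \<and> fresh_walk a L b i w \<and> \<not> fresh_walk a L b i (l # w)}
        \<subseteq> {b. ?P (map flip w) b}"
    proof (rule image_subsetI)
      fix b assume b: "b \<in> {b. b permutes U \<and> fresh_walk a L b i w \<and> \<not> fresh_walk a L b i (l # w)}"
      then have bU: "b permutes U" by blast
      have bij: "bij (inv' b)" using permutes_bij[OF permutes_inv[OF bU]] .
      have bb: "inv' (inv' b) = b" using permutes_bij[OF bU] by (rule inv_inv_eq)
      have "fresh_walk a L (inv' b) i (map flip (l # w)) = fresh_walk a L b i (l # w)"
        and f: "fresh_walk a L (inv' b) i (map flip w) = fresh_walk a L b i w"
        using fresh_walk_flip[OF bij, of a L i] unfolding bb by blast+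
      moreover have "map flip (l # w) = (True, True) # map flip w" using 3 by (simp add: flip_def)
      ultimately have "fresh_walk a L (inv' b) i ((True, True) # map flip w) = fresh_walk a L b i (l # w)"
        by (simp only:)
      with f show "inv' b \<in> {b. ?P (map flip w) b}" using b permutes_inv[OF bU] by blast
    qed
    have "inj_on inv' {b. b permutes U \<and> fresh_walk a L b i w \<and> \<not> fresh_walk a L b i (l # w)}"
      by (rule inj_onI) (metis (mono_tags, lifting) inv_inv_eq mem_Collect_eq permutes_bij)
    then have "card {b. b permutes U \<and> fresh_walk a L b i w \<and> \<not> fresh_walk a L b i (l # w)}
        \<le> card {b. ?P (map flip w) b}"
      using sub by (rule card_inj_on_le) (rule finite_permutes[OF fin])
    then have "card {b. b permutes U \<and> fresh_walk a L b i w \<and> \<not> fresh_walk a L b i (l # w)} * (card U - L)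
        \<le> card {b. ?P (map flip w) b} * (card U - L)" by (rule mult_le_mono1)
    also have "\<dots> \<le> 2 * (L + 1)\<^sup>2 * fact (card U)"
      using len by (intro card_first_revisit_forward[OF fin a i ap red']) auto
    finally show ?thesis .
  qed
qed

lemma card_not_fresh_walk:
  assumes fin: "finite U" and a: "a permutes U" and i: "i \<in> U"
    and ap: "\<And>j x. 0 < j \<Longrightarrow> j \<le> L \<Longrightarrow> x \<in> U \<Longrightarrow> (a ^^ j) x \<noteq> x"
    and "reduced w" "length w \<le> L"
  shows "card {b. b permutes U \<and> \<not> fresh_walk a L b i w} * (card U - L)
    \<le> length w * (2 * (L + 1)\<^sup>2 * fact (card U))"
  using assms(5,6)
proof (induction w)
  case (Cons l w)
  have red: "reduced w" using Cons.prems by (simp add: reduced_Cons)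
  let ?Y = "{b. b permutes U \<and> fresh_walk a L b i w \<and> \<not> fresh_walk a L b i (l # w)}"
  let ?X = "{b. b permutes U \<and> \<not> fresh_walk a L b i w}"
  have "{b. b permutes U \<and> \<not> fresh_walk a L b i (l # w)} \<subseteq> ?X \<union> ?Y" by auto
  then have "card {b. b permutes U \<and> \<not> fresh_walk a L b i (l # w)} \<le> card (?X \<union> ?Y)"
    by (rule card_mono[rotated]) (simp add: finite_permutes[OF fin])
  also have "\<dots> \<le> card ?X + card ?Y" by (rule card_Un_le)
  finally have "card {b. b permutes U \<and> \<not> fresh_walk a L b i (l # w)} * (card U - L)
      \<le> (card ?X + card ?Y) * (card U - L)" by (rule mult_le_mono1)
  also have "\<dots> = card ?X * (card U - L) + card ?Y * (card U - L)" by (rule add_mult_distrib)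
  also have "\<dots> \<le> length w * (2 * (L + 1)\<^sup>2 * fact (card U)) + 2 * (L + 1)\<^sup>2 * fact (card U)"
    using Cons.prems by (intro add_mono Cons.IH red card_first_revisit[OF fin a i ap]) auto
  finally show ?case by simp
qed simp

lemma cyc_funpow: "i \<in> {1..n} \<Longrightarrow> (cyc n ^^ j) i = (i - 1 + j) mod n + 1"
proof (induction j)
  case (Suc j)
  let ?m = "(i - 1 + j) mod n"
  have "?m < n" using Suc.prems by (intro mod_less_divisor) auto
  then have "cyc n (?m + 1) = Suc ?m mod n + 1"
    by (auto simp: cyc_def mod_Suc)
  then show ?case using Suc by (simp add: mod_Suc_eq)
qed auto

lemma cyc_funpow_neq:
  assumes "i \<in> {1..n}" "0 < j" "j < n"
  shows "(cyc n ^^ j) i \<noteq> i"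
proof
  assume "(cyc n ^^ j) i = i"
  then have "(i - 1 + j) mod n = i - 1" using cyc_funpow[OF assms(1), of j] by linarith
  moreover have "(i - 1) mod n = i - 1" using assms(1) by (intro mod_less) auto
  ultimately have "(i - 1 + j) mod n = (i - 1) mod n" by simp
  then have "n dvd j" using mod_eq_dvd_iff_nat[of "i - 1" "i - 1 + j" n] by simp
  then show False using assms by (auto dest: dvd_imp_le)
qed

text \<open>The expected number of fixed points of \<open>w\<close> is bounded independently of
  \<open>n\<close>, by the bound on the probability that a walk is not fresh. The claim follows
  by Markov's inequality.\<close>

lemma free_fraction:
  fixes \<epsilon> :: real
  assumes red: "reduced w" and "w \<noteq> []" and \<epsilon>: "\<epsilon> > 0"
  shows "(\<lambda>n. real (card {b. b permutes {1..n} \<and> \<not> 1 - \<epsilon> \<le> hamming_dist n (word_act (cyc n) b w) id}) / fact n) \<longlonglongrightarrow> 0"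
proof -
  define L where "L = length w"
  define K where "K = real L * (2 * (real L + 1)\<^sup>2)"
  have bound: "real (card {b. b permutes {1..n} \<and> \<not> 1 - \<epsilon> \<le> hamming_dist n (word_act (cyc n) b w) id}) / fact n
      \<le> K / (\<epsilon> * (real n - real L))" if n: "n > L" for n
  proof -
    define S where "S = {b. b permutes {1..n}}"
    define X where "X = {b. b permutes {1..n} \<and> \<not> 1 - \<epsilon> \<le> hamming_dist n (word_act (cyc n) b w) id}"
    have finS: "finite S" unfolding S_def by (intro finite_permutations) simp
    have XS: "X \<subseteq> S" by (auto simp: X_def S_def)
    let ?fix = "\<lambda>b. {i. i \<in> {1..n} \<and> word_act (cyc n) b w i = i}"
    have many: "\<epsilon> * real n \<le> real (card (?fix b))" if b: "b \<in> X" for b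
    proof -
      have "{i \<in> {1..n}. word_act (cyc n) b w i \<noteq> id i} = {1..n} - ?fix b" by auto
      then have "card {i \<in> {1..n}. word_act (cyc n) b w i \<noteq> id i} = n - card (?fix b)"
        using card_Diff_subset[of "?fix b" "{1..n}"] finite_subset[of "?fix b" "{1..n}"] by force
      moreover have "card (?fix b) \<le> card {1..n}" by (rule card_mono) auto
      moreover have "real (card {i \<in> {1..n}. word_act (cyc n) b w i \<noteq> id i}) < (1 - \<epsilon>) * real n"
        using b n by (auto simp: X_def hamming_dist_def not_le divide_less_eq simp del: id_apply)
      ultimately show ?thesis by (simp add: of_nat_diff algebra_simps)
    qed
    have few: "real (card {b. b \<in> S \<and> word_act (cyc n) b w i = i}) \<le> K * fact n / (real n - real L)"
      if i: "i \<in> {1..n}" for i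
    proof -
      have ap: "(cyc n ^^ j) x \<noteq> x" if "0 < j" "j \<le> L" "x \<in> {1..n}" for j x
        using cyc_funpow_neq that n by simp
      have "{b. b \<in> S \<and> word_act (cyc n) b w i = i}
          \<subseteq> {b. b permutes {1..n} \<and> \<not> fresh_walk (cyc n) L b i w}"
        using fresh_walk_not_closed[OF cyc_permutes i ap _ red _ \<open>w \<noteq> []\<close>] by (auto simp: S_def L_def)
      then have "card {b. b \<in> S \<and> word_act (cyc n) b w i = i} * (n - L)
          \<le> card {b. b permutes {1..n} \<and> \<not> fresh_walk (cyc n) L b i w} * (n - L)"
        by (intro mult_le_mono1 card_mono finite_permutes) auto
      also have "\<dots> \<le> L * (2 * (L + 1)\<^sup>2 * fact n)"
        using card_not_fresh_walk[OF _ cyc_permutes i ap red, of L] by (simp add: L_def)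
      finally have "real (card {b. b \<in> S \<and> word_act (cyc n) b w i = i} * (n - L))
          \<le> real (L * (2 * (L + 1)\<^sup>2 * fact n))" by (simp only: of_nat_le_iff)
      then show ?thesis using n by (simp add: K_def of_nat_diff field_simps)
    qed
    have "real (card X) * (\<epsilon> * real n) = (\<Sum>b\<in>X. \<epsilon> * real n)" by simp
    also have "\<dots> \<le> (\<Sum>b\<in>X. real (card (?fix b)))" by (rule sum_mono) (rule many)
    also have "\<dots> \<le> (\<Sum>b\<in>S. real (card (?fix b)))" using finS XS by (intro sum_mono2) auto
    also have "\<dots> = (\<Sum>i\<in>{1..n}. real (card {b. b \<in> S \<and> word_act (cyc n) b w i = i}))"
      using sum.swap_restrict[OF finS, of "{1..n}" "\<lambda>_ _. 1 :: real" "\<lambda>b i. word_act (cyc n) b w i = i"] by simp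
    also have "\<dots> \<le> (\<Sum>i\<in>{1..n}. K * fact n / (real n - real L))" by (rule sum_mono) (rule few)
    also have "\<dots> = real n * (K * fact n / (real n - real L))" by simp
    finally have "(real (card X) * \<epsilon>) * real n \<le> (K * fact n / (real n - real L)) * real n"
      by (simp only: mult_ac)
    then have "real (card X) * \<epsilon> \<le> K * fact n / (real n - real L)"
      by (rule mult_right_le_imp_le) (use n in simp)
    then show ?thesis unfolding X_def[symmetric] using n \<epsilon> by (simp add: field_simps)
  qed
  show ?thesis
  proof (rule tendsto_sandwich[OF _ _ tendsto_const])
    show "(\<lambda>n. K / (\<epsilon> * (real n - real L))) \<longlonglongrightarrow> 0" using \<epsilon> by real_asymp
    show "\<forall>\<^sub>F n in sequentially. real (card {b. b permutes {1..n} \<and>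
        \<not> 1 - \<epsilon> \<le> hamming_dist n (word_act (cyc n) b w) id}) / fact n \<le> K / (\<epsilon> * (real n - real L))"
      using eventually_gt_at_top[of L] by eventually_elim (rule bound)
  qed simp
qed

section \<open>Conjugacy as almost equivariant matching of copies\<close>

text \<open>The number that \<open>amplify\<close> gives to the point \<open>fst z\<close> of the copy with
  index \<open>snd z\<close>. In these coordinates an amplification of \<open>p\<close> is
  \<open>map_prod p id\<close>.\<close>

definition block :: "nat \<Rightarrow> nat \<times> nat \<Rightarrow> nat" where
  "block n z = n * snd z + fst z"

lemma bij_betw_block: "bij_betw (block n) ({1..n} \<times> {..<r}) {1..n * r}"
proof (rule bij_betw_imageI)
  show "inj_on (block n) ({1..n} \<times> {..<r})"
  proof (rule inj_onI, clarify)
    fix x j x' j' assume x: "x \<in> {1..n}" "x' \<in> {1..n}" and eq: "block n (x, j) = block n (x', j')"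
    have eq': "n * j + (x - 1) = n * j' + (x' - 1)" using x eq by (simp add: block_def)
    have div: "(n * j + d) div n = j" if "d < n" for j d using that by simp
    have lt: "x - 1 < n" "x' - 1 < n" using x by auto
    have "j = j'" using div[OF lt(1), of j] div[OF lt(2), of j'] unfolding eq' by simp
    then show "x = x' \<and> j = j'" using eq by (simp add: block_def)
  qed
  show "block n ` ({1..n} \<times> {..<r}) = {1..n * r}"
  proof
    show "block n ` ({1..n} \<times> {..<r}) \<subseteq> {1..n * r}"
      using amplify_block(1) by (auto simp: block_def simp del: atLeastAtMost_iff)
    show "{1..n * r} \<subseteq> block n ` ({1..n} \<times> {..<r})"
    proof
      fix i assume "i \<in> {1..n * r}"
      then obtain b j where "b < r" "j \<in> {1..n}" "i = n * b + j" by (rule block_cases)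
      then show "i \<in> block n ` ({1..n} \<times> {..<r})"
        by (intro image_eqI[of _ _ "(j, b)"]) (auto simp: block_def)
    qed
  qed
qed

lemma amplify_block_map_prod:
  "z \<in> {1..n} \<times> {..<r} \<Longrightarrow> amplify n r p (block n z) = block n (map_prod p id z)"
  using amplify_block(2)[of "snd z" r "fst z" n p] by (cases z) (auto simp: block_def)

lemma sofic_class_eq_iff:
  assumes p: "p \<in> carrier (perm_seqs n)" and q: "q \<in> carrier (perm_seqs n)"
  shows "sofic_class \<omega> n p = sofic_class \<omega> n q
    \<longleftrightarrow> ((\<lambda>k. hamming_dist (n k) (p k) (q k)) \<longlongrightarrow> 0) \<omega>"
  using sofic_class_eqI[OF p q] sofic_class_self[OF p] mem_sofic_class[OF q] by blast

lemma comp_carrier_perm_seqs: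
  "p \<in> carrier (perm_seqs n) \<Longrightarrow> q \<in> carrier (perm_seqs n) \<Longrightarrow> (\<lambda>k. p k \<circ> q k) \<in> carrier (perm_seqs n)"
  unfolding carrier_perm_seqs using permutes_compose by blast

lemma sofic_class_conj_iff:
  assumes u: "u \<in> carrier (perm_seqs n)" and p: "p \<in> carrier (perm_seqs n)" and q: "q \<in> carrier (perm_seqs n)"
  shows "sofic_class \<omega> n u \<otimes>\<^bsub>sofic_group \<omega> n\<^esub> sofic_class \<omega> n p
      \<otimes>\<^bsub>sofic_group \<omega> n\<^esub> inv\<^bsub>sofic_group \<omega> n\<^esub> sofic_class \<omega> n u = sofic_class \<omega> n q
    \<longleftrightarrow> ((\<lambda>k. hamming_dist (n k) (u k \<circ> p k) (q k \<circ> u k)) \<longlongrightarrow> 0) \<omega>"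
proof -
  interpret group "sofic_group \<omega> n" by (rule group_sofic_group)
  have c: "sofic_class \<omega> n x \<in> carrier (sofic_group \<omega> n)" if "x \<in> carrier (perm_seqs n)" for x
    using that unfolding carrier_sofic_group by blast
  have "sofic_class \<omega> n u \<otimes>\<^bsub>sofic_group \<omega> n\<^esub> sofic_class \<omega> n p
      \<otimes>\<^bsub>sofic_group \<omega> n\<^esub> inv\<^bsub>sofic_group \<omega> n\<^esub> sofic_class \<omega> n u = sofic_class \<omega> n q
    \<longleftrightarrow> sofic_class \<omega> n u \<otimes>\<^bsub>sofic_group \<omega> n\<^esub> sofic_class \<omega> n p
      = sofic_class \<omega> n q \<otimes>\<^bsub>sofic_group \<omega> n\<^esub> sofic_class \<omega> n u"
    using inv_solve_right'[OF c[OF q] m_closed[OF c[OF u] c[OF p]] c[OF u]] by metis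
  also have "\<dots> \<longleftrightarrow> sofic_class \<omega> n (\<lambda>k. u k \<circ> p k) = sofic_class \<omega> n (\<lambda>k. q k \<circ> u k)"
    by (simp only: mult_sofic_class u p q)
  also have "\<dots> \<longleftrightarrow> ((\<lambda>k. hamming_dist (n k) (u k \<circ> p k) (q k \<circ> u k)) \<longlongrightarrow> 0) \<omega>"
    by (rule sofic_class_eq_iff) (rule comp_carrier_perm_seqs; fact)+
  finally show ?thesis .
qed

definition mismatch :: "'a set \<Rightarrow> ('a \<Rightarrow> 'a) \<Rightarrow> ('b \<Rightarrow> 'b) \<Rightarrow> ('a \<Rightarrow> 'b) \<Rightarrow> 'a set" where
  "mismatch X p q h = {z \<in> X. h (p z) \<noteq> q (h z)}"

lemma mismatch_subset: "mismatch X p q h \<subseteq> X"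
  by (auto simp: mismatch_def)

lemma hamming_dist_mismatch:
  assumes P: "P permutes {1..N}" and Q: "Q permutes {1..n}" and D: "N * r = n * t"
    and h: "\<And>z. z \<in> {1..N} \<times> {..<r} \<Longrightarrow> h z \<in> {1..n} \<times> {..<t}"
    and u: "\<And>z. z \<in> {1..N} \<times> {..<r} \<Longrightarrow> u (block N z) = block n (h z)"
  shows "hamming_dist (N * r) (u \<circ> amplify N r P) (amplify n t Q \<circ> u)
    = real (card (mismatch ({1..N} \<times> {..<r}) (map_prod P id) (map_prod Q id) h)) / real (N * r)"
proof (cases "N * r = 0")
  case False
  let ?X = "{1..N} \<times> {..<r}" and ?Y = "{1..n} \<times> {..<t}"
  have injN: "inj_on (block N) ?X" and imgN: "block N ` ?X = {1..N * r}"
    using bij_betw_block[of N r] by (auto simp: bij_betw_def)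
  have injn: "inj_on (block n) ?Y" using bij_betw_block[of n t] by (auto simp: bij_betw_def)
  have pres: "map_prod p id z \<in> {1..m} \<times> {..<s}"
    if "p permutes {1..m}" "z \<in> {1..m} \<times> {..<s}" for p m s and z :: "nat \<times> nat"
  proof -
    have "p (fst z) \<in> {1..m}" using permutes_in_image[OF that(1)] that(2) by (simp only: mem_Times_iff)
    then show ?thesis using that(2) by (simp only: mem_Times_iff fst_map_prod snd_map_prod id_apply)
  qed
  have eq: "u (amplify N r P (block N z)) = amplify n t Q (u (block N z))
      \<longleftrightarrow> h (map_prod P id z) = map_prod Q id (h z)" if z: "z \<in> ?X" for z
  proof -
    note Pz = pres[OF P z]
    have l: "u (amplify N r P (block N z)) = block n (h (map_prod P id z))"
      using amplify_block_map_prod[OF z, of P] u[OF Pz] by simp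
    have r: "amplify n t Q (u (block N z)) = block n (map_prod Q id (h z))"
      using amplify_block_map_prod[OF h[OF z], of Q] u[OF z] by simp
    show ?thesis unfolding l r
      by (rule inj_on_eq_iff[OF injn h[OF Pz] pres[OF Q h[OF z]]])
  qed
  have "{i \<in> {1..N * r}. (u \<circ> amplify N r P) i \<noteq> (amplify n t Q \<circ> u) i}
      = block N ` mismatch ?X (map_prod P id) (map_prod Q id) h"
    unfolding imgN[symmetric] mismatch_def using eq by auto
  then show ?thesis
    unfolding hamming_dist_def by (simp only: card_image[OF inj_on_subset[OF injN mismatch_subset]])
qed (simp add: hamming_dist_def)

definition mismatch_rate ::
    "(nat \<Rightarrow> nat) \<Rightarrow> (nat \<Rightarrow> nat \<Rightarrow> nat) \<Rightarrow> (nat \<Rightarrow> nat \<Rightarrow> nat) \<Rightarrow> (nat \<Rightarrow> nat)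
      \<Rightarrow> (nat \<Rightarrow> nat \<times> nat \<Rightarrow> nat \<times> nat) \<Rightarrow> nat \<Rightarrow> real" where
  "mismatch_rate N P Q r h k = real (card (mismatch ({1..N k} \<times> {..<r k})
     (map_prod (P k) id) (map_prod (Q k) id) (h k))) / real (N k * r k)"

lemma sofic_conj_amplify_iff:
  assumes rt: "\<And>k. 0 < r k \<and> 0 < t k \<and> N k * r k = n k * t k"
    and h: "\<And>k. bij_betw (h k) ({1..N k} \<times> {..<r k}) ({1..n k} \<times> {..<t k})"
    and u: "u \<in> carrier (perm_seqs (\<lambda>k. N k * r k))"
    and rel: "\<And>k z. z \<in> {1..N k} \<times> {..<r k} \<Longrightarrow> u k (block (N k) z) = block (n k) (h k z)"
    and P: "P \<in> carrier (perm_seqs N)" and Q: "Q \<in> carrier (perm_seqs n)"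
    and S: "S = sofic_group \<omega> (\<lambda>k. N k * r k)"
  shows "sofic_class \<omega> (\<lambda>k. N k * r k) u \<otimes>\<^bsub>S\<^esub> amplify_class \<omega> N r (sofic_class \<omega> N P)
        \<otimes>\<^bsub>S\<^esub> inv\<^bsub>S\<^esub> sofic_class \<omega> (\<lambda>k. N k * r k) u = amplify_class \<omega> n t (sofic_class \<omega> n Q)
     \<longleftrightarrow> (mismatch_rate N P Q r h \<longlongrightarrow> 0) \<omega>"
proof -
  have r: "0 < r k" and t: "0 < t k" for k using rt by blast+
  have eq: "n k * t k = N k * r k" for k using rt by simp
  have car: "(\<lambda>k. amplify (N k) (r k) (P k)) \<in> carrier (perm_seqs (\<lambda>k. N k * r k))"
    by (rule amplify_carrier[OF P])
  have car': "(\<lambda>k. amplify (n k) (t k) (Q k)) \<in> carrier (perm_seqs (\<lambda>k. N k * r k))"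
    using amplify_carrier[OF Q, of t] unfolding eq .
  have "hamming_dist (N k * r k) (u k \<circ> amplify (N k) (r k) (P k)) (amplify (n k) (t k) (Q k) \<circ> u k)
      = mismatch_rate N P Q r h k" for k
    unfolding mismatch_rate_def
  proof (rule hamming_dist_mismatch)
    show "P k permutes {1..N k}" using P unfolding carrier_perm_seqs by blast
    show "Q k permutes {1..n k}" using Q unfolding carrier_perm_seqs by blast
    show "N k * r k = n k * t k" using rt by blast
    show "h k z \<in> {1..n k} \<times> {..<t k}" if "z \<in> {1..N k} \<times> {..<r k}" for z
      using h that by (rule bij_betw_apply)
  qed (rule rel)
  then show ?thesis
    unfolding S amplify_class_eq[OF P r] amplify_class_eq[OF Q t]
    unfolding eq sofic_class_conj_iff[OF u car car'] by simp
qed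

text \<open>In block coordinates, a sequence of conjugating permutations is a sequence of bijections between
  disjoint unions of copies. They conjugate the classes if and only if the proportion of the
  points at which they are not equivariant tends to 0.\<close>

lemma sof_equiv_iff:
  assumes P: "\<And>g. g \<in> carrier G \<Longrightarrow> P g \<in> carrier (perm_seqs N) \<and> \<phi> g = sofic_class \<omega> N (P g)"
    and Q: "\<And>g. g \<in> carrier G \<Longrightarrow> Q g \<in> carrier (perm_seqs n) \<and> \<theta> g = sofic_class \<omega> n (Q g)"
  shows "sof_equiv G \<omega> N \<phi> n \<theta> \<longleftrightarrow>
    (\<exists>r t h. (\<forall>k. 0 < r k \<and> 0 < t k \<and> N k * r k = n k * t k) \<and>
      (\<forall>k. bij_betw (h k) ({1..N k} \<times> {..<r k}) ({1..n k} \<times> {..<t k})) \<and>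
      (\<forall>g\<in>carrier G. (mismatch_rate N (P g) (Q g) r h \<longlongrightarrow> 0) \<omega>))"
    (is "_ \<longleftrightarrow> ?R")
proof
  assume "sof_equiv G \<omega> N \<phi> n \<theta>"
  then obtain r t U where
    rt: "\<And>k. 0 < r k \<and> 0 < t k \<and> N k * r k = n k * t k"
    and U: "U \<in> carrier (sofic_group \<omega> (\<lambda>k. N k * r k))"
    and conj: "\<And>g. g \<in> carrier G \<Longrightarrow>
      U \<otimes>\<^bsub>sofic_group \<omega> (\<lambda>k. N k * r k)\<^esub> amplify_class \<omega> N r (\<phi> g)
        \<otimes>\<^bsub>sofic_group \<omega> (\<lambda>k. N k * r k)\<^esub> inv\<^bsub>sofic_group \<omega> (\<lambda>k. N k * r k)\<^esub> U
      = amplify_class \<omega> n t (\<theta> g)"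
    unfolding sof_equiv_def by blast
  from U obtain u where u: "u \<in> carrier (perm_seqs (\<lambda>k. N k * r k))"
    and U: "U = sofic_class \<omega> (\<lambda>k. N k * r k) u" unfolding carrier_sofic_group by blast
  have uk: "u k permutes {1..N k * r k}" for k using u unfolding carrier_perm_seqs by blast
  define h where "h k = inv_into ({1..n k} \<times> {..<t k}) (block (n k)) \<circ> (u k \<circ> block (N k))" for k
  have D: "{1..N k * r k} = {1..n k * t k}" for k using rt[of k] by simp
  have bij: "bij_betw (h k) ({1..N k} \<times> {..<r k}) ({1..n k} \<times> {..<t k})" for k
  proof -
    have "bij_betw (u k \<circ> block (N k)) ({1..N k} \<times> {..<r k}) {1..n k * t k}"
      using bij_betw_trans[OF bij_betw_block permutes_imp_bij[OF uk[of k]]] unfolding D .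
    then show ?thesis unfolding h_def by (rule bij_betw_trans[OF _ bij_betw_inv_into[OF bij_betw_block]])
  qed
  have rel: "u k (block (N k) z) = block (n k) (h k z)" if z: "z \<in> {1..N k} \<times> {..<r k}" for k z
  proof -
    have "block (N k) z \<in> {1..N k * r k}" using bij_betw_block z by (rule bij_betw_apply)
    then have "u k (block (N k) z) \<in> {1..n k * t k}"
      using permutes_in_image[OF uk[of k]] unfolding D by blast
    then show ?thesis unfolding h_def o_apply
      by (rule bij_betw_inv_into_right[OF bij_betw_block, symmetric])
  qed
  have "(mismatch_rate N (P g) (Q g) r h \<longlongrightarrow> 0) \<omega>" if g: "g \<in> carrier G" for g
    using sofic_conj_amplify_iff[OF rt bij u rel conjunct1[OF P[OF g]] conjunct1[OF Q[OF g]] refl, of \<omega>]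
      conj[OF g] unfolding U conjunct2[OF P[OF g]] conjunct2[OF Q[OF g]] by blast
  then show ?R using rt bij by blast
next
  assume ?R
  then obtain r t h where rt: "\<And>k. 0 < r k \<and> 0 < t k \<and> N k * r k = n k * t k"
    and bij: "\<And>k. bij_betw (h k) ({1..N k} \<times> {..<r k}) ({1..n k} \<times> {..<t k})"
    and lim: "\<And>g. g \<in> carrier G \<Longrightarrow> (mismatch_rate N (P g) (Q g) r h \<longlongrightarrow> 0) \<omega>" by blast
  define v where "v k = (block (n k) \<circ> h k) \<circ> inv_into ({1..N k} \<times> {..<r k}) (block (N k))" for k
  define u where "u k x = (if x \<in> {1..N k * r k} then v k x else x)" for k x
  have D: "{1..n k * t k} = {1..N k * r k}" for k using rt[of k] by simp
  have "bij_betw (v k) {1..N k * r k} {1..N k * r k}" for k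
  proof -
    have "bij_betw (block (n k) \<circ> h k) ({1..N k} \<times> {..<r k}) {1..N k * r k}"
      using bij_betw_trans[OF bij[of k] bij_betw_block] unfolding D .
    then show ?thesis unfolding v_def by (rule bij_betw_trans[OF bij_betw_inv_into[OF bij_betw_block]])
  qed
  then have "bij_betw (u k) {1..N k * r k} {1..N k * r k}" for k
    using bij_betw_cong[of "{1..N k * r k}" "u k" "v k"] by (simp add: u_def)
  then have uk: "u k permutes {1..N k * r k}" for k
    by (rule bij_imp_permutes) (simp only: u_def if_False)
  then have u: "u \<in> carrier (perm_seqs (\<lambda>k. N k * r k))" unfolding carrier_perm_seqs by blast
  have rel: "u k (block (N k) z) = block (n k) (h k z)" if z: "z \<in> {1..N k} \<times> {..<r k}" for k z
  proof -
    have "block (N k) z \<in> {1..N k * r k}" using bij_betw_block z by (rule bij_betw_apply)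
    then show ?thesis unfolding u_def v_def
      by (simp only: if_True o_apply bij_betw_inv_into_left[OF bij_betw_block z])
  qed
  show "sof_equiv G \<omega> N \<phi> n \<theta>"
  proof (rule sof_equivI[OF rt refl])
    show "sofic_class \<omega> (\<lambda>k. N k * r k) u \<in> carrier (sofic_group \<omega> (\<lambda>k. N k * r k))"
      unfolding carrier_sofic_group using u by blast
  next
    fix g assume g: "g \<in> carrier G"
    show "sofic_class \<omega> (\<lambda>k. N k * r k) u \<otimes>\<^bsub>sofic_group \<omega> (\<lambda>k. N k * r k)\<^esub> amplify_class \<omega> N r (\<phi> g)
        \<otimes>\<^bsub>sofic_group \<omega> (\<lambda>k. N k * r k)\<^esub> inv\<^bsub>sofic_group \<omega> (\<lambda>k. N k * r k)\<^esub> sofic_class \<omega> (\<lambda>k. N k * r k) u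
      = amplify_class \<omega> n t (\<theta> g)"
      using sofic_conj_amplify_iff[OF rt bij u rel conjunct1[OF P[OF g]] conjunct1[OF Q[OF g]] refl, of \<omega>]
        lim[OF g] unfolding conjunct2[OF P[OF g]] conjunct2[OF Q[OF g]] by blast
  qed
qed

section \<open>Almost invariant sets in many copies\<close>

lemma card_slices:
  fixes t :: nat
  assumes "finite U" "Z \<subseteq> U \<times> {..<t}"
  shows "card Z = (\<Sum>j<t. card {x. (x, j) \<in> Z})"
proof -
  have fin: "finite {x. (x, j) \<in> Z}" for j
    using assms by (auto intro: finite_subset[of _ U])
  have "Z = (\<lambda>(j, x). (x, j)) ` (SIGMA j:{..<t}. {x. (x, j) \<in> Z})"
    using assms by (auto simp: image_iff)
  moreover have "inj_on (\<lambda>(j, x). (x, j)) (SIGMA j:{..<t}. {x. (x, j) \<in> Z})"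
    by (auto simp: inj_on_def)
  ultimately have "card Z = card (SIGMA j:{..<t}. {x. (x, j) \<in> Z})"
    using card_image by metis
  also have "\<dots> = (\<Sum>j<t. card {x. (x, j) \<in> Z})"
    by (rule card_SigmaI) (use fin in auto)
  finally show ?thesis .
qed

definition majority :: "nat \<Rightarrow> nat \<Rightarrow> (nat \<times> nat) set \<Rightarrow> nat set" where
  "majority n t A = {j. j < t \<and> n \<le> 2 * card {x. (x, j) \<in> A}}"

text \<open>In a copy with at most \<open>\<delta> n\<close> points of each boundary, the slice of
  \<open>A\<close> is almost empty or almost full by expansion, and the majority decides which.
  Any other copy has at most \<open>n\<close> points to go wrong, which is at most \<open>1 /
  \<delta>\<close> times the part of the boundaries in this copy.\<close>

lemma almost_invariant_near_slices:
  fixes \<epsilon> \<delta> :: real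
  assumes n: "n > 0" and exp: "expanding n \<epsilon> \<delta> (q ` I)" and I: "finite I"
    and \<epsilon>: "0 < \<epsilon>" "\<epsilon> < 1/2" and \<delta>: "\<delta> > 0" and A: "A \<subseteq> {1..n} \<times> {..<t}"
  shows "real (card (sym_diff A ({1..n} \<times> majority n t A)))
    \<le> \<epsilon> * real (n * t)
      + (\<Sum>i\<in>I. real (card (edge_boundary ({1..n} \<times> {..<t}) (map_prod (q i) id) A))) / \<delta>"
proof -
  let ?\<Delta> = "sym_diff A ({1..n} \<times> majority n t A)"
  let ?A = "\<lambda>j. {x. (x, j) \<in> A}"
  let ?b = "\<lambda>i j. real (card (edge_boundary {1..n} (q i) (?A j)))"
  have slice: "real (card {x. (x, j) \<in> ?\<Delta>}) \<le> \<epsilon> * real n + (\<Sum>i\<in>I. ?b i j) / \<delta>" if j: "j < t" for j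
  proof -
    have Aj: "?A j \<subseteq> {1..n}" using A by auto
    then have le: "card (?A j) \<le> n" using card_mono[of "{1..n}" "?A j"] by simp
    have card_diff: "card ({1..n} - ?A j) = n - card (?A j)"
      using card_Diff_subset[OF finite_subset[OF Aj] Aj] by simp
    have sl: "{x. (x, j) \<in> ?\<Delta>} = (if j \<in> majority n t A then {1..n} - ?A j else ?A j)"
      using A by auto
    have nonneg: "0 \<le> (\<Sum>i\<in>I. ?b i j) / \<delta>" using \<delta> by (intro divide_nonneg_pos sum_nonneg) auto
    show ?thesis
    proof (cases "\<forall>i\<in>I. ?b i j \<le> \<delta> * real n")
      case True
      then have "real (card (?A j)) \<le> \<epsilon> * real n \<or> (1 - \<epsilon>) * real n \<le> real (card (?A j))"
        using exp Aj unfolding expanding_def by blast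
      then have "real (card {x. (x, j) \<in> ?\<Delta>}) \<le> \<epsilon> * real n"
      proof
        assume small: "real (card (?A j)) \<le> \<epsilon> * real n"
        also have "\<dots> < 1/2 * real n" using \<epsilon> n by (intro mult_strict_right_mono) auto
        finally have "j \<notin> majority n t A" by (simp add: majority_def)
        then show ?thesis unfolding sl using small by simp
      next
        assume large: "(1 - \<epsilon>) * real n \<le> real (card (?A j))"
        have "1/2 * real n \<le> (1 - \<epsilon>) * real n" using \<epsilon> by (intro mult_right_mono) auto
        also note large
        finally have "j \<in> majority n t A" using j by (simp add: majority_def)
        moreover have "real (card ({1..n} - ?A j)) = real n - real (card (?A j))"
          using card_diff le by (simp add: of_nat_diff)
        ultimately show ?thesis unfolding sl using large by (simp add: algebra_simps)
      qed
      then show ?thesis using nonneg by linarith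
    next
      case False
      then obtain i where i: "i \<in> I" "\<delta> * real n < ?b i j" by force
      then have "\<delta> * real n \<le> (\<Sum>i\<in>I. ?b i j)"
        using member_le_sum[of i I "\<lambda>i. ?b i j"] I by force
      then have "real n \<le> (\<Sum>i\<in>I. ?b i j) / \<delta>" using \<delta> by (simp add: field_simps)
      moreover have "card {x. (x, j) \<in> ?\<Delta>} \<le> n" unfolding sl using le card_diff by simp
      moreover have "0 \<le> \<epsilon> * real n" using \<epsilon> by simp
      ultimately show ?thesis by linarith
    qed
  qed
  have boundary: "(\<Sum>j<t. ?b i j) = real (card (edge_boundary ({1..n} \<times> {..<t}) (map_prod (q i) id) A))" for i
  proof -
    have "{x. (x, j) \<in> edge_boundary ({1..n} \<times> {..<t}) (map_prod (q i) id) A} = edge_boundary {1..n} (q i) (?A j)"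
      if "j < t" for j
      using that by (auto simp: edge_boundary_def)
    then have "card (edge_boundary ({1..n} \<times> {..<t}) (map_prod (q i) id) A)
        = (\<Sum>j<t. card (edge_boundary {1..n} (q i) (?A j)))"
      by (subst card_slices[of "{1..n}"]) (auto simp: edge_boundary_def)
    then show ?thesis by simp
  qed
  have "card ?\<Delta> = (\<Sum>j<t. card {x. (x, j) \<in> ?\<Delta>})"
    using A by (intro card_slices[of "{1..n}"]) (auto simp: majority_def)
  then have "real (card ?\<Delta>) = (\<Sum>j<t. real (card {x. (x, j) \<in> ?\<Delta>}))" by simp
  also have "\<dots> \<le> (\<Sum>j<t. \<epsilon> * real n + (\<Sum>i\<in>I. ?b i j) / \<delta>)"
    by (rule sum_mono) (use slice in simp)
  also have "\<dots> = \<epsilon> * real (n * t) + (\<Sum>j<t. \<Sum>i\<in>I. ?b i j) / \<delta>"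
    by (simp add: sum.distrib sum_divide_distrib)
  also have "(\<Sum>j<t. \<Sum>i\<in>I. ?b i j) = (\<Sum>i\<in>I. \<Sum>j<t. ?b i j)" by (rule sum.swap)
  finally show ?thesis by (simp only: boundary)
qed

text \<open>A permutation moves as many points out of a finite set as into it, and it moves \<open>f
  x\<close> out of the image of \<open>f\<close> only if \<open>x\<close> is a mismatch.\<close>

lemma edge_boundary_image_le_mismatch:
  assumes fin: "finite X" "finite Y" and \<sigma>: "bij_betw \<sigma> Y Y" and inj: "inj_on f X"
    and img: "f ` X \<subseteq> Y" and \<pi>: "\<pi> ` X \<subseteq> X"
  shows "card (edge_boundary Y \<sigma> (f ` X)) \<le> 2 * card (mismatch X \<pi> \<sigma> f)"
proof -
  let ?A = "f ` X"
  define out inw where "out = {z \<in> ?A. \<sigma> z \<notin> ?A}" and "inw = {z \<in> Y - ?A. \<sigma> z \<in> ?A}"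
  have finM: "finite (mismatch X \<pi> \<sigma> f)" using finite_subset[OF mismatch_subset fin(1)] .
  have "out \<subseteq> f ` mismatch X \<pi> \<sigma> f"
  proof
    fix z assume "z \<in> out"
    then obtain x where x: "x \<in> X" "z = f x" "\<sigma> (f x) \<notin> ?A" by (auto simp: out_def)
    have "f (\<pi> x) \<in> ?A" using x \<pi> by blast
    then show "z \<in> f ` mismatch X \<pi> \<sigma> f" using x unfolding mismatch_def by force
  qed
  then have out: "card out \<le> card (mismatch X \<pi> \<sigma> f)"
    using surj_card_le[OF finM] by blast
  have "?A \<subseteq> \<sigma> ` Y" using \<sigma> img by (simp add: bij_betw_def)
  moreover have "\<sigma> ` {z \<in> Y. \<sigma> z \<in> C} = C" if "C \<subseteq> \<sigma> ` Y" for C using that by auto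
  ultimately have "\<sigma> ` {z \<in> Y. \<sigma> z \<in> ?A} = ?A" by blast
  moreover have "inj_on \<sigma> {z \<in> Y. \<sigma> z \<in> ?A}"
    using bij_betw_imp_inj_on[OF \<sigma>] by (rule inj_on_subset) blast
  ultimately have "bij_betw \<sigma> {z \<in> Y. \<sigma> z \<in> ?A} ?A" by (simp add: bij_betw_def)
  then have "card {z \<in> Y. \<sigma> z \<in> ?A} = card ?A" by (rule bij_betw_same_card)
  moreover have "{z \<in> Y. \<sigma> z \<in> ?A} = (?A - out) \<union> inw" using img by (auto simp: out_def inw_def)
  then have "card {z \<in> Y. \<sigma> z \<in> ?A} = card ((?A - out) \<union> inw)" by (rule arg_cong)
  moreover have "card ((?A - out) \<union> inw) = card (?A - out) + card inw"
    by (rule card_Un_disjoint) (use fin in \<open>auto simp: inw_def\<close>)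
  moreover have "card (?A - out) = card ?A - card out"
    by (rule card_Diff_subset) (use fin in \<open>auto simp: out_def\<close>)
  moreover have "card out \<le> card ?A" by (rule card_mono) (use fin in \<open>auto simp: out_def\<close>)
  ultimately have "card inw = card out" by linarith
  moreover have "edge_boundary Y \<sigma> ?A = out \<union> inw"
    using img by (auto simp: edge_boundary_def out_def inw_def)
  ultimately show ?thesis using out card_Un_le[of out inw] by simp
qed

section \<open>From an almost equivariant embedding to a conjugacy\<close>

text \<open>The domain of \<open>\<iota>\<close> has \<open>\<alpha> = N * card J\<close> points and
  \<open>{1..n} \<times> B\<close> has \<open>\<beta> = n * card B\<close> points, so
  \<open>\<beta>\<close> copies of the former can be matched with \<open>\<alpha>\<close> copies
  of the latter. On the first \<open>min \<alpha> \<beta>\<close> copies, \<open>\<iota>\<close>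
  is used wherever it leads into \<open>{1..n} \<times> B\<close>, and this is extended to a
  bijection arbitrarily. The bijection does not depend on \<open>P\<close> and \<open>Q\<close>,
  and it inherits the mismatches of \<open>\<iota>\<close>. Further ones come only from points
  that \<open>\<iota>\<close> takes out of \<open>{1..n} \<times> B\<close>, from preimages of
  these points under \<open>P\<close>, and from the copies beyond the first \<open>min \<alpha>
  \<beta>\<close>. All of them are controlled by the symmetric difference.\<close>

lemma matching_of_embedding:
  fixes \<iota> :: "nat \<times> 'j \<Rightarrow> nat \<times> nat"
  assumes J: "finite J" "J \<noteq> {}" and B: "finite B" "B \<noteq> {}" and N: "0 < N" and n: "0 < n"
    and inj: "inj_on \<iota> ({1..N} \<times> J)"
  obtains r t h where "0 < r" "0 < t" "N * r = n * t"
    "bij_betw h ({1..N} \<times> {..<r}) ({1..n} \<times> {..<t})"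
    "\<And>P Q. P permutes {1..N} \<Longrightarrow>
       real (card (mismatch ({1..N} \<times> {..<r}) (map_prod P id) (map_prod Q id) h)) / real (N * r)
       \<le> real (card (sym_diff (\<iota> ` ({1..N} \<times> J)) ({1..n} \<times> B))) / real (n * card B)
         + (2 * real (card (sym_diff (\<iota> ` ({1..N} \<times> J)) ({1..n} \<times> B)))
            + real (card (mismatch ({1..N} \<times> J) (map_prod P id) (map_prod Q id) \<iota>))) / real (N * card J)"
proof -
  define \<alpha> \<beta> where "\<alpha> = N * card J" and "\<beta> = n * card B"
  define A where "A = \<iota> ` ({1..N} \<times> J)"
  define \<Delta> where "\<Delta> = sym_diff A ({1..n} \<times> B)"
  define m where "m = min \<alpha> \<beta>"
  define X Y where "X = {1..N} \<times> (J \<times> {..<\<beta>})" and "Y = {1..n} \<times> (B \<times> {..<\<alpha>})"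
  define f where "f = (\<lambda>(x, j, l). (fst (\<iota> (x, j)), snd (\<iota> (x, j)), l :: nat))"
  define D where "D = {(x, j, l). x \<in> {1..N} \<and> j \<in> J \<and> l < m \<and> \<iota> (x, j) \<in> {1..n} \<times> B}"
  have pos: "0 < \<alpha>" "0 < \<beta>" using assms by (auto simp: \<alpha>_def \<beta>_def card_gt_0_iff)
  have finXY: "finite X" "finite Y" using J B by (auto simp: X_def Y_def)
  have cXY: "card X = card Y" by (simp add: X_def Y_def card_cartesian_product \<alpha>_def \<beta>_def)
  have cX: "card X = \<alpha> * \<beta>" by (simp add: X_def card_cartesian_product \<alpha>_def)
  have DX: "D \<subseteq> X" by (auto simp: D_def X_def m_def)
  have injf: "inj_on f D"
  proof (rule inj_onI)
    fix z z' assume "z \<in> D" "z' \<in> D" and eq: "f z = f z'"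
    then obtain x j l x' j' l' where z: "z = (x, j, l)" "x \<in> {1..N}" "j \<in> J"
      and z': "z' = (x', j', l')" "x' \<in> {1..N}" "j' \<in> J" by (auto simp: D_def)
    have "f (x, j, l) = f (x', j', l')" using eq unfolding z(1) z'(1) .
    then have "\<iota> (x, j) = \<iota> (x', j')" "l = l'" by (simp_all add: f_def prod_eq_iff)
    then show "z = z'" using inj_onD[OF inj, of "(x, j)" "(x', j')"] z z' by simp
  qed
  have "f ` D \<subseteq> Y"
  proof (rule image_subsetI)
    fix z assume "z \<in> D"
    then obtain x j l where "z = (x, j, l)" "l < m" "\<iota> (x, j) \<in> {1..n} \<times> B" by (auto simp: D_def)
    then show "f z \<in> Y" by (simp add: f_def Y_def m_def mem_Times_iff del: atLeastAtMost_iff)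
  qed
  then obtain h0 where h0: "bij_betw h0 X Y" "\<And>z. z \<in> D \<Longrightarrow> h0 z = f z"
    using extend_to_bij_betw[OF finXY cXY DX injf] by blast
  \<comment> \<open>Only the sizes of the index sets matter, so initial segments can take their place.\<close>
  define r t where "r = card J * \<beta>" and "t = card B * \<alpha>"
  obtain e where e: "bij_betw e {..<r} (J \<times> {..<\<beta>})"
    using finite_same_card_bij[of "{..<r}" "J \<times> {..<\<beta>}"] J by (auto simp: r_def card_cartesian_product)
  obtain e' where e': "bij_betw e' (B \<times> {..<\<alpha>}) {..<t}"
    using finite_same_card_bij[of "B \<times> {..<\<alpha>}" "{..<t}"] B by (auto simp: t_def card_cartesian_product)
  define h where "h = map_prod id e' \<circ> (h0 \<circ> map_prod id e)"
  have be: "bij_betw (map_prod id e) ({1..N} \<times> {..<r}) X"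
    unfolding X_def by (rule bij_betw_map_prod[OF bij_betw_id e])
  have be': "bij_betw (map_prod id e') Y ({1..n} \<times> {..<t})"
    unfolding Y_def by (rule bij_betw_map_prod[OF bij_betw_id e'])
  have bij: "bij_betw h ({1..N} \<times> {..<r}) ({1..n} \<times> {..<t})"
    unfolding h_def by (rule bij_betw_trans[OF bij_betw_trans[OF be h0(1)] be'])
  have bound: "real (card (mismatch ({1..N} \<times> {..<r}) (map_prod P id) (map_prod Q id) h)) / real (N * r)
       \<le> real (card \<Delta>) / real \<beta>
         + (2 * real (card \<Delta>) + real (card (mismatch ({1..N} \<times> J) (map_prod P id) (map_prod Q id) \<iota>))) / real \<alpha>"
    if P: "P permutes {1..N}" for P Q
  proof -
    let ?M = "mismatch ({1..N} \<times> J) (map_prod P id) (map_prod Q id) \<iota>"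
    define K where "K = {z \<in> {1..N} \<times> J. \<iota> z \<notin> {1..n} \<times> B}"
    define K' where "K' = {z \<in> {1..N} \<times> J. map_prod P id z \<in> K}"
    define E where "E = ({1..N} \<times> J) \<times> {m..<\<beta>} \<union> (K \<union> K' \<union> ?M) \<times> {..<\<beta>}"
    have finK: "finite K" "finite K'" "finite ?M" using J by (auto simp: K_def K'_def mismatch_def)
    have fin\<Delta>: "finite \<Delta>" using J B by (simp add: \<Delta>_def A_def)
    have "inj_on \<iota> K" by (rule inj_on_subset[OF inj]) (auto simp: K_def)
    moreover have "\<iota> ` K \<subseteq> \<Delta>"
    proof (rule image_subsetI)
      fix z assume "z \<in> K"
      then have "z \<in> {1..N} \<times> J \<and> \<iota> z \<notin> {1..n} \<times> B" unfolding K_def by (rule CollectD)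
      then show "\<iota> z \<in> \<Delta>" by (simp only: \<Delta>_def A_def Un_iff Diff_iff image_eqI simp_thms)
    qed
    ultimately have K: "card K \<le> card \<Delta>" using fin\<Delta> by (rule card_inj_on_le)
    have "inj_on (map_prod P id) K'"
      using permutes_inj[OF P] by (auto simp: inj_on_def dest: injD)
    then have K': "card K' \<le> card K" using finK by (intro card_inj_on_le[of "map_prod P id"]) (auto simp: K'_def)
    have cA: "card A = \<alpha>" unfolding A_def card_image[OF inj] by (simp add: card_cartesian_product \<alpha>_def)
    have "\<beta> - card A \<le> card (({1..n} \<times> B) - A)"
      using diff_card_le_card_Diff[of A "{1..n} \<times> B"] J by (simp add: A_def \<beta>_def card_cartesian_product)
    also have "\<dots> \<le> card \<Delta>" by (rule card_mono[OF fin\<Delta>]) (auto simp: \<Delta>_def)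
    finally have \<beta>m: "\<beta> - m \<le> card \<Delta>" by (simp add: m_def cA min_def)
    have Pmem: "P x \<in> {1..N} \<longleftrightarrow> x \<in> {1..N}" for x by (rule permutes_in_image[OF P])
    have "mismatch X (map_prod P id) (map_prod Q id) h0 \<subseteq> (\<lambda>((x, j), l). (x, j, l)) ` E"
    proof
      fix z assume z: "z \<in> mismatch X (map_prod P id) (map_prod Q id) h0"
      then obtain x j l where zx: "z = (x, j, l)" "x \<in> {1..N}" "j \<in> J" "l < \<beta>"
        by (auto simp: mismatch_def X_def)
      have ne: "h0 (P x, j, l) \<noteq> map_prod Q id (h0 (x, j, l))"
        using z zx by (simp add: mismatch_def)
      have "((x, j), l) \<in> E"
      proof (rule ccontr)
        assume "((x, j), l) \<notin> E"
        then have l: "l < m" and nK: "(x, j) \<notin> K" "(x, j) \<notin> K'" "(x, j) \<notin> ?M"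
          using zx by (auto simp: E_def)
        have "(x, j, l) \<in> D" using l nK(1) zx
          by (simp add: D_def K_def del: atLeastAtMost_iff)
        moreover have "(P x, j, l) \<in> D"
          using l nK(2) zx Pmem[of x] by (simp add: D_def K_def K'_def del: atLeastAtMost_iff)
        moreover have "\<iota> (P x, j) = map_prod Q id (\<iota> (x, j))"
          using nK(3) zx by (simp add: mismatch_def)
        ultimately show False using ne by (simp add: h0(2) f_def)
      qed
      then show "z \<in> (\<lambda>((x, j), l). (x, j, l)) ` E"
        unfolding zx(1) by (intro image_eqI[of _ _ "((x, j), l)"]) auto
    qed
    then have "card (mismatch X (map_prod P id) (map_prod Q id) h0) \<le> card E"
      using surj_card_le[of E] finK J by (simp add: E_def)
    also have "\<dots> \<le> card (({1..N} \<times> J) \<times> {m..<\<beta>}) + card ((K \<union> K' \<union> ?M) \<times> {..<\<beta>})"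
      unfolding E_def by (rule card_Un_le)
    also have "\<dots> = \<alpha> * (\<beta> - m) + card (K \<union> K' \<union> ?M) * \<beta>"
      by (simp add: card_cartesian_product \<alpha>_def)
    also have "\<dots> \<le> \<alpha> * card \<Delta> + (card K + card K' + card ?M) * \<beta>"
      by (intro add_mono mult_le_mono order_trans[OF card_Un_le] \<beta>m) (auto intro: card_Un_le)
    also have "\<dots> \<le> \<alpha> * card \<Delta> + (2 * card \<Delta> + card ?M) * \<beta>"
      using K K' by (intro add_mono mult_le_mono) auto
    finally have h0_le: "card (mismatch X (map_prod P id) (map_prod Q id) h0)
        \<le> \<alpha> * card \<Delta> + (2 * card \<Delta> + card ?M) * \<beta>" .
    have "map_prod id e ` mismatch ({1..N} \<times> {..<r}) (map_prod P id) (map_prod Q id) h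
        \<subseteq> mismatch X (map_prod P id) (map_prod Q id) h0"
    proof (rule image_subsetI)
      fix z assume z: "z \<in> mismatch ({1..N} \<times> {..<r}) (map_prod P id) (map_prod Q id) h"
      have "map_prod P id (map_prod id e z) = map_prod id e (map_prod P id z)" by (cases z) simp
      moreover have "map_prod Q id (map_prod id e' y) = map_prod id e' (map_prod Q id y)" for y by (cases y) simp
      ultimately have "h0 (map_prod P id (map_prod id e z)) \<noteq> map_prod Q id (h0 (map_prod id e z))"
        using z by (auto simp: mismatch_def h_def)
      moreover have "map_prod id e z \<in> X"
        using z by (intro bij_betw_apply[OF be]) (auto simp: mismatch_def)
      ultimately show "map_prod id e z \<in> mismatch X (map_prod P id) (map_prod Q id) h0"
        unfolding mismatch_def by blast
    qed
    then have "card (mismatch ({1..N} \<times> {..<r}) (map_prod P id) (map_prod Q id) h)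
        \<le> card (mismatch X (map_prod P id) (map_prod Q id) h0)"
      by (rule card_inj_on_le[OF inj_on_subset[OF bij_betw_imp_inj_on[OF be] mismatch_subset] _
            finite_subset[OF mismatch_subset finXY(1)]])
    then have "real (card (mismatch ({1..N} \<times> {..<r}) (map_prod P id) (map_prod Q id) h))
        \<le> real (\<alpha> * card \<Delta> + (2 * card \<Delta> + card ?M) * \<beta>)"
      using h0_le by (simp only: of_nat_le_iff)
    moreover have "N * r = \<alpha> * \<beta>" by (simp add: r_def \<alpha>_def)
    ultimately show ?thesis using pos by (simp add: field_simps)
  qed
  show ?thesis
  proof (rule that[OF _ _ _ bij bound[unfolded \<Delta>_def A_def \<alpha>_def \<beta>_def]])
    show "0 < r" "0 < t" using pos J B by (auto simp: r_def t_def card_gt_0_iff)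
    show "N * r = n * t" by (simp add: r_def t_def \<alpha>_def \<beta>_def)
  qed
qed

text \<open>The image of \<open>\<iota>\<close> is almost invariant, hence close to a union of copies of
  \<open>{1..n}\<close> by expansion. As it occupies a proportion that tends to \<open>c >
  0\<close>, errors that are small compared to all copies are also small compared to this union,
  and \<open>matching_of_embedding\<close> applies. It gives nothing if no copy is selected, but
  this happens only outside a set of the filter, where any bijection will do.\<close>

lemma sof_equiv_of_embedding:
  fixes \<iota> :: "nat \<Rightarrow> nat \<times> 'j \<Rightarrow> nat \<times> nat"
  assumes P: "\<And>g. g \<in> carrier G \<Longrightarrow> P g \<in> carrier (perm_seqs N) \<and> \<phi> g = sofic_class \<omega> N (P g)"
    and Q: "\<And>g. g \<in> carrier G \<Longrightarrow> Q g \<in> carrier (perm_seqs n) \<and> \<theta> g = sofic_class \<omega> n (Q g)"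
    and pos: "\<And>k. 0 < N k" "\<And>k. 0 < n k" "\<And>k. 0 < t k" and J: "\<And>k. finite (J k)"
    and inj: "\<And>k. inj_on (\<iota> k) ({1..N k} \<times> J k)"
    and img: "\<And>k. \<iota> k ` ({1..N k} \<times> J k) \<subseteq> {1..n k} \<times> {..<t k}"
    and lim: "\<And>g. g \<in> carrier G \<Longrightarrow> ((\<lambda>k. real (card (mismatch ({1..N k} \<times> J k)
        (map_prod (P g k) id) (map_prod (Q g k) id) (\<iota> k))) / real (n k * t k)) \<longlongrightarrow> 0) \<omega>"
    and c: "c > 0" "((\<lambda>k. real (N k * card (J k)) / real (n k * t k)) \<longlongrightarrow> c) \<omega>"
    and I: "finite I" "I \<subseteq> carrier G"
    and exp: "\<And>\<epsilon>. \<epsilon> > 0 \<Longrightarrow> \<exists>\<delta>>0. \<forall>\<^sub>F k in \<omega>. expanding (n k) \<epsilon> \<delta> ((\<lambda>g. Q g k) ` I)"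
  shows "sof_equiv G \<omega> N \<phi> n \<theta>"
proof -
  define A where "A k = \<iota> k ` ({1..N k} \<times> J k)" for k
  define B where "B k = majority (n k) (t k) (A k)" for k
  define \<Delta> where "\<Delta> k = real (card (sym_diff (A k) ({1..n k} \<times> B k)))" for k
  define D where "D k = real (n k * t k)" for k
  define \<alpha> \<beta> where "\<alpha> k = real (N k * card (J k))" and "\<beta> k = real (n k * card (B k))" for k
  define m where "m g k = real (card (mismatch ({1..N k} \<times> J k)
        (map_prod (P g k) id) (map_prod (Q g k) id) (\<iota> k)))" for g k
  have D: "D k > 0" for k using pos by (simp add: D_def)
  have AY: "A k \<subseteq> {1..n k} \<times> {..<t k}" for k using img by (simp add: A_def)
  have finA: "finite (A k)" for k using J by (simp add: A_def)
  have finB: "finite (B k)" for k by (simp add: B_def majority_def)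
  have Pk: "P g k permutes {1..N k}" and Qk: "Q g k permutes {1..n k}" if "g \<in> carrier G" for g k
    using P[OF that] Q[OF that] unfolding carrier_perm_seqs by blast+
  have m: "((\<lambda>k. m g k / D k) \<longlongrightarrow> 0) \<omega>" if "g \<in> carrier G" for g
    using lim[OF that] by (simp add: m_def D_def)
  have \<alpha>: "((\<lambda>k. \<alpha> k / D k) \<longlongrightarrow> c) \<omega>" using c(2) by (simp add: \<alpha>_def D_def)
  define b where "b g k = real (card (edge_boundary ({1..n k} \<times> {..<t k}) (map_prod (Q g k) id) (A k)))" for g k
  have b_le: "b g k \<le> 2 * m g k" if g: "g \<in> carrier G" for g k
  proof -
    have "bij_betw (map_prod (Q g k) id) ({1..n k} \<times> {..<t k}) ({1..n k} \<times> {..<t k})"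
      by (rule bij_betw_map_prod[OF permutes_imp_bij[OF Qk[OF g]] bij_betw_id])
    moreover have "map_prod (P g k) id ` ({1..N k} \<times> J k) \<subseteq> {1..N k} \<times> J k"
      using map_prod_surj_on[OF permutes_image[OF Pk[OF g]], of id "J k" "J k" k] by simp
    ultimately have "card (edge_boundary ({1..n k} \<times> {..<t k}) (map_prod (Q g k) id) (A k))
        \<le> 2 * card (mismatch ({1..N k} \<times> J k) (map_prod (P g k) id) (map_prod (Q g k) id) (\<iota> k))"
      unfolding A_def using J img inj by (intro edge_boundary_image_le_mismatch) auto
    then show ?thesis unfolding b_def m_def by linarith
  qed
  have b: "((\<lambda>k. b g k / D k) \<longlongrightarrow> 0) \<omega>" if g: "g \<in> carrier G" for g
  proof (rule tendsto_sandwich[OF _ _ tendsto_const])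
    show "((\<lambda>k. 2 * (m g k / D k)) \<longlongrightarrow> 0) \<omega>" using tendsto_mult_right_zero[OF m[OF g]] .
    show "\<forall>\<^sub>F k in \<omega>. 0 \<le> b g k / D k" using D by (intro always_eventually) (simp add: b_def less_imp_le)
    show "\<forall>\<^sub>F k in \<omega>. b g k / D k \<le> 2 * (m g k / D k)"
      using b_le[OF g] D by (intro always_eventually) (simp add: divide_right_mono less_imp_le)
  qed
  have bsum: "((\<lambda>k. (\<Sum>g\<in>I. b g k) / D k) \<longlongrightarrow> 0) \<omega>"
    unfolding sum_divide_distrib using I b by (intro tendsto_null_sum) auto
  have \<Delta>: "((\<lambda>k. \<Delta> k / D k) \<longlongrightarrow> 0) \<omega>"
  proof (rule tendstoI)
    fix e :: real assume e: "e > 0"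
    \<comment> \<open>The majority separates almost empty from almost full slices only if \<open>\<epsilon> < 1/2\<close>.\<close>
    define \<epsilon> where "\<epsilon> = min (e / 2) (1 / 4)"
    have \<epsilon>: "0 < \<epsilon>" "\<epsilon> < 1/2" "\<epsilon> \<le> e / 2" using e by (auto simp: \<epsilon>_def)
    obtain \<delta> where \<delta>: "\<delta> > 0" and ex: "\<forall>\<^sub>F k in \<omega>. expanding (n k) \<epsilon> \<delta> ((\<lambda>g. Q g k) ` I)"
      using exp[OF \<epsilon>(1)] by blast
    have "\<forall>\<^sub>F k in \<omega>. (\<Sum>g\<in>I. b g k) / D k < \<delta> * (e / 2)"
      using order_tendstoD(2)[OF bsum, of "\<delta> * (e / 2)"] \<delta> e by simp
    with ex show "\<forall>\<^sub>F k in \<omega>. dist (\<Delta> k / D k) 0 < e"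
    proof eventually_elim
      case (elim k)
      have "\<Delta> k \<le> \<epsilon> * D k + (\<Sum>g\<in>I. b g k) / \<delta>"
        unfolding \<Delta>_def D_def b_def B_def
        by (rule almost_invariant_near_slices[OF pos(2) elim(1) I(1) \<epsilon>(1,2) \<delta> AY])
      then have "\<Delta> k / D k \<le> \<epsilon> + (\<Sum>g\<in>I. b g k) / D k / \<delta>"
        using D[of k] by (simp add: field_simps)
      moreover have "(\<Sum>g\<in>I. b g k) / D k / \<delta> < e / 2" 
        using elim(2) unfolding pos_divide_less_eq[OF \<delta>] by (simp only: mult.commute)
      ultimately have "\<Delta> k / D k < e" using \<epsilon>(3) by linarith
      moreover have "0 \<le> \<Delta> k / D k" using D[of k] by (simp add: \<Delta>_def)
      ultimately show ?case by simp
    qed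
  qed
  have diff: "\<bar>\<beta> k - \<alpha> k\<bar> \<le> \<Delta> k" for k
  proof -
    let ?C = "{1..n k} \<times> B k"
    have cA: "\<alpha> k = real (card (A k))" unfolding \<alpha>_def A_def card_image[OF inj] by (simp add: card_cartesian_product)
    have cC: "\<beta> k = real (card ?C)" by (simp add: \<beta>_def card_cartesian_product)
    have fin: "finite ?C" "finite (sym_diff (A k) ?C)" using finA finB by auto
    have "card (A k) \<le> card (?C \<union> sym_diff (A k) ?C)" "card ?C \<le> card (A k \<union> sym_diff (A k) ?C)"
      by (rule card_mono; use fin finA in auto)+
    then have "card (A k) \<le> card ?C + card (sym_diff (A k) ?C)" "card ?C \<le> card (A k) + card (sym_diff (A k) ?C)"
      using card_Un_le order_trans by blast+
    then show ?thesis unfolding cA cC \<Delta>_def by linarith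
  qed
  have "((\<lambda>k. \<beta> k / D k - \<alpha> k / D k) \<longlongrightarrow> 0) \<omega>"
  proof (rule tendsto_0_le[OF \<Delta>, where K = 1])
    show "\<forall>\<^sub>F k in \<omega>. norm (\<beta> k / D k - \<alpha> k / D k) \<le> norm (\<Delta> k / D k) * 1"
    proof (rule always_eventually, rule allI)
      fix k
      have "\<bar>\<beta> k / D k - \<alpha> k / D k\<bar> = \<bar>\<beta> k - \<alpha> k\<bar> / D k"
        using D[of k] by (simp add: diff_divide_distrib[symmetric] abs_divide)
      also have "\<dots> \<le> \<Delta> k / D k" using diff D[of k] by (intro divide_right_mono) auto
      finally show "norm (\<beta> k / D k - \<alpha> k / D k) \<le> norm (\<Delta> k / D k) * 1"
        unfolding real_norm_def mult_1_right by linarith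
    qed
  qed
  from tendsto_add[OF this \<alpha>] have \<beta>: "((\<lambda>k. \<beta> k / D k) \<longlongrightarrow> c) \<omega>" by simp
  define good where "good k r s h \<longleftrightarrow> 0 < r \<and> 0 < s \<and> N k * r = n k * s \<and>
      bij_betw h ({1..N k} \<times> {..<r}) ({1..n k} \<times> {..<s}) \<and>
      (J k \<noteq> {} \<and> B k \<noteq> {} \<longrightarrow> (\<forall>g\<in>carrier G.
        real (card (mismatch ({1..N k} \<times> {..<r}) (map_prod (P g k) id) (map_prod (Q g k) id) h)) / real (N k * r)
         \<le> \<Delta> k / \<beta> k + (2 * \<Delta> k + m g k) / \<alpha> k))" for k r s h
  have "\<exists>r s h. good k r s h" for k
  proof (cases "J k \<noteq> {} \<and> B k \<noteq> {}")
    case True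
    obtain r s h where "0 < r" "0 < s" "N k * r = n k * s"
      "bij_betw h ({1..N k} \<times> {..<r}) ({1..n k} \<times> {..<s})"
      "\<And>p q. p permutes {1..N k} \<Longrightarrow>
       real (card (mismatch ({1..N k} \<times> {..<r}) (map_prod p id) (map_prod q id) h)) / real (N k * r)
       \<le> real (card (sym_diff (\<iota> k ` ({1..N k} \<times> J k)) ({1..n k} \<times> B k))) / real (n k * card (B k))
         + (2 * real (card (sym_diff (\<iota> k ` ({1..N k} \<times> J k)) ({1..n k} \<times> B k)))
            + real (card (mismatch ({1..N k} \<times> J k) (map_prod p id) (map_prod q id) (\<iota> k)))) / real (N k * card (J k))"
      using True by (rule_tac matching_of_embedding[OF J[of k] _ finB[of k] _ pos(1)[of k] pos(2)[of k] inj[of k]]) blast+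
    then have "good k r s h" unfolding good_def \<Delta>_def \<beta>_def \<alpha>_def m_def A_def using Pk by blast
    then show ?thesis by blast
  next
    case False
    have "card ({1..N k} \<times> {..<n k}) = card ({1..n k} \<times> {..<N k})" by (simp add: card_cartesian_product)
    then obtain h where "bij_betw h ({1..N k} \<times> {..<n k}) ({1..n k} \<times> {..<N k})"
      using finite_same_card_bij[of "{1..N k} \<times> {..<n k}" "{1..n k} \<times> {..<N k}"] by auto
    then have "good k (n k) (N k) h" using False pos by (auto simp: good_def)
    then show ?thesis by blast
  qed
  then have "\<forall>k. \<exists>r s h. good k r s h" by blast
  then obtain r s h where good: "\<And>k. good k (r k) (s k) (h k)" unfolding choice_iff by blast
  have "(mismatch_rate N (P g) (Q g) r h \<longlongrightarrow> 0) \<omega>" if g: "g \<in> carrier G" for g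
  proof (rule tendsto_sandwich[OF _ _ tendsto_const])
    have "((\<lambda>k. (\<Delta> k / D k) / (\<beta> k / D k) + (2 * (\<Delta> k / D k) + m g k / D k) / (\<alpha> k / D k))
        \<longlongrightarrow> 0 / c + (2 * 0 + 0) / c) \<omega>"
      using c(1) by (intro tendsto_intros \<Delta> \<alpha> \<beta> m[OF g]) auto
    moreover have "(\<Delta> k / D k) / (\<beta> k / D k) + (2 * (\<Delta> k / D k) + m g k / D k) / (\<alpha> k / D k)
        = \<Delta> k / \<beta> k + (2 * \<Delta> k + m g k) / \<alpha> k" for k
      using D[of k] by (simp add: add_divide_distrib[symmetric])
    ultimately show "((\<lambda>k. \<Delta> k / \<beta> k + (2 * \<Delta> k + m g k) / \<alpha> k) \<longlongrightarrow> 0) \<omega>" by simp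
    show "\<forall>\<^sub>F k in \<omega>. 0 \<le> mismatch_rate N (P g) (Q g) r h k"
      by (rule always_eventually) (simp add: mismatch_rate_def)
    have "\<forall>\<^sub>F k in \<omega>. 0 < \<alpha> k / D k" "\<forall>\<^sub>F k in \<omega>. 0 < \<beta> k / D k"
      using order_tendstoD(1)[OF \<alpha> c(1)] order_tendstoD(1)[OF \<beta> c(1)] .
    then show "\<forall>\<^sub>F k in \<omega>. mismatch_rate N (P g) (Q g) r h k \<le> \<Delta> k / \<beta> k + (2 * \<Delta> k + m g k) / \<alpha> k"
    proof eventually_elim
      case (elim k)
      then have "J k \<noteq> {}" "B k \<noteq> {}" by (auto simp: \<alpha>_def \<beta>_def)
      then show ?case using good[of k] g unfolding good_def mismatch_rate_def by blast
    qed
  qed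
  then show ?thesis
    using good unfolding good_def
    by (intro iffD2[OF sof_equiv_iff[where P = P and Q = Q, OF P Q]] exI[of _ r] exI[of _ s] exI[of _ h]) auto
qed

text \<open>Here \<open>W\<close> is an action that contains an amplification of \<open>P\<close> as an
  invariant part, embedded by \<open>emb\<close>. Following an almost equivariant bijection
  \<open>h\<close> after this embedding, in each of the copies of \<open>W\<close>, gives an
  almost equivariant embedding of an amplification of \<open>P\<close>. Both summands of a
  direct sum are of this form.\<close>

lemma sof_equiv_summand:
  assumes P: "\<And>g. g \<in> carrier G \<Longrightarrow> P g \<in> carrier (perm_seqs N) \<and> \<phi> g = sofic_class \<omega> N (P g)"
    and Q: "\<And>g. g \<in> carrier G \<Longrightarrow> Q g \<in> carrier (perm_seqs n) \<and> \<theta> g = sofic_class \<omega> n (Q g)"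
    and pos: "\<And>k. 0 < N k" "\<And>k. 0 < n k"
    and rt: "\<And>k. 0 < r k \<and> 0 < t k \<and> d k * r k = n k * t k"
    and h: "\<And>k. bij_betw (h k) ({1..d k} \<times> {..<r k}) ({1..n k} \<times> {..<t k})"
    and lim: "\<And>g. g \<in> carrier G \<Longrightarrow> (mismatch_rate d (W g) (Q g) r h \<longlongrightarrow> 0) \<omega>"
    and emb_inj: "\<And>k. inj_on (emb k) ({1..N k} \<times> {..<R k})"
    and emb_img: "\<And>k. emb k ` ({1..N k} \<times> {..<R k}) \<subseteq> {1..d k}"
    and emb: "\<And>g k x j. g \<in> carrier G \<Longrightarrow> x \<in> {1..N k} \<Longrightarrow> j < R k \<Longrightarrow>
        W g k (emb k (x, j)) = emb k (P g k x, j)"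
    and c: "c > 0" "((\<lambda>k. real (N k * R k) / real (d k)) \<longlongrightarrow> c) \<omega>"
    and I: "finite I" "I \<subseteq> carrier G"
    and exp: "\<And>\<epsilon>. \<epsilon> > 0 \<Longrightarrow> \<exists>\<delta>>0. \<forall>\<^sub>F k in \<omega>. expanding (n k) \<epsilon> \<delta> ((\<lambda>g. Q g k) ` I)"
  shows "sof_equiv G \<omega> N \<phi> n \<theta>"
proof -
  define J where "J k = {..<R k} \<times> {..<r k}" for k
  define \<eta> where "\<eta> k = (\<lambda>(x, j, i :: nat). (emb k (x, j), i))" for k
  define \<iota> where "\<iota> k = h k \<circ> \<eta> k" for k
  have \<eta>_inj: "inj_on (\<eta> k) ({1..N k} \<times> J k)" for k
  proof (rule inj_onI)
    fix z z' assume z: "z \<in> {1..N k} \<times> J k" and z': "z' \<in> {1..N k} \<times> J k" and eq: "\<eta> k z = \<eta> k z'"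
    obtain x j i x' j' i' where zz: "z = (x, j, i)" "z' = (x', j', i')" by (metis prod_cases3)
    have "emb k (x, j) = emb k (x', j')" "i = i'" using eq unfolding zz by (simp_all add: \<eta>_def)
    then show "z = z'"
      using inj_onD[OF emb_inj[of k], of "(x, j)" "(x', j')"] z z' unfolding zz by (simp add: J_def)
  qed
  have \<eta>_img: "\<eta> k ` ({1..N k} \<times> J k) \<subseteq> {1..d k} \<times> {..<r k}" for k
    using emb_img[of k] by (auto simp: \<eta>_def J_def image_subset_iff simp del: atLeastAtMost_iff)
  have hinj: "inj_on (h k) (\<eta> k ` ({1..N k} \<times> J k))" for k
    using bij_betw_imp_inj_on[OF h[of k]] \<eta>_img[of k] by (rule inj_on_subset)
  show ?thesis
  proof (rule sof_equiv_of_embedding[where P = P and Q = Q and J = J and \<iota> = \<iota> and t = t, OF P Q pos _ _ _ _ _ c(1) _ I exp])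
    show "0 < t k" for k using rt by blast
    show "finite (J k)" for k by (simp add: J_def)
    show "inj_on (\<iota> k) ({1..N k} \<times> J k)" for k
      unfolding \<iota>_def by (rule comp_inj_on[OF \<eta>_inj hinj])
    show "\<iota> k ` ({1..N k} \<times> J k) \<subseteq> {1..n k} \<times> {..<t k}" for k
      using \<eta>_img[of k] bij_betw_imp_surj_on[OF h[of k]] unfolding \<iota>_def image_comp[symmetric] by blast
    have "real (N k * card (J k)) / real (n k * t k) = real (N k * R k) / real (d k)" for k
    proof -
      have "real (n k * t k) = real (d k) * real (r k)" using rt[of k] by (metis of_nat_mult)
      then show ?thesis using rt[of k] by (simp add: J_def card_cartesian_product)
    qed
    then show "((\<lambda>k. real (N k * card (J k)) / real (n k * t k)) \<longlongrightarrow> c) \<omega>" using c(2) by simp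
    fix g assume g: "g \<in> carrier G"
    show "((\<lambda>k. real (card (mismatch ({1..N k} \<times> J k)
        (map_prod (P g k) id) (map_prod (Q g k) id) (\<iota> k))) / real (n k * t k)) \<longlongrightarrow> 0) \<omega>"
    proof (rule tendsto_sandwich[OF _ _ tendsto_const lim[OF g]])
      have "real (card (mismatch ({1..N k} \<times> J k) (map_prod (P g k) id) (map_prod (Q g k) id) (\<iota> k))) / real (n k * t k)
         \<le> mismatch_rate d (W g) (Q g) r h k" for k
      proof -
        let ?M = "mismatch ({1..N k} \<times> J k) (map_prod (P g k) id) (map_prod (Q g k) id) (\<iota> k)"
        let ?M' = "mismatch ({1..d k} \<times> {..<r k}) (map_prod (W g k) id) (map_prod (Q g k) id) (h k)"
        have "\<eta> k ` ?M \<subseteq> ?M'"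
        proof (rule image_subsetI)
          fix z assume z: "z \<in> ?M"
          have zX: "z \<in> {1..N k} \<times> J k" by (rule subsetD[OF mismatch_subset z])
          obtain x j i where zz: "z = (x, j, i)" by (metis prod_cases3)
          have "map_prod (W g k) id (\<eta> k z) = \<eta> k (map_prod (P g k) id z)"
            using zX emb[OF g, of x k j] unfolding zz by (simp add: \<eta>_def J_def)
          then have "h k (map_prod (W g k) id (\<eta> k z)) \<noteq> map_prod (Q g k) id (h k (\<eta> k z))"
            using z by (simp add: mismatch_def \<iota>_def)
          moreover have "\<eta> k z \<in> {1..d k} \<times> {..<r k}" by (rule subsetD[OF \<eta>_img imageI[OF zX]])
          ultimately show "\<eta> k z \<in> ?M'" unfolding mismatch_def by (intro CollectI conjI)
        qed
        moreover have "finite ?M'" by (rule finite_subset[OF mismatch_subset]) simp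
        ultimately have "card ?M \<le> card ?M'"
          by (rule card_inj_on_le[OF inj_on_subset[OF \<eta>_inj mismatch_subset]])
        then show ?thesis unfolding mismatch_rate_def using rt[of k]
          by (simp add: divide_right_mono flip: of_nat_mult)
      qed
      then show "\<forall>\<^sub>F k in \<omega>. real (card (mismatch ({1..N k} \<times> J k)
        (map_prod (P g k) id) (map_prod (Q g k) id) (\<iota> k))) / real (n k * t k) \<le> mismatch_rate d (W g) (Q g) r h k"
        by (rule always_eventually[OF allI])
    qed (simp add: always_eventually)
  qed
qed

section \<open>Expansion implies extremality\<close>

lemma Sof_eq_sof_class:
  assumes "X \<in> Sof G \<omega>" "(n, \<theta>) \<in> X"
  shows "(n, \<theta>) \<in> sofic_reps G \<omega>" "X = sof_class G \<omega> n \<theta>"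
proof -
  obtain y where y: "y \<in> sofic_reps G \<omega>" "X = sof_rel G \<omega> `` {y}"
    using assms(1) unfolding Sof_def by (rule quotientE)
  then have rel: "(y, (n, \<theta>)) \<in> sof_rel G \<omega>" using assms(2) by simp
  then show "(n, \<theta>) \<in> sofic_reps G \<omega>" unfolding sof_rel_def by blast
  show "X = sof_class G \<omega> n \<theta>"
    unfolding y(2) sof_class_def by (rule equiv_class_eq[OF equiv_sof_rel rel])
qed

lemma sof_class_eq_if_sof_equiv:
  assumes "(n, \<theta>) \<in> sofic_reps G \<omega>" "(m, \<psi>) \<in> sofic_reps G \<omega>" "sof_equiv G \<omega> n \<theta> m \<psi>"
  shows "sof_class G \<omega> n \<theta> = sof_class G \<omega> m \<psi>"
  unfolding sof_class_def
  by (rule equiv_class_eq[OF equiv_sof_rel]) (use assms in \<open>simp add: sof_rel_def\<close>)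

lemma sofic_reps_lift:
  assumes "(n, \<theta>) \<in> sofic_reps G \<omega>"
  shows "\<exists>P. \<forall>g\<in>carrier G. P g \<in> carrier (perm_seqs n) \<and> \<theta> g = sofic_class \<omega> n (P g)"
proof -
  have "\<exists>p. p \<in> carrier (perm_seqs n) \<and> \<theta> g = sofic_class \<omega> n p" if "g \<in> carrier G" for g
    using sofic_reps_closed[OF assms that] unfolding carrier_sofic_group by blast
  then show ?thesis by (intro bchoice) blast
qed

theorem is_extreme_point_if_expanding:
  assumes rep: "(n, \<theta>) \<in> sofic_reps G \<omega>"
    and Q: "\<And>g. g \<in> carrier G \<Longrightarrow> Q g \<in> carrier (perm_seqs n) \<and> \<theta> g = sofic_class \<omega> n (Q g)"
    and I: "finite I" "I \<subseteq> carrier G"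
    and exp: "\<And>\<epsilon>. \<epsilon> > 0 \<Longrightarrow> \<exists>\<delta>>0. \<forall>\<^sub>F k in \<omega>. expanding (n k) \<epsilon> \<delta> ((\<lambda>g. Q g k) ` I)"
  shows "is_extreme_point G \<omega> (sof_class G \<omega> n \<theta>)"
  unfolding is_extreme_point_def
proof (intro conjI allI impI)
  show "sof_class G \<omega> n \<theta> \<in> Sof G \<omega>" unfolding Sof_def sof_class_def using rep by (rule quotientI)
next
  fix c X Y
  assume "0 < c \<and> c < 1 \<and> X \<in> Sof G \<omega> \<and> Y \<in> Sof G \<omega> \<and> is_convex_combination G \<omega> c X Y (sof_class G \<omega> n \<theta>)"
  then have c: "0 < c" "c < 1" and X: "X \<in> Sof G \<omega>" and Y: "Y \<in> Sof G \<omega>"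
    and conv: "is_convex_combination G \<omega> c X Y (sof_class G \<omega> n \<theta>)" by blast+
  from conv obtain N \<phi> M \<psi> R T where \<phi>: "(N, \<phi>) \<in> X" and \<psi>: "(M, \<psi>) \<in> Y"
    and RT: "\<And>k. 0 < R k \<and> 0 < T k"
    and limc: "((\<lambda>k. real (N k * R k) / real (N k * R k + M k * T k)) \<longlongrightarrow> c) \<omega>"
    and cls: "sof_class G \<omega> n \<theta> = sof_class G \<omega> (\<lambda>k. N k * R k + M k * T k)
             (\<lambda>g. sum_class \<omega> (\<lambda>k. N k * R k) (\<lambda>k. M k * T k)
                    (amplify_class \<omega> N R (\<phi> g)) (amplify_class \<omega> M T (\<psi> g)))"
    unfolding is_convex_combination_def by blast
  note rep\<phi> = Sof_eq_sof_class(1)[OF X \<phi>] and X_eq = Sof_eq_sof_class(2)[OF X \<phi>]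
  note rep\<psi> = Sof_eq_sof_class(1)[OF Y \<psi>] and Y_eq = Sof_eq_sof_class(2)[OF Y \<psi>]
  obtain P where P: "\<And>g. g \<in> carrier G \<Longrightarrow> P g \<in> carrier (perm_seqs N) \<and> \<phi> g = sofic_class \<omega> N (P g)"
    using sofic_reps_lift[OF rep\<phi>] by blast
  obtain P' where P': "\<And>g. g \<in> carrier G \<Longrightarrow> P' g \<in> carrier (perm_seqs M) \<and> \<psi> g = sofic_class \<omega> M (P' g)"
    using sofic_reps_lift[OF rep\<psi>] by blast
  have pos: "\<And>k. 0 < N k" "\<And>k. 0 < M k" "\<And>k. 0 < n k"
    using rep\<phi> rep\<psi> rep by (simp_all add: sofic_reps_def)
  define d where "d k = N k * R k + M k * T k" for k
  define W where "W g k = direct_sum (N k * R k) (amplify (N k) (R k) (P g k)) (amplify (M k) (T k) (P' g k))" for g k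
  define \<sigma> where "\<sigma> g = sum_class \<omega> (\<lambda>k. N k * R k) (\<lambda>k. M k * T k)
                    (amplify_class \<omega> N R (\<phi> g)) (amplify_class \<omega> M T (\<psi> g))" for g
  have W: "W g \<in> carrier (perm_seqs d) \<and> \<sigma> g = sofic_class \<omega> d (W g)" if g: "g \<in> carrier G" for g
  proof
    have Pg: "P g \<in> carrier (perm_seqs N)" "\<phi> g = sofic_class \<omega> N (P g)" using P[OF g] by blast+
    have P'g: "P' g \<in> carrier (perm_seqs M)" "\<psi> g = sofic_class \<omega> M (P' g)" using P'[OF g] by blast+
    show "W g \<in> carrier (perm_seqs d)"
      using amplify_carrier[OF Pg(1), of R] amplify_carrier[OF P'g(1), of T]
      unfolding carrier_perm_seqs W_def d_def using direct_sum_permutes by blast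
    show "\<sigma> g = sofic_class \<omega> d (W g)"
      unfolding \<sigma>_def Pg(2) P'g(2) amplify_class_eq[OF Pg(1) conjunct1[OF RT]]
        amplify_class_eq[OF P'g(1) conjunct2[OF RT]]
        sum_class_eq[OF amplify_carrier[OF Pg(1)] amplify_carrier[OF P'g(1)]]
      by (simp add: d_def[abs_def] W_def[abs_def])
  qed
  have "(n, \<theta>) \<in> sof_class G \<omega> n \<theta>"
    unfolding sof_class_def by (rule equiv_class_self[OF equiv_sof_rel rep])
  then have "(n, \<theta>) \<in> sof_class G \<omega> d \<sigma>" unfolding cls by (simp add: d_def[abs_def] \<sigma>_def[abs_def])
  then have equiv: "sof_equiv G \<omega> d \<sigma> n \<theta>" by (simp add: sof_class_def sof_rel_def)
  have "\<exists>r t h. (\<forall>k. 0 < r k \<and> 0 < t k \<and> d k * r k = n k * t k) \<and>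
      (\<forall>k. bij_betw (h k) ({1..d k} \<times> {..<r k}) ({1..n k} \<times> {..<t k})) \<and>
      (\<forall>g\<in>carrier G. (mismatch_rate d (W g) (Q g) r h \<longlongrightarrow> 0) \<omega>)"
    by (rule iffD1[OF sof_equiv_iff[where P = W and Q = Q, OF W Q] equiv])
  then obtain r t h where rt: "\<And>k. 0 < r k \<and> 0 < t k \<and> d k * r k = n k * t k"
    and h: "\<And>k. bij_betw (h k) ({1..d k} \<times> {..<r k}) ({1..n k} \<times> {..<t k})"
    and lim: "\<And>g. g \<in> carrier G \<Longrightarrow> (mismatch_rate d (W g) (Q g) r h \<longlongrightarrow> 0) \<omega>"
    by blast
  have blockN: "block (N k) z \<in> {1..N k * R k}" if "z \<in> {1..N k} \<times> {..<R k}" for k z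
    using bij_betw_block that by (rule bij_betw_apply)
  have blockM: "block (M k) z \<in> {1..M k * T k}" if "z \<in> {1..M k} \<times> {..<T k}" for k z
    using bij_betw_block that by (rule bij_betw_apply)
  have "sof_equiv G \<omega> N \<phi> n \<theta>"
  proof (rule sof_equiv_summand[where P = P and Q = Q and W = W and emb = "\<lambda>k. block (N k)" and R = R,
        OF P Q pos(1,3) rt h lim _ _ _ _ _ I exp])
    show "inj_on (block (N k)) ({1..N k} \<times> {..<R k})" for k by (rule bij_betw_imp_inj_on[OF bij_betw_block])
    show "block (N k) ` ({1..N k} \<times> {..<R k}) \<subseteq> {1..d k}" for k
      using blockN[of _ k] by (fastforce simp: d_def)
    fix g k x j assume "g \<in> carrier G" and xj: "x \<in> {1..N k}" "j < R k"
    then have "(x, j) \<in> {1..N k} \<times> {..<R k}" by simp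
    then show "W g k (block (N k) (x, j)) = block (N k) (P g k x, j)"
      using blockN[of "(x, j)" k] amplify_block_map_prod[of "(x, j)" "N k" "R k" "P g k"]
      by (simp add: W_def direct_sum_def)
  qed (use c limc in \<open>simp_all add: d_def\<close>)
  moreover have "sof_equiv G \<omega> M \<psi> n \<theta>"
  proof (rule sof_equiv_summand[where P = P' and Q = Q and W = W and R = T and c = "1 - c"
        and emb = "\<lambda>k z. N k * R k + block (M k) z", OF P' Q pos(2,3) rt h lim _ _ _ _ _ I exp])
    show "inj_on (\<lambda>z. N k * R k + block (M k) z) ({1..M k} \<times> {..<T k})" for k
      by (rule inj_onI, rule inj_onD[OF bij_betw_imp_inj_on[OF bij_betw_block]]) simp_all
    show "(\<lambda>z. N k * R k + block (M k) z) ` ({1..M k} \<times> {..<T k}) \<subseteq> {1..d k}" for k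
      using blockM[of _ k] by (fastforce simp: d_def)
    have "real (M k * T k) / real (d k) = 1 - real (N k * R k) / real (d k)" for k
    proof -
      have "0 < d k" using pos RT by (simp add: d_def)
      moreover have "real (d k) = real (N k * R k) + real (M k * T k)" by (simp add: d_def)
      ultimately show ?thesis by (simp add: field_simps)
    qed
    moreover have "((\<lambda>k. 1 - real (N k * R k) / real (d k)) \<longlongrightarrow> 1 - c) \<omega>"
      using limc unfolding d_def by (intro tendsto_intros)
    ultimately show "((\<lambda>k. real (M k * T k) / real (d k)) \<longlongrightarrow> 1 - c) \<omega>" by simp
    fix g k x j assume "g \<in> carrier G" and xj: "x \<in> {1..M k}" "j < T k"
    then have "(x, j) \<in> {1..M k} \<times> {..<T k}" by simp
    then show "W g k (N k * R k + block (M k) (x, j)) = N k * R k + block (M k) (P' g k x, j)"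
      using blockM[of "(x, j)" k] amplify_block_map_prod[of "(x, j)" "M k" "T k" "P' g k"]
      by (simp add: W_def direct_sum_def)
  qed (use c in simp_all)
  ultimately show "X = sof_class G \<omega> n \<theta>" "Y = sof_class G \<omega> n \<theta>"
    unfolding X_eq Y_eq using sof_class_eq_if_sof_equiv rep rep\<phi> rep\<psi> by blast+
qed

section \<open>The representation of the free group\<close>

lemma letter_act_cancels:
  assumes "bij a" "bij b" "cancels l l'"
  shows "letter_act a b l \<circ> letter_act a b l' = id"
proof -
  have "inv' g \<circ> g = id \<and> g \<circ> inv' g = id" if "bij g" for g :: "'a \<Rightarrow> 'a"
    using that by (auto simp: bij_is_inj surj_iff[symmetric] bij_is_surj)
  then show ?thesis using assms by (auto simp: letter_act_def cancels_def)
qed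

lemma word_act_cons_reduce:
  assumes "bij a" "bij b"
  shows "word_act a b (cons_reduce l w) = letter_act a b l \<circ> word_act a b w"
proof (cases w)
  case (Cons l' v)
  then show ?thesis using letter_act_cancels[OF assms, of l l'] by (auto simp: comp_assoc[symmetric])
qed simp

lemma word_act_mult:
  assumes "bij a" "bij b"
  shows "word_act a b (u \<otimes>\<^bsub>F2\<^esub> v) = word_act a b u \<circ> word_act a b v"
  unfolding F2_def free_group_def
  by (induction u) (auto simp: word_act_cons_reduce[OF assms] comp_assoc)

lemma carrier_F2: "carrier F2 = {w. reduced w}"
  by (simp add: F2_def free_group_def)

lemma one_F2: "\<one>\<^bsub>F2\<^esub> = []"
  by (simp add: F2_def free_group_def)

lemma one_sofic_group: "\<one>\<^bsub>sofic_group \<omega> n\<^esub> = sofic_class \<omega> n (\<lambda>k. id)"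
proof -
  interpret group "perm_seqs n" by (rule group_perm_seqs)
  have one: "\<one>\<^bsub>perm_seqs n\<^esub> = (\<lambda>k. id)" by (simp add: sym_group_one restrict_def)
  have "null_seqs \<omega> n \<subseteq> carrier (perm_seqs n)" by (auto simp: null_seqs_def)
  then have "null_seqs \<omega> n #>\<^bsub>perm_seqs n\<^esub> \<one>\<^bsub>perm_seqs n\<^esub> = null_seqs \<omega> n"
    by (rule coset_mult_one)
  then have "null_seqs \<omega> n = sofic_class \<omega> n (\<lambda>k. id)" unfolding sofic_class_def one ..
  moreover have "\<one>\<^bsub>sofic_group \<omega> n\<^esub> = null_seqs \<omega> n" by (simp add: sofic_group_def)
  ultimately show ?thesis by simp
qed

lemma id_carrier: "(\<lambda>k. id) \<in> carrier (perm_seqs n)"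
  unfolding carrier_perm_seqs by (simp add: permutes_id)

text \<open>The union bound: the proportions of the bad permutations add up to less than 1 for large
  \<open>n\<close>.\<close>

lemma exists_good_permutation:
  fixes C :: "(nat \<Rightarrow> (nat \<Rightarrow> nat) \<Rightarrow> bool) set"
  assumes fin: "finite C"
    and rare: "\<And>\<Phi>. \<Phi> \<in> C \<Longrightarrow> (\<lambda>n. real (card {b. b permutes {1..n} \<and> \<not> \<Phi> n b}) / fact n) \<longlonglongrightarrow> 0"
  shows "\<forall>\<^sub>F n in sequentially. \<exists>b. b permutes {1..n} \<and> (\<forall>\<Phi>\<in>C. \<Phi> n b)"
proof -
  have "(\<lambda>n. \<Sum>\<Phi>\<in>C. real (card {b. b permutes {1..n} \<and> \<not> \<Phi> n b}) / fact n) \<longlonglongrightarrow> 0"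
    by (rule tendsto_null_sum) (rule rare)
  then have "\<forall>\<^sub>F n in sequentially. (\<Sum>\<Phi>\<in>C. real (card {b. b permutes {1..n} \<and> \<not> \<Phi> n b}) / fact n) < 1"
    by (rule order_tendstoD) simp
  then show ?thesis
  proof eventually_elim
    case (elim n)
    show ?case
    proof (rule ccontr)
      assume none: "\<not> ?thesis"
      have "{b. b permutes {1..n}} \<subseteq> (\<Union>\<Phi>\<in>C. {b. b permutes {1..n} \<and> \<not> \<Phi> n b})" using none by blast
      then have "card {b. b permutes {1..n}} \<le> card (\<Union>\<Phi>\<in>C. {b. b permutes {1..n} \<and> \<not> \<Phi> n b})"
        by (intro card_mono finite_UN_I fin finite_permutes finite_atLeastAtMost)
      also have "\<dots> \<le> (\<Sum>\<Phi>\<in>C. card {b. b permutes {1..n} \<and> \<not> \<Phi> n b})" by (rule card_UN_le[OF fin])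
      finally have "fact n \<le> (\<Sum>\<Phi>\<in>C. card {b. b permutes {1..n} \<and> \<not> \<Phi> n b})"
        using card_permutations[of "{1..n}" n] by simp
      then have "real (fact n) \<le> real (\<Sum>\<Phi>\<in>C. card {b. b permutes {1..n} \<and> \<not> \<Phi> n b})"
        by (simp only: of_nat_le_iff)
      then show False using elim by (simp add: sum_divide_distrib[symmetric])
    qed
  qed
qed

lemma nonprincipal_le_sequentially:
  assumes "nonprincipal_ultrafilter \<omega>"
  shows "\<omega> \<le> sequentially"
proof (rule filter_leI)
  fix P assume "eventually P sequentially"
  then obtain K where K: "\<And>k. k \<ge> K \<Longrightarrow> P k" unfolding eventually_sequentially by blast
  have "\<forall>\<^sub>F k in \<omega>. \<forall>j\<in>{..<K}. k \<noteq> j"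
    using assms by (intro eventually_ball_finite) (auto simp: nonprincipal_ultrafilter_def)
  then show "eventually P \<omega>"
  proof eventually_elim
    case (elim k)
    then have "k \<ge> K" using not_le by auto
    then show ?case by (rule K)
  qed
qed

lemma expanding_mono: "expanding n \<epsilon> \<delta> S \<Longrightarrow> \<epsilon> \<le> \<epsilon>' \<Longrightarrow> expanding n \<epsilon>' \<delta> S"
proof -
  assume ex: "expanding n \<epsilon> \<delta> S" and le: "\<epsilon> \<le> \<epsilon>'"
  have "\<epsilon> * real n \<le> \<epsilon>' * real n" "(1 - \<epsilon>') * real n \<le> (1 - \<epsilon>) * real n"
    using le by (auto intro!: mult_right_mono)
  then show ?thesis using ex unfolding expanding_def by (meson order_trans)
qed

text \<open>The requirements with index \<open>k\<close> are finitely many, and those on expansion and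
  rigidity include the ones with smaller indices. So along a sequence of such permutations each
  requirement holds eventually.\<close>

lemma good_permutations_exist:
  fixes \<delta> \<rho> :: "nat \<Rightarrow> real"
  assumes \<delta>: "\<And>j. (\<lambda>n. real (card {b. b permutes {1..n} \<and> \<not> expanding n (1 / (real j + 1)) (\<delta> j) {cyc n, b}}) / fact n) \<longlonglongrightarrow> 0"
    and \<rho>: "\<And>j. (\<lambda>n. real (card {b. b permutes {1..n} \<and> \<not> rigid n (1 / (real j + 1)) (\<rho> j) {cyc n, b}}) / fact n) \<longlonglongrightarrow> 0"
  shows "\<exists>n b. 0 < n \<and> b permutes {1..n} \<and>
      (\<forall>j\<le>k. expanding n (1 / (real j + 1)) (\<delta> j) {cyc n, b} \<and> rigid n (1 / (real j + 1)) (\<rho> j) {cyc n, b}) \<and>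
      (\<forall>w. reduced w \<and> w \<noteq> [] \<and> length w \<le> k \<longrightarrow> 1 - 1 / (real k + 1) \<le> hamming_dist n (word_act (cyc n) b w) id)"
proof -
  define W where "W = {w :: (bool \<times> bool) list. reduced w \<and> w \<noteq> [] \<and> length w \<le> k}"
  have "finite W"
    using finite_lists_length_le[of "UNIV :: (bool \<times> bool) set" k] by (rule rev_finite_subset) (auto simp: W_def)
  define C where "C = (\<lambda>j n b. expanding n (1 / (real j + 1)) (\<delta> j) {cyc n, b}) ` {..k} \<union>
    (\<lambda>j n b. rigid n (1 / (real j + 1)) (\<rho> j) {cyc n, b}) ` {..k} \<union>
    (\<lambda>w n b. 1 - 1 / (real k + 1) \<le> hamming_dist n (word_act (cyc n) b w) id) ` W"
  have "\<forall>\<^sub>F n in sequentially. \<exists>b. b permutes {1..n} \<and> (\<forall>\<Phi>\<in>C. \<Phi> n b)"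
  proof (rule exists_good_permutation)
    show "finite C" using \<open>finite W\<close> by (simp add: C_def)
    fix \<Phi> assume "\<Phi> \<in> C"
    then consider j where "\<Phi> = (\<lambda>n b. expanding n (1 / (real j + 1)) (\<delta> j) {cyc n, b})"
      | j where "\<Phi> = (\<lambda>n b. rigid n (1 / (real j + 1)) (\<rho> j) {cyc n, b})"
      | w where "w \<in> W" "\<Phi> = (\<lambda>n b. 1 - 1 / (real k + 1) \<le> hamming_dist n (word_act (cyc n) b w) id)"
      unfolding C_def by blast
    then show "(\<lambda>n. real (card {b. b permutes {1..n} \<and> \<not> \<Phi> n b}) / fact n) \<longlonglongrightarrow> 0"
    proof cases
      case 1 then show ?thesis using \<delta> by simp
    next
      case 2 then show ?thesis using \<rho> by simp
    next
      case 3
      then have "reduced w" "w \<noteq> []" by (simp_all add: W_def)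
      then show ?thesis unfolding 3(2) by (rule free_fraction) simp
    qed
  qed
  then have "\<forall>\<^sub>F n in sequentially. 0 < n \<and> (\<exists>b. b permutes {1..n} \<and> (\<forall>\<Phi>\<in>C. \<Phi> n b))"
    by (rule eventually_conj[OF eventually_gt_at_top])
  then have "\<exists>n. 0 < n \<and> (\<exists>b. b permutes {1..n} \<and> (\<forall>\<Phi>\<in>C. \<Phi> n b))"
    by (rule eventually_happens'[OF sequentially_bot])
  then obtain n b where nb: "0 < n" "b permutes {1..n}" "\<And>\<Phi>. \<Phi> \<in> C \<Longrightarrow> \<Phi> n b"
    by blast
  have "expanding n (1 / (real j + 1)) (\<delta> j) {cyc n, b}" if "j \<le> k" for j
    using nb(3)[of "\<lambda>n b. expanding n (1 / (real j + 1)) (\<delta> j) {cyc n, b}"] that by (simp add: C_def)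
  moreover have "rigid n (1 / (real j + 1)) (\<rho> j) {cyc n, b}" if "j \<le> k" for j
    using nb(3)[of "\<lambda>n b. rigid n (1 / (real j + 1)) (\<rho> j) {cyc n, b}"] that by (simp add: C_def)
  moreover have "1 - 1 / (real k + 1) \<le> hamming_dist n (word_act (cyc n) b w) id" if "w \<in> W" for w
    using nb(3)[of "\<lambda>n b. 1 - 1 / (real k + 1) \<le> hamming_dist n (word_act (cyc n) b w) id"] that
    by (simp add: C_def)
  ultimately show ?thesis using nb(1,2) unfolding W_def by blast
qed

lemma inverse_index_small:
  assumes "(e :: real) > 0"
  obtains j where "1 / (real j + 1) < e"
  using reals_Archimedean[OF assms] by (auto simp: inverse_eq_divide add.commute)

theorem corollary3p15:
  fixes \<omega> :: "nat filter"
  assumes "nonprincipal_ultrafilter \<omega>"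
  shows "\<exists>(n :: nat \<Rightarrow> nat) \<theta>. (\<forall>k. 0 < n k) \<and>
           sofic_representation F2 \<omega> n \<theta> \<and>
           is_extreme_point F2 \<omega> (sof_class F2 \<omega> n \<theta>) \<and>
           commutant F2 \<omega> n \<theta> = {\<one>\<^bsub>sofic_group \<omega> n\<^esub>}"
proof -
  have \<omega>: "\<omega> \<noteq> bot" "\<omega> \<le> sequentially"
    using assms nonprincipal_le_sequentially by (auto simp: nonprincipal_ultrafilter_def ultrafilter_def)
  have ev_ge: "\<forall>\<^sub>F k in \<omega>. K \<le> k" for K :: nat
    using \<omega>(2) eventually_ge_at_top[of K] by (rule filter_leD)
  have "\<forall>j. \<exists>\<delta>>0. (\<lambda>n. real (card {b. b permutes {1..n} \<and>
      \<not> expanding n (1 / (real j + 1)) \<delta> {cyc n, b}}) / fact n) \<longlonglongrightarrow> 0"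
    by (intro allI expanding_fraction) simp
  then obtain \<delta> where \<delta>: "\<And>j. \<delta> j > 0" "\<And>j. (\<lambda>n. real (card {b. b permutes {1..n} \<and>
      \<not> expanding n (1 / (real j + 1)) (\<delta> j) {cyc n, b}}) / fact n) \<longlonglongrightarrow> 0"
    unfolding choice_iff by blast
  have "\<forall>j. \<exists>\<rho>>0. (\<lambda>n. real (card {b. b permutes {1..n} \<and>
      \<not> rigid n (1 / (real j + 1)) \<rho> {cyc n, b}}) / fact n) \<longlonglongrightarrow> 0"
    by (intro allI rigid_fraction) simp
  then obtain \<rho> where \<rho>: "\<And>j. \<rho> j > 0" "\<And>j. (\<lambda>n. real (card {b. b permutes {1..n} \<and>
      \<not> rigid n (1 / (real j + 1)) (\<rho> j) {cyc n, b}}) / fact n) \<longlonglongrightarrow> 0"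
    unfolding choice_iff by blast
  have "\<forall>k. \<exists>n b. 0 < n \<and> b permutes {1..n} \<and>
      (\<forall>j\<le>k. expanding n (1 / (real j + 1)) (\<delta> j) {cyc n, b} \<and> rigid n (1 / (real j + 1)) (\<rho> j) {cyc n, b}) \<and>
      (\<forall>w. reduced w \<and> w \<noteq> [] \<and> length w \<le> k \<longrightarrow> 1 - 1 / (real k + 1) \<le> hamming_dist n (word_act (cyc n) b w) id)"
    using good_permutations_exist[OF \<delta>(2) \<rho>(2)] by blast
  then obtain n b where n: "\<And>k. 0 < n k" and b: "\<And>k. b k permutes {1..n k}"
    and exp: "\<And>j k. j \<le> k \<Longrightarrow> expanding (n k) (1 / (real j + 1)) (\<delta> j) {cyc (n k), b k}"
    and rig: "\<And>j k. j \<le> k \<Longrightarrow> rigid (n k) (1 / (real j + 1)) (\<rho> j) {cyc (n k), b k}"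
    and free: "\<And>k w. reduced w \<Longrightarrow> w \<noteq> [] \<Longrightarrow> length w \<le> k \<Longrightarrow>
      1 - 1 / (real k + 1) \<le> hamming_dist (n k) (word_act (cyc (n k)) (b k) w) id"
    unfolding choice_iff by blast
  define Q where "Q w k = word_act (cyc (n k)) (b k) w" for w k
  define \<theta> where "\<theta> w = sofic_class \<omega> n (Q w)" for w
  have Q: "Q w \<in> carrier (perm_seqs n)" for w
    unfolding carrier_perm_seqs Q_def using word_act_permutes[OF cyc_permutes b] by blast
  have hom: "\<theta> \<in> hom F2 (sofic_group \<omega> n)"
  proof (rule homI)
    show "\<theta> w \<in> carrier (sofic_group \<omega> n)" for w unfolding \<theta>_def carrier_sofic_group using Q by blast
    fix u v
    have "Q (u \<otimes>\<^bsub>F2\<^esub> v) = (\<lambda>k. Q u k \<circ> Q v k)"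
      unfolding Q_def[abs_def] using word_act_mult[OF permutes_bij[OF cyc_permutes] permutes_bij[OF b]] by simp
    then show "\<theta> (u \<otimes>\<^bsub>F2\<^esub> v) = \<theta> u \<otimes>\<^bsub>sofic_group \<omega> n\<^esub> \<theta> v"
      unfolding \<theta>_def mult_sofic_class[OF Q Q] by simp
  qed
  have rep: "sofic_representation F2 \<omega> n \<theta>"
    unfolding sofic_representation_def
  proof (intro conjI hom ballI impI)
    fix w assume "w \<in> carrier F2" "w \<noteq> \<one>\<^bsub>F2\<^esub>"
    then have w: "reduced w" "w \<noteq> []" by (simp_all add: carrier_F2 one_F2)
    have "((\<lambda>k. hamming_dist (n k) (Q w k) id) \<longlongrightarrow> 1) \<omega>"
    proof (rule tendsto_sandwich[OF _ _ _ tendsto_const])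
      have "(\<lambda>k. 1 - 1 / (real k + 1)) \<longlonglongrightarrow> 1" by real_asymp
      then show "((\<lambda>k. 1 - 1 / (real k + 1)) \<longlongrightarrow> 1) \<omega>" by (rule tendsto_mono[OF \<omega>(2)])
      show "\<forall>\<^sub>F k in \<omega>. 1 - 1 / (real k + 1) \<le> hamming_dist (n k) (Q w k) id"
        using ev_ge[of "length w"] unfolding Q_def by eventually_elim (rule free[OF w])
      show "\<forall>\<^sub>F k in \<omega>. hamming_dist (n k) (Q w k) id \<le> 1"
        by (rule always_eventually) (simp add: hamming_dist_le_1)
    qed
    then show "sofic_dist \<omega> n (\<theta> w) \<one>\<^bsub>sofic_group \<omega> n\<^esub> = 1"
      unfolding \<theta>_def one_sofic_group by (rule sofic_dist_sofic_class[OF \<omega>(1) Q id_carrier])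
  qed
  let ?I = "{[(False, True)], [(True, True)]}"
  have I: "?I \<subseteq> carrier F2" by (auto simp: carrier_F2 reduced_def)
  have gens: "Q [(False, True)] k = cyc (n k)" "Q [(True, True)] k = b k" for k
    by (simp_all add: Q_def letter_act_def)
  have "is_extreme_point F2 \<omega> (sof_class F2 \<omega> n \<theta>)"
  proof (rule is_extreme_point_if_expanding[where Q = Q, OF _ _ _ I])
    show "(n, \<theta>) \<in> sofic_reps F2 \<omega>" using n rep by (simp add: sofic_reps_def)
    show "Q g \<in> carrier (perm_seqs n) \<and> \<theta> g = sofic_class \<omega> n (Q g)" for g
      unfolding \<theta>_def by (intro conjI Q refl)
    fix \<epsilon> :: real assume "\<epsilon> > 0"
    then obtain j where j: "1 / (real j + 1) < \<epsilon>" by (rule inverse_index_small)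
    have "\<forall>\<^sub>F k in \<omega>. expanding (n k) \<epsilon> (\<delta> j) ((\<lambda>g. Q g k) ` ?I)"
      using ev_ge[of j]
    proof eventually_elim
      case (elim k)
      then show ?case using expanding_mono[OF exp[OF elim] less_imp_le[OF j]] by (simp add: gens)
    qed
    then show "\<exists>\<delta>>0. \<forall>\<^sub>F k in \<omega>. expanding (n k) \<epsilon> \<delta> ((\<lambda>g. Q g k) ` ?I)" using \<delta>(1) by blast
  qed simp
  moreover have "commutant F2 \<omega> n \<theta> = {\<one>\<^bsub>sofic_group \<omega> n\<^esub>}"
  proof (intro equalityI subsetI)
    fix p assume "p \<in> commutant F2 \<omega> n \<theta>"
    then have p: "p \<in> carrier (sofic_group \<omega> n)"
      and comm: "\<And>g. g \<in> carrier F2 \<Longrightarrow> p \<otimes>\<^bsub>sofic_group \<omega> n\<^esub> \<theta> g = \<theta> g \<otimes>\<^bsub>sofic_group \<omega> n\<^esub> p"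
      by (auto simp: commutant_def)
    from p obtain q where q: "q \<in> carrier (perm_seqs n)" and pq: "p = sofic_class \<omega> n q"
      unfolding carrier_sofic_group by blast
    have lim: "((\<lambda>k. hamming_dist (n k) (q k \<circ> Q g k) (Q g k \<circ> q k)) \<longlongrightarrow> 0) \<omega>" if "g \<in> carrier F2" for g
      using comm[OF that] sofic_class_eq_iff[OF comp_carrier_perm_seqs[OF q Q] comp_carrier_perm_seqs[OF Q q]]
      unfolding pq \<theta>_def mult_sofic_class[OF q Q] mult_sofic_class[OF Q q] by blast
    have lim_a: "((\<lambda>k. hamming_dist (n k) (q k \<circ> cyc (n k)) (cyc (n k) \<circ> q k)) \<longlongrightarrow> 0) \<omega>"
      and lim_b: "((\<lambda>k. hamming_dist (n k) (q k \<circ> b k) (b k \<circ> q k)) \<longlongrightarrow> 0) \<omega>"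
      using lim[of "[(False, True)]"] lim[of "[(True, True)]"] I unfolding gens by blast+
    have "((\<lambda>k. hamming_dist (n k) (q k) id) \<longlongrightarrow> 0) \<omega>"
    proof (rule tendstoI)
      fix e :: real assume "e > 0"
      then obtain j where j: "1 / (real j + 1) < e" by (rule inverse_index_small)
      from ev_ge[of j] order_tendstoD(2)[OF lim_a \<rho>(1)[of j]] order_tendstoD(2)[OF lim_b \<rho>(1)[of j]]
      show "\<forall>\<^sub>F k in \<omega>. dist (hamming_dist (n k) (q k) id) 0 < e"
      proof eventually_elim
        case (elim k)
        have "q k permutes {1..n k}" using q unfolding carrier_perm_seqs by blast
        then have "hamming_dist (n k) (q k) id \<le> 1 / (real j + 1)"
          using rig[OF elim(1)] elim(2,3) unfolding rigid_def by (auto simp: less_imp_le)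
        then show ?case using j hamming_dist_nonneg[of "n k" "q k" id] by simp
      qed
    qed
    then show "p \<in> {\<one>\<^bsub>sofic_group \<omega> n\<^esub>}"
      unfolding pq one_sofic_group using sofic_class_eqI[OF q id_carrier] by blast
  next
    interpret group "sofic_group \<omega> n" by (rule group_sofic_group)
    fix p assume p: "p \<in> {\<one>\<^bsub>sofic_group \<omega> n\<^esub>}"
    have "\<one>\<^bsub>sofic_group \<omega> n\<^esub> \<otimes>\<^bsub>sofic_group \<omega> n\<^esub> \<theta> g = \<theta> g \<otimes>\<^bsub>sofic_group \<omega> n\<^esub> \<one>\<^bsub>sofic_group \<omega> n\<^esub>"
      if "g \<in> carrier F2" for g
      using l_one[OF hom_in_carrier[OF hom that]] r_one[OF hom_in_carrier[OF hom that]] by (rule trans[OF _ sym])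
    then show "p \<in> commutant F2 \<omega> n \<theta>" using p one_closed unfolding commutant_def by blast
  qed
  ultimately show ?thesis using n rep by blast
qed

end
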